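(* Let $A$ be an Artin algebra and $e$ an idempotent in $A$ such that $AeA$ is a strongly idempotent ideal with $\mathrm{pd}_A(AeA)<+\infty$. Then: (1) $\mathrm{fin.dim}(A)\leq\max\{2\,\mathrm{fin.dim}(eAe)+1,\ \mathrm{pd}_A(AeA)+\mathrm{fin.dim}(eAe)+\mathrm{fin.dim}(A/AeA)+2\}$; (2) $\mathrm{fin.dim}(A)\leq 2\,\mathrm{fin.dim}(eAe)+\mathrm{fin.dim}(A/AeA)+2$. In particular, if $\mathrm{fin.dim}(A/AeA)<+\infty$ and $\mathrm{fin.dim}(eAe)<+\infty$, then $\mathrm{fin.dim}(A)<+\infty$.
   Context: All modules are finitely generated left modules. $\mathrm{pd}_A(X)$ denotes the projective dimension of an $A$-module $X$; $\mathrm{pd}_A(AeA)$ is the projective dimension of $AeA$ as a left $A$-module. For an Artin algebra $\Lambda$, $\mathrm{fin.dim}(\Lambda)$ is the supremum (in $\mathbb{N}\cup\{+\infty\}$) of the projective dimensions of finitely generated $\Lambda$-modules of finite projective dimension. For an idempotent $e\in A$, every $A/AeA$-module is an $A$-module via the surjection $A\to A/AeA$. The two-sided ideal $AeA$ is called a strongly idempotent ideal if for all $A/AeA$-modules $X,Y$ and all $n\ge 0$ the induced natural map $\mathrm{Ext}^n_{A/AeA}(X,Y)\to \mathrm{Ext}^n_A(X,Y)$ is an isomorphism. *)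

theory Defs
  imports "HOL-Algebra.Module" "HOL-Algebra.QuotRing" "HOL-Library.Extended_Nat"
begin

text \<open>
  The locale \<^locale>\<open>module\<close> requires a commutative ring of scalars. Left modules over an
  arbitrary ring are given here on the same record type; its fields \<^const>\<open>mult\<close> and
  \<^const>\<open>one\<close> carry no meaning.
\<close>

locale left_module = R?: ring R + M?: abelian_group M
  for R :: "('r, 'x) ring_scheme" (structure) and M :: "('r, 'm) module" (structure) +
  assumes smult_closed [simp, intro]:
      "\<lbrakk>a \<in> carrier R; x \<in> carrier M\<rbrakk> \<Longrightarrow> a \<odot>\<^bsub>M\<^esub> x \<in> carrier M"
    and smult_l_distr:
      "\<lbrakk>a \<in> carrier R; b \<in> carrier R; x \<in> carrier M\<rbrakk> \<Longrightarrow>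
        (a \<oplus>\<^bsub>R\<^esub> b) \<odot>\<^bsub>M\<^esub> x = a \<odot>\<^bsub>M\<^esub> x \<oplus>\<^bsub>M\<^esub> b \<odot>\<^bsub>M\<^esub> x"
    and smult_r_distr:
      "\<lbrakk>a \<in> carrier R; x \<in> carrier M; y \<in> carrier M\<rbrakk> \<Longrightarrow>
        a \<odot>\<^bsub>M\<^esub> (x \<oplus>\<^bsub>M\<^esub> y) = a \<odot>\<^bsub>M\<^esub> x \<oplus>\<^bsub>M\<^esub> a \<odot>\<^bsub>M\<^esub> y"
    and smult_assoc:
      "\<lbrakk>a \<in> carrier R; b \<in> carrier R; x \<in> carrier M\<rbrakk> \<Longrightarrow>
        (a \<otimes>\<^bsub>R\<^esub> b) \<odot>\<^bsub>M\<^esub> x = a \<odot>\<^bsub>M\<^esub> (b \<odot>\<^bsub>M\<^esub> x)"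
    and smult_one [simp]:
      "x \<in> carrier M \<Longrightarrow> \<one>\<^bsub>R\<^esub> \<odot>\<^bsub>M\<^esub> x = x"

definition fg_left_module :: "('r, 'x) ring_scheme \<Rightarrow> ('r, 'm) module \<Rightarrow> bool" where
  "fg_left_module R M \<longleftrightarrow> left_module R M \<and>
     (\<exists>S. finite S \<and> S \<subseteq> carrier M \<and>
          (\<forall>N. submodule N R M \<and> S \<subseteq> N \<longrightarrow> N = carrier M))"

text \<open>
  Every finitely generated left \<open>R\<close>-module is isomorphic to a quotient of some \<open>R\<^sup>n\<close>, hence to a
  module whose elements are cosets, i.e. sets of functions \<open>nat \<Rightarrow> 'r\<close>. Quantification over
  all finitely generated \<open>R\<close>-modules up to isomorphism can thus be carried out on the
  following type.
\<close>

type_synonym 'r mod_univ = "(nat \<Rightarrow> 'r) set"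

definition mod_hom ::
  "('r, 'x) ring_scheme \<Rightarrow> ('r, 'm) module \<Rightarrow> ('r, 'n) module \<Rightarrow> ('m \<Rightarrow> 'n) set" where
  "mod_hom R M N =
     {f \<in> hom (add_monoid M) (add_monoid N).
        \<forall>r\<in>carrier R. \<forall>x\<in>carrier M. f (r \<odot>\<^bsub>M\<^esub> x) = r \<odot>\<^bsub>N\<^esub> f x}"

definition restrict_scalars :: "('s \<Rightarrow> 'r) \<Rightarrow> ('r, 'm) module \<Rightarrow> ('s, 'm) module" where
  "restrict_scalars \<phi> M =
     \<lparr>carrier = carrier M, mult = mult M, one = \<one>\<^bsub>M\<^esub>, zero = \<zero>\<^bsub>M\<^esub>, add = add M,
      smult = (\<lambda>s x. \<phi> s \<odot>\<^bsub>M\<^esub> x)\<rparr>"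

definition left_ideal_module :: "('r, 'x) ring_scheme \<Rightarrow> 'r set \<Rightarrow> ('r, 'r) module" where
  "left_ideal_module R I =
     \<lparr>carrier = I, mult = mult R, one = \<one>\<^bsub>R\<^esub>, zero = \<zero>\<^bsub>R\<^esub>, add = add R, smult = mult R\<rparr>"


definition comm_artinian_ring :: "('k, 'x) ring_scheme \<Rightarrow> bool" where
  "comm_artinian_ring k \<longleftrightarrow> cring k \<and>
     (\<forall>I :: nat \<Rightarrow> 'k set. (\<forall>n. ideal (I n) k) \<and> (\<forall>n. I (Suc n) \<subseteq> I n) \<longrightarrow>
        (\<exists>N. \<forall>n\<ge>N. I n = I N))"

definition artin_algebra ::
  "('k, 'x) ring_scheme \<Rightarrow> ('k \<Rightarrow> 'a) \<Rightarrow> ('a, 'y) ring_scheme \<Rightarrow> bool" where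
  "artin_algebra k \<phi> A \<longleftrightarrow>
     comm_artinian_ring k \<and> ring A \<and> \<phi> \<in> ring_hom k A \<and>
     (\<forall>r\<in>carrier k. \<forall>a\<in>carrier A. \<phi> r \<otimes>\<^bsub>A\<^esub> a = a \<otimes>\<^bsub>A\<^esub> \<phi> r) \<and>
     fg_left_module k (restrict_scalars \<phi> (left_ideal_module A (carrier A)))"

definition corner_ring :: "('a, 'x) ring_scheme \<Rightarrow> 'a \<Rightarrow> ('a, 'x) ring_scheme" where
  "corner_ring A e =
     A\<lparr>carrier := {e \<otimes>\<^bsub>A\<^esub> a \<otimes>\<^bsub>A\<^esub> e | a. a \<in> carrier A}, one := e\<rparr>"


text \<open>
  Projectivity is the lifting property in the category of finitely generated modules, which for
  a finitely generated module agrees with projectivity among all modules.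
\<close>

definition fg_projective :: "('r, 'x) ring_scheme \<Rightarrow> ('r, 'm) module \<Rightarrow> bool" where
  "fg_projective R P \<longleftrightarrow> fg_left_module R P \<and>
     (\<forall>(M :: ('r, 'r mod_univ) module) (N :: ('r, 'r mod_univ) module) p f.
        fg_left_module R M \<and> fg_left_module R N \<and>
        p \<in> mod_hom R M N \<and> p ` carrier M = carrier N \<and> f \<in> mod_hom R P N \<longrightarrow>
        (\<exists>g\<in>mod_hom R P M. \<forall>x\<in>carrier P. p (g x) = f x))"

text \<open>
  The complex \<open>\<dots> \<rightarrow> P 2 \<rightarrow> P 1 \<rightarrow> P 0 \<rightarrow> X \<rightarrow> 0\<close> with differentials
  \<open>d n : P (n + 1) \<rightarrow> P n\<close> and augmentation \<open>\<epsilon> : P 0 \<rightarrow> X\<close> is exact.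
\<close>

definition projective_resolution ::
  "('r, 'x) ring_scheme \<Rightarrow> ('r, 'm) module \<Rightarrow> (nat \<Rightarrow> ('r, 'r mod_univ) module) \<Rightarrow>
   (nat \<Rightarrow> 'r mod_univ \<Rightarrow> 'r mod_univ) \<Rightarrow> ('r mod_univ \<Rightarrow> 'm) \<Rightarrow> bool" where
  "projective_resolution R X P d \<epsilon> \<longleftrightarrow>
     (\<forall>n. fg_projective R (P n)) \<and>
     (\<forall>n. d n \<in> mod_hom R (P (Suc n)) (P n)) \<and>
     \<epsilon> \<in> mod_hom R (P 0) X \<and>
     \<epsilon> ` carrier (P 0) = carrier X \<and>
     a_kernel (P 0) X \<epsilon> = d 0 ` carrier (P (Suc 0)) \<and>
     (\<forall>n. a_kernel (P (Suc n)) (P n) (d n) = d (Suc n) ` carrier (P (Suc (Suc n))))"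

text \<open>
  The least length of a projective resolution, \<open>\<infinity>\<close> if there is no finite one. The zero
  module has projective dimension \<open>0\<close>.
\<close>

definition proj_dim :: "('r, 'x) ring_scheme \<Rightarrow> ('r, 'm) module \<Rightarrow> enat" where
  "proj_dim R X =
     Inf {enat n | n. \<exists>P d \<epsilon>. projective_resolution R X P d \<epsilon> \<and>
                       (\<forall>i>n. carrier (P i) = {\<zero>\<^bsub>P i\<^esub>})}"

definition fin_dim :: "('r, 'x) ring_scheme \<Rightarrow> enat" where
  "fin_dim R =
     Sup {proj_dim R X | X :: ('r, 'r mod_univ) module.
            fg_left_module R X \<and> proj_dim R X < \<infinity>}"


text \<open>
  For \<open>P\<close>, \<open>d\<close> a projective resolution of \<open>X\<close>, the group \<open>ext_group R P d Y n\<close> is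
  \<open>Ext\<^sup>n\<close> of \<open>X\<close> and \<open>Y\<close> over \<open>R\<close>, the \<open>n\<close>-th cohomology of the complex of
  homomorphisms from \<open>P\<close> to \<open>Y\<close>. Homomorphisms are taken extensional, so that equality of
  functions is equality of maps on the carrier.
\<close>

definition Hom_set ::
  "('r, 'x) ring_scheme \<Rightarrow> ('r, 'm) module \<Rightarrow> ('r, 'n) module \<Rightarrow> ('m \<Rightarrow> 'n) set" where
  "Hom_set R M N = mod_hom R M N \<inter> extensional (carrier M)"

definition ext_cocycles ::
  "('r, 'x) ring_scheme \<Rightarrow> (nat \<Rightarrow> ('r, 'p) module) \<Rightarrow> (nat \<Rightarrow> 'p \<Rightarrow> 'p) \<Rightarrow>
   ('r, 'n) module \<Rightarrow> nat \<Rightarrow> ('p \<Rightarrow> 'n) monoid" where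
  "ext_cocycles R P d Y n =
     \<lparr>carrier = {g \<in> Hom_set R (P n) Y. \<forall>x\<in>carrier (P (Suc n)). g (d n x) = \<zero>\<^bsub>Y\<^esub>},
      mult = (\<lambda>g h. \<lambda>x\<in>carrier (P n). g x \<oplus>\<^bsub>Y\<^esub> h x),
      one = (\<lambda>x\<in>carrier (P n). \<zero>\<^bsub>Y\<^esub>)\<rparr>"

definition ext_coboundaries ::
  "('r, 'x) ring_scheme \<Rightarrow> (nat \<Rightarrow> ('r, 'p) module) \<Rightarrow> (nat \<Rightarrow> 'p \<Rightarrow> 'p) \<Rightarrow>
   ('r, 'n) module \<Rightarrow> nat \<Rightarrow> ('p \<Rightarrow> 'n) set" where
  "ext_coboundaries R P d Y n =
     (case n of
        0 \<Rightarrow> {\<lambda>x\<in>carrier (P 0). \<zero>\<^bsub>Y\<^esub>}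
      | Suc m \<Rightarrow> {compose (carrier (P (Suc m))) h (d m) | h. h \<in> Hom_set R (P m) Y})"

definition ext_group ::
  "('r, 'x) ring_scheme \<Rightarrow> (nat \<Rightarrow> ('r, 'p) module) \<Rightarrow> (nat \<Rightarrow> 'p \<Rightarrow> 'p) \<Rightarrow>
   ('r, 'n) module \<Rightarrow> nat \<Rightarrow> ('p \<Rightarrow> 'n) set monoid" where
  "ext_group R P d Y n = ext_cocycles R P d Y n Mod ext_coboundaries R P d Y n"

text \<open>
  Let \<open>\<pi> : A \<rightarrow> B\<close> be a ring homomorphism and \<open>X\<close>, \<open>Y\<close> be \<open>B\<close>-modules, \<open>Q\<close> a
  projective resolution of \<open>X\<close> over \<open>B\<close> and \<open>P\<close> one over \<open>A\<close>. The natural map from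
  \<open>Ext\<close> over \<open>B\<close> to \<open>Ext\<close> over \<open>A\<close> is precomposition with an \<open>A\<close>-linear chain map
  \<open>f : P \<rightarrow> Q\<close> over the identity of \<open>X\<close>; such an \<open>f\<close> exists and is unique up to
  homotopy.
\<close>

definition comparison_map ::
  "('a, 'x) ring_scheme \<Rightarrow> ('a \<Rightarrow> 'b) \<Rightarrow> ('b, 'm) module \<Rightarrow>
   (nat \<Rightarrow> ('a, 'p) module) \<Rightarrow> (nat \<Rightarrow> 'p \<Rightarrow> 'p) \<Rightarrow> ('p \<Rightarrow> 'm) \<Rightarrow>
   (nat \<Rightarrow> ('b, 'q) module) \<Rightarrow> (nat \<Rightarrow> 'q \<Rightarrow> 'q) \<Rightarrow> ('q \<Rightarrow> 'm) \<Rightarrow>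
   (nat \<Rightarrow> 'p \<Rightarrow> 'q) \<Rightarrow> bool" where
  "comparison_map A \<pi> X P d \<epsilon> Q d' \<epsilon>' f \<longleftrightarrow>
     (\<forall>n. f n \<in> mod_hom A (P n) (restrict_scalars \<pi> (Q n))) \<and>
     (\<forall>x\<in>carrier (P 0). \<epsilon>' (f 0 x) = \<epsilon> x) \<and>
     (\<forall>n. \<forall>x\<in>carrier (P (Suc n)). d' n (f (Suc n) x) = f n (d n x))"

definition ext_natural_map ::
  "('a, 'x) ring_scheme \<Rightarrow> ('a \<Rightarrow> 'b) \<Rightarrow> (nat \<Rightarrow> ('a, 'p) module) \<Rightarrow>
   (nat \<Rightarrow> 'p \<Rightarrow> 'p) \<Rightarrow> (nat \<Rightarrow> 'p \<Rightarrow> 'q) \<Rightarrow> ('b, 'n) module \<Rightarrow> nat \<Rightarrow>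
   ('q \<Rightarrow> 'n) set \<Rightarrow> ('p \<Rightarrow> 'n) set" where
  "ext_natural_map A \<pi> P d f Y n =
     (\<lambda>C. the_elem ((\<lambda>g. ext_coboundaries A P d (restrict_scalars \<pi> Y) n
                           #>\<^bsub>ext_cocycles A P d (restrict_scalars \<pi> Y) n\<^esub>
                         compose (carrier (P n)) g (f n)) ` C))"

text \<open>
  The natural map does not depend on the resolutions and the comparison map, up to the canonical
  identifications of the \<open>Ext\<close> groups; all choices are quantified universally.
\<close>

definition strongly_idempotent_ideal :: "('a, 'x) ring_scheme \<Rightarrow> 'a set \<Rightarrow> bool" where
  "strongly_idempotent_ideal A I \<longleftrightarrow> ideal I A \<and>
     (\<forall>(X :: ('a set, 'a set mod_univ) module) (Y :: ('a set, 'a set mod_univ) module) n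
        P d \<epsilon> Q d' \<epsilon>' f.
        fg_left_module (A Quot I) X \<and> fg_left_module (A Quot I) Y \<and>
        projective_resolution A (restrict_scalars (\<lambda>a. I +>\<^bsub>A\<^esub> a) X) P d \<epsilon> \<and>
        projective_resolution (A Quot I) X Q d' \<epsilon>' \<and>
        comparison_map A (\<lambda>a. I +>\<^bsub>A\<^esub> a) X P d \<epsilon> Q d' \<epsilon>' f \<longrightarrow>
        ext_natural_map A (\<lambda>a. I +>\<^bsub>A\<^esub> a) P d f Y n
          \<in> iso (ext_group (A Quot I) Q d' Y n)
                (ext_group A P d (restrict_scalars (\<lambda>a. I +>\<^bsub>A\<^esub> a) Y) n))"

end

theory Submission
  imports Defs
begin

text \<open>
  Write \<open>I = AeA\<close>. Feeding the quotient modules \<open>W/AeW\<close> of the syzygies \<open>W\<close> of \<open>I\<close> into the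
  \<open>Ext\<close> isomorphisms shows that \<open>I\<close> has a finite resolution by powers of \<open>Ae\<close>; multiplication by \<open>e\<close>
  turns it into a projective resolution of \<open>eA\<close> over \<open>eAe\<close>. Hence \<open>eX\<close> has finite projective
  dimension over \<open>eAe\<close> whenever \<open>X\<close> has finite projective dimension, and that dimension is then at
  most \<open>s = fin.dim(eAe)\<close>; also \<open>pd(I) \<le> s\<close>, so that (1) implies (2).

  The modules \<open>Ae \<otimes> V\<close> and the groups \<open>Tor\<^sub>i(Ae, eX)\<close> over \<open>eAe\<close> are avoided: everything is expressed
  by resolutions whose terms are powers of \<open>Ae\<close>. A mapping cone argument gives that for
  the \<open>(s+1)\<close>-st syzygy \<open>Z\<close> of \<open>X\<close> the submodule \<open>AeZ\<close> has such a finite resolution. For modules \<open>Z\<close> of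
  this kind taking syzygies commutes with passing to \<open>Z/AeZ\<close>, so \<open>Z/AeZ\<close> has finite projective
  dimension over \<open>A/I\<close>, at most \<open>t = fin.dim(A/I)\<close>, and therefore at most \<open>t + pd(I) + 1\<close> over \<open>A\<close>. As
  \<open>pd(AeZ) \<le> s\<close>, this gives \<open>pd(X) \<le> s + 1 + max s (t + pd(I) + 1)\<close>.
\<close>

text \<open>The \<open>Ext\<close> isomorphisms are applied only to \<open>X = A/I\<close>. This is
  free over \<open>A/I\<close>, so its \<open>Ext\<close> groups in positive degree vanish there and
  hence over \<open>A\<close>. Along \<open>0 -> I -> A -> A/I -> 0\<close> this becomes the
  vanishing of all \<open>Ext^i(I, Y)\<close>; for \<open>i = 0\<close> because a homomorphism from
  \<open>A\<close> to an \<open>A/I\<close>-module kills \<open>I\<close>. In degree 0 it kills the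
  projection of \<open>W\<close> onto \<open>W/AeW\<close>, so each syzygy \<open>W\<close> is
  generated by \<open>eW\<close>.

  Modules resolved by summands of powers of \<open>Ae\<close> are rigid: they are generated by
  \<open>e\<close>-fixed vectors, so equalities and surjectivity can be tested on these. The
  obstacle is that the kernel of a map between traces \<open>AeX\<close> need not be generated by
  \<open>e\<close>; finite resolutions of this kind remove it.

  In the count \<open>s + 1\<close>, up to \<open>s\<close> syzygies exhaust a resolution of
  \<open>eX\<close> over \<open>eAe\<close>, and one more makes the remaining \<open>e\<close>-part
  zero.

  A syzygy lives on a type of its own. Hence the lemmas named \<open>_step\<close>, which treat a
  module of arbitrary type and take the statement for modules of tuples as a hypothesis.\<close>

lemma left_moduleI:
  fixes R :: "('r, 'x) ring_scheme" and M :: "('r, 'm) module"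
  assumes "ring R"
    and "\<And>x y. \<lbrakk>x \<in> carrier M; y \<in> carrier M\<rbrakk> \<Longrightarrow> x \<oplus>\<^bsub>M\<^esub> y \<in> carrier M"
    and "\<zero>\<^bsub>M\<^esub> \<in> carrier M"
    and "\<And>x y z. \<lbrakk>x \<in> carrier M; y \<in> carrier M; z \<in> carrier M\<rbrakk> \<Longrightarrow>
      (x \<oplus>\<^bsub>M\<^esub> y) \<oplus>\<^bsub>M\<^esub> z = x \<oplus>\<^bsub>M\<^esub> (y \<oplus>\<^bsub>M\<^esub> z)"
    and "\<And>x y. \<lbrakk>x \<in> carrier M; y \<in> carrier M\<rbrakk> \<Longrightarrow> x \<oplus>\<^bsub>M\<^esub> y = y \<oplus>\<^bsub>M\<^esub> x"
    and "\<And>x. x \<in> carrier M \<Longrightarrow> \<zero>\<^bsub>M\<^esub> \<oplus>\<^bsub>M\<^esub> x = x"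
    and "\<And>x. x \<in> carrier M \<Longrightarrow> ((\<ominus>\<^bsub>R\<^esub> \<one>\<^bsub>R\<^esub>) \<odot>\<^bsub>M\<^esub> x) \<oplus>\<^bsub>M\<^esub> x = \<zero>\<^bsub>M\<^esub>"
    and "\<And>a x. \<lbrakk>a \<in> carrier R; x \<in> carrier M\<rbrakk> \<Longrightarrow> a \<odot>\<^bsub>M\<^esub> x \<in> carrier M"
    and "\<And>a b x. \<lbrakk>a \<in> carrier R; b \<in> carrier R; x \<in> carrier M\<rbrakk> \<Longrightarrow>
        (a \<oplus>\<^bsub>R\<^esub> b) \<odot>\<^bsub>M\<^esub> x = a \<odot>\<^bsub>M\<^esub> x \<oplus>\<^bsub>M\<^esub> b \<odot>\<^bsub>M\<^esub> x"
    and "\<And>a x y. \<lbrakk>a \<in> carrier R; x \<in> carrier M; y \<in> carrier M\<rbrakk> \<Longrightarrow>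
        a \<odot>\<^bsub>M\<^esub> (x \<oplus>\<^bsub>M\<^esub> y) = a \<odot>\<^bsub>M\<^esub> x \<oplus>\<^bsub>M\<^esub> a \<odot>\<^bsub>M\<^esub> y"
    and "\<And>a b x. \<lbrakk>a \<in> carrier R; b \<in> carrier R; x \<in> carrier M\<rbrakk> \<Longrightarrow>
        (a \<otimes>\<^bsub>R\<^esub> b) \<odot>\<^bsub>M\<^esub> x = a \<odot>\<^bsub>M\<^esub> (b \<odot>\<^bsub>M\<^esub> x)"
    and "\<And>x. x \<in> carrier M \<Longrightarrow> \<one>\<^bsub>R\<^esub> \<odot>\<^bsub>M\<^esub> x = x"
  shows "left_module R M"
proof -
  interpret ring R by fact
  have "abelian_group M"
  proof (rule abelian_groupI)
    show "\<exists>y\<in>carrier M. y \<oplus>\<^bsub>M\<^esub> x = \<zero>\<^bsub>M\<^esub>" if "x \<in> carrier M" for x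
      using assms(7,8) that by blast
  qed (use assms(2-6) in auto)
  then show ?thesis
    using assms(8-12) by (intro left_module.intro left_module_axioms.intro \<open>ring R\<close>) auto
qed

text \<open>
  Subtraction is written through the scalar \<open>-1\<close>, which makes it literally invariant under
  passage to a submodule and obviously compatible with homomorphisms.
\<close>

definition mdiff :: "('r, 'x) ring_scheme \<Rightarrow> ('r, 'm) module \<Rightarrow> 'm \<Rightarrow> 'm \<Rightarrow> 'm" where
  "mdiff R M x y = x \<oplus>\<^bsub>M\<^esub> ((\<ominus>\<^bsub>R\<^esub> \<one>\<^bsub>R\<^esub>) \<odot>\<^bsub>M\<^esub> y)"

lemma mdiff_carrier_update [simp]: "mdiff R (M\<lparr>carrier := N\<rparr>) = mdiff R M"
  by (simp add: mdiff_def fun_eq_iff)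

context left_module
begin

lemma smult_zero_l [simp]: "x \<in> carrier M \<Longrightarrow> \<zero> \<odot>\<^bsub>M\<^esub> x = \<zero>\<^bsub>M\<^esub>"
  using smult_l_distr[of \<zero> \<zero> x] by (simp add: M.add.l_cancel_one)

lemma smult_zero_r [simp]: "a \<in> carrier R \<Longrightarrow> a \<odot>\<^bsub>M\<^esub> \<zero>\<^bsub>M\<^esub> = \<zero>\<^bsub>M\<^esub>"
  using smult_r_distr[of a "\<zero>\<^bsub>M\<^esub>" "\<zero>\<^bsub>M\<^esub>"] by (simp add: M.add.l_cancel_one)

lemma smult_minus_one_l: "x \<in> carrier M \<Longrightarrow> ((\<ominus> \<one>) \<odot>\<^bsub>M\<^esub> x) \<oplus>\<^bsub>M\<^esub> x = \<zero>\<^bsub>M\<^esub>"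
  using smult_l_distr[of "\<ominus> \<one>" \<one> x] by (simp add: R.l_neg)

lemma smult_minus_one: "x \<in> carrier M \<Longrightarrow> (\<ominus> \<one>) \<odot>\<^bsub>M\<^esub> x = \<ominus>\<^bsub>M\<^esub> x"
  using smult_minus_one_l[of x] by (simp add: M.minus_equality)

lemma mdiff_eq: "\<lbrakk>x \<in> carrier M; y \<in> carrier M\<rbrakk> \<Longrightarrow> mdiff R M x y = x \<ominus>\<^bsub>M\<^esub> y"
  by (simp add: mdiff_def smult_minus_one M.minus_eq)

lemma mdiff_closed [simp, intro]:
  "\<lbrakk>x \<in> carrier M; y \<in> carrier M\<rbrakk> \<Longrightarrow> mdiff R M x y \<in> carrier M"
  by (simp add: mdiff_def)

lemma mdiff_self [simp]: "x \<in> carrier M \<Longrightarrow> mdiff R M x x = \<zero>\<^bsub>M\<^esub>"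
  by (simp add: mdiff_eq M.r_neg M.minus_eq)

lemma mdiff_eq_zero_iff:
  "\<lbrakk>x \<in> carrier M; y \<in> carrier M\<rbrakk> \<Longrightarrow> mdiff R M x y = \<zero>\<^bsub>M\<^esub> \<longleftrightarrow> x = y"
  by (metis M.add.inv_closed M.add.m_closed M.l_neg M.minus_eq M.minus_minus M.minus_equality mdiff_eq
      mdiff_self)

lemma mdiff_add_cancel [simp]:
  "\<lbrakk>x \<in> carrier M; y \<in> carrier M\<rbrakk> \<Longrightarrow> mdiff R M x y \<oplus>\<^bsub>M\<^esub> y = x"
  by (simp add: mdiff_eq M.minus_eq M.a_assoc M.l_neg)

lemma add_mdiff_cancel [simp]:
  "\<lbrakk>x \<in> carrier M; y \<in> carrier M\<rbrakk> \<Longrightarrow> mdiff R M (x \<oplus>\<^bsub>M\<^esub> y) y = x"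
  by (simp add: mdiff_eq M.minus_eq M.a_assoc M.r_neg)

lemma mdiff_zero_r [simp]: "x \<in> carrier M \<Longrightarrow> mdiff R M x \<zero>\<^bsub>M\<^esub> = x"
  by (simp add: mdiff_def)

lemma add_mdiff_swap [simp]:
  "\<lbrakk>x \<in> carrier M; y \<in> carrier M\<rbrakk> \<Longrightarrow> y \<oplus>\<^bsub>M\<^esub> mdiff R M x y = x"
  using mdiff_add_cancel M.a_comm mdiff_closed by metis

end

section \<open>Homomorphisms of left modules\<close>

lemma mod_homI:
  assumes "\<And>x. x \<in> carrier M \<Longrightarrow> f x \<in> carrier N"
    and "\<And>x y. \<lbrakk>x \<in> carrier M; y \<in> carrier M\<rbrakk> \<Longrightarrow> f (x \<oplus>\<^bsub>M\<^esub> y) = f x \<oplus>\<^bsub>N\<^esub> f y"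
    and "\<And>a x. \<lbrakk>a \<in> carrier R; x \<in> carrier M\<rbrakk> \<Longrightarrow> f (a \<odot>\<^bsub>M\<^esub> x) = a \<odot>\<^bsub>N\<^esub> f x"
  shows "f \<in> mod_hom R M N"
  using assms by (auto simp: mod_hom_def hom_def)

lemma mod_homD:
  assumes "f \<in> mod_hom R M N"
  shows mod_hom_closed: "x \<in> carrier M \<Longrightarrow> f x \<in> carrier N"
    and mod_hom_add: "\<lbrakk>x \<in> carrier M; y \<in> carrier M\<rbrakk> \<Longrightarrow> f (x \<oplus>\<^bsub>M\<^esub> y) = f x \<oplus>\<^bsub>N\<^esub> f y"
    and mod_hom_smult: "\<lbrakk>a \<in> carrier R; x \<in> carrier M\<rbrakk> \<Longrightarrow> f (a \<odot>\<^bsub>M\<^esub> x) = a \<odot>\<^bsub>N\<^esub> f x"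
  using assms by (auto simp: mod_hom_def hom_def)

lemma mod_hom_zero:
  assumes "left_module R M" "left_module R N" "f \<in> mod_hom R M N"
  shows "f \<zero>\<^bsub>M\<^esub> = \<zero>\<^bsub>N\<^esub>"
proof -
  interpret M: left_module R M by fact
  interpret N: left_module R N by fact
  have "f (\<zero>\<^bsub>R\<^esub> \<odot>\<^bsub>M\<^esub> \<zero>\<^bsub>M\<^esub>) = \<zero>\<^bsub>R\<^esub> \<odot>\<^bsub>N\<^esub> f \<zero>\<^bsub>M\<^esub>"
    using mod_hom_smult[OF assms(3)] by blast
  then show ?thesis
    using mod_hom_closed[OF assms(3)] by simp
qed

lemma mod_hom_mdiff:
  assumes "left_module R M" "f \<in> mod_hom R M N" "x \<in> carrier M" "y \<in> carrier M"
  shows "f (mdiff R M x y) = mdiff R N (f x) (f y)"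
proof -
  interpret M: left_module R M by fact
  show ?thesis
    using assms(3,4) by (simp add: mdiff_def mod_homD[OF assms(2)])
qed

lemma mod_hom_comp:
  assumes "f \<in> mod_hom R M N" "g \<in> mod_hom R N L"
  shows "(\<lambda>x. g (f x)) \<in> mod_hom R M L"
  by (rule mod_homI) (auto simp: mod_homD[OF assms(1)] mod_homD[OF assms(2)])

lemma mod_hom_cong:
  assumes "f \<in> mod_hom R M N" "left_module R M" "\<And>x. x \<in> carrier M \<Longrightarrow> g x = f x"
  shows "g \<in> mod_hom R M N"
proof -
  interpret M: left_module R M by fact
  show ?thesis
    by (rule mod_homI) (auto simp: mod_homD[OF assms(1)] assms(3))
qed

lemma mod_hom_id: "(\<lambda>x. x) \<in> mod_hom R M M"
  by (rule mod_homI) auto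

lemma mod_hom_const_zero:
  assumes "left_module R N"
  shows "(\<lambda>x. \<zero>\<^bsub>N\<^esub>) \<in> mod_hom R M N"
proof -
  interpret N: left_module R N by fact
  show ?thesis by (rule mod_homI) auto
qed

lemma mod_hom_sum:
  assumes "left_module R N" "f \<in> mod_hom R M N" "g \<in> mod_hom R M N"
  shows "(\<lambda>x. f x \<oplus>\<^bsub>N\<^esub> g x) \<in> mod_hom R M N"
proof -
  interpret N: left_module R N by fact
  show ?thesis
    by (rule mod_homI) (auto simp: mod_homD[OF assms(2)] mod_homD[OF assms(3)]
        N.smult_r_distr N.a_ac)
qed

lemma mod_hom_diff:
  assumes "left_module R N" "f \<in> mod_hom R M N" "g \<in> mod_hom R M N"
  shows "(\<lambda>x. mdiff R N (f x) (g x)) \<in> mod_hom R M N"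
proof -
  interpret N: left_module R N by fact
  have c: "\<And>x. x \<in> carrier M \<Longrightarrow> f x \<in> carrier N" "\<And>x. x \<in> carrier M \<Longrightarrow> g x \<in> carrier N"
    using mod_homD[OF assms(2)] mod_homD[OF assms(3)] by blast+
  have "a \<odot>\<^bsub>N\<^esub> ((\<ominus>\<^bsub>R\<^esub> \<one>\<^bsub>R\<^esub>) \<odot>\<^bsub>N\<^esub> x) = (\<ominus>\<^bsub>R\<^esub> \<one>\<^bsub>R\<^esub>) \<odot>\<^bsub>N\<^esub> (a \<odot>\<^bsub>N\<^esub> x)"
    if "a \<in> carrier R" "x \<in> carrier N" for a x
    using that N.smult_assoc[symmetric, of a "\<ominus>\<^bsub>R\<^esub> \<one>\<^bsub>R\<^esub>" x] N.smult_assoc[symmetric, of "\<ominus>\<^bsub>R\<^esub> \<one>\<^bsub>R\<^esub>" a x]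
    by (simp add: N.R.l_minus N.R.r_minus)
  then show ?thesis
    by (intro mod_homI) (auto simp: mod_homD[OF assms(2)] mod_homD[OF assms(3)] c mdiff_def
        N.smult_r_distr N.a_ac)
qed

subsection \<open>Submodules, kernels and transport of structure\<close>

text \<open>Closure under negatives is supplied by the scalar -1. On left modules the notion agrees
  with \<open>submodule\<close>, see \<open>submodule_iff\<close>.\<close>

definition left_submodule :: "'m set \<Rightarrow> ('r, 'x) ring_scheme \<Rightarrow> ('r, 'm) module \<Rightarrow> bool" where
  "left_submodule N R M \<longleftrightarrow> N \<subseteq> carrier M \<and> \<zero>\<^bsub>M\<^esub> \<in> N \<and>
     (\<forall>x\<in>N. \<forall>y\<in>N. x \<oplus>\<^bsub>M\<^esub> y \<in> N) \<and> (\<forall>a\<in>carrier R. \<forall>x\<in>N. a \<odot>\<^bsub>M\<^esub> x \<in> N)"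

lemma left_submoduleI:
  assumes "N \<subseteq> carrier M" "\<zero>\<^bsub>M\<^esub> \<in> N"
    and "\<And>x y. \<lbrakk>x \<in> N; y \<in> N\<rbrakk> \<Longrightarrow> x \<oplus>\<^bsub>M\<^esub> y \<in> N"
    and "\<And>a x. \<lbrakk>a \<in> carrier R; x \<in> N\<rbrakk> \<Longrightarrow> a \<odot>\<^bsub>M\<^esub> x \<in> N"
  shows "left_submodule N R M"
  using assms by (auto simp: left_submodule_def)

lemma left_submoduleD:
  assumes "left_submodule N R M"
  shows "x \<in> N \<Longrightarrow> x \<in> carrier M" "N \<subseteq> carrier M" "\<zero>\<^bsub>M\<^esub> \<in> N"
    and "\<lbrakk>x \<in> N; y \<in> N\<rbrakk> \<Longrightarrow> x \<oplus>\<^bsub>M\<^esub> y \<in> N"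
    and "\<lbrakk>a \<in> carrier R; x \<in> N\<rbrakk> \<Longrightarrow> a \<odot>\<^bsub>M\<^esub> x \<in> N"
  using assms by (auto simp: left_submodule_def)

lemma left_submodule_mdiff:
  assumes "left_submodule N R M" "ring R" "x \<in> N" "y \<in> N"
  shows "mdiff R M x y \<in> N"
proof -
  interpret ring R by fact
  show ?thesis
    using assms(3,4) left_submoduleD[OF assms(1)] by (auto simp: mdiff_def)
qed

lemma left_submodule_left_module:
  assumes "left_module R M" "left_submodule N R M"
  shows "left_module R (M\<lparr>carrier := N\<rparr>)"
proof -
  interpret M: left_module R M by fact
  note D = left_submoduleD[OF assms(2)]
  show ?thesis
    by (rule left_moduleI)
      (simp_all add: D M.a_assoc M.smult_l_distr M.smult_r_distr M.smult_assoc
        M.smult_minus_one_l M.R.ring_axioms, simp add: D M.a_comm)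
qed

text \<open>Only the carrier of the source is changed. Operations and zero stay the same terms, so
  iterated kernels and kernels of different maps on one module can be equal as records.\<close>

definition kerm :: "('r, 'm) module \<Rightarrow> ('r, 'n) module \<Rightarrow> ('m \<Rightarrow> 'n) \<Rightarrow> ('r, 'm) module" where
  "kerm M N f = M\<lparr>carrier := {x \<in> carrier M. f x = \<zero>\<^bsub>N\<^esub>}\<rparr>"

lemma kerm_simps [simp]:
  "x \<in> carrier (kerm M N f) \<longleftrightarrow> x \<in> carrier M \<and> f x = \<zero>\<^bsub>N\<^esub>"
  "zero (kerm M N f) = zero M" "add (kerm M N f) = add M" "smult (kerm M N f) = smult M"
  "mdiff R (kerm M N f) = mdiff R M"
  by (simp_all add: kerm_def)

lemma carrier_kerm: "carrier (kerm M N f) = {x \<in> carrier M. f x = \<zero>\<^bsub>N\<^esub>}"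
  by (simp add: kerm_def)

lemma kerm_cong:
  assumes "\<And>x. x \<in> carrier M \<Longrightarrow> f x = \<zero>\<^bsub>N\<^esub> \<longleftrightarrow> g x = \<zero>\<^bsub>L\<^esub>"
  shows "kerm M N f = kerm M L g"
proof -
  have "{x \<in> carrier M. f x = \<zero>\<^bsub>N\<^esub>} = {x \<in> carrier M. g x = \<zero>\<^bsub>L\<^esub>}"
    using assms by blast
  then show ?thesis by (simp only: kerm_def)
qed

lemma kerm_kerm:
  "kerm (kerm M X g) K f = M\<lparr>carrier := {x \<in> carrier M. g x = \<zero>\<^bsub>X\<^esub> \<and> f x = \<zero>\<^bsub>K\<^esub>}\<rparr>"
  by (simp add: kerm_def conj_assoc)

lemma left_submodule_ker:
  assumes "left_module R M" "left_module R N" "f \<in> mod_hom R M N"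
  shows "left_submodule {x \<in> carrier M. f x = \<zero>\<^bsub>N\<^esub>} R M"
proof -
  interpret M: left_module R M by fact
  interpret N: left_module R N by fact
  show ?thesis
    by (rule left_submoduleI) (auto simp: mod_homD[OF assms(3)] mod_hom_zero[OF assms])
qed

lemma left_module_kerm:
  assumes "left_module R M" "left_module R N" "f \<in> mod_hom R M N"
  shows "left_module R (kerm M N f)"
  unfolding kerm_def by (rule left_submodule_left_module[OF assms(1) left_submodule_ker[OF assms]])

lemma kerm_incl: "(\<lambda>x. x) \<in> mod_hom R (kerm M N f) M"
  by (rule mod_homI) auto

lemma left_submodule_vimage:
  assumes "left_module R M" "left_module R N" "f \<in> mod_hom R M N" "left_submodule L R N"
  shows "left_submodule {x \<in> carrier M. f x \<in> L} R M"
proof -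
  interpret M: left_module R M by fact
  show ?thesis
    by (rule left_submoduleI)
      (auto simp: mod_homD[OF assms(3)] mod_hom_zero[OF assms(1-3)] left_submoduleD[OF assms(4)])
qed

lemma left_submodule_image:
  assumes "left_module R M" "left_module R N" "f \<in> mod_hom R M N" "left_submodule L R M"
  shows "left_submodule (f ` L) R N"
proof (rule left_submoduleI)
  show "f ` L \<subseteq> carrier N"
    using left_submoduleD[OF assms(4)] mod_homD[OF assms(3)] by blast
  show "\<zero>\<^bsub>N\<^esub> \<in> f ` L"
    using mod_hom_zero[OF assms(1-3)] left_submoduleD(3)[OF assms(4)] by force
  show "x \<oplus>\<^bsub>N\<^esub> y \<in> f ` L" if xy: "x \<in> f ` L" "y \<in> f ` L" for x y
  proof -
    obtain u v where "u \<in> L" "v \<in> L" "x = f u" "y = f v" using xy by blast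
    then show ?thesis
      using left_submoduleD[OF assms(4)] mod_homD(2)[OF assms(3), of u v, symmetric] by auto
  qed
  show "a \<odot>\<^bsub>N\<^esub> x \<in> f ` L" if ax: "a \<in> carrier R" "x \<in> f ` L" for a x
  proof -
    obtain u where "u \<in> L" "x = f u" using ax by blast
    then show ?thesis
      using ax left_submoduleD[OF assms(4)] mod_homD(3)[OF assms(3), of a u, symmetric] by auto
  qed
qed

lemma left_submodule_eq:
  assumes "left_module R M" "left_module R N" "f \<in> mod_hom R M N" "g \<in> mod_hom R M N"
  shows "left_submodule {x \<in> carrier M. f x = g x} R M"
proof -
  interpret M: left_module R M by fact
  show ?thesis
    by (rule left_submoduleI) (auto simp: mod_homD[OF assms(3)] mod_homD[OF assms(4)]
        mod_hom_zero[OF assms(1-3)] mod_hom_zero[OF assms(1,2,4)])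
qed

lemma left_submodule_carrier:
  assumes "left_module R M"
  shows "left_submodule (carrier M) R M"
proof -
  interpret M: left_module R M by fact
  show ?thesis by (auto simp: left_submodule_def)
qed

lemma inv_into_mod_hom:
  assumes "left_module R M" "f \<in> mod_hom R M N" "bij_betw f (carrier M) (carrier N)"
  shows "inv_into (carrier M) f \<in> mod_hom R N M"
proof -
  interpret M: left_module R M by fact
  let ?g = "inv_into (carrier M) f"
  have g: "?g y \<in> carrier M" "f (?g y) = y" if "y \<in> carrier N" for y
    using that assms(3) by (auto simp: bij_betw_def inv_into_into f_inv_into_f)
  have gf: "?g (f x) = x" if "x \<in> carrier M" for x
    using that assms(3) by (auto simp: bij_betw_def)
  show ?thesis
  proof (rule mod_homI)
    fix x y assume xy: "x \<in> carrier N" "y \<in> carrier N"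
    show "?g (x \<oplus>\<^bsub>N\<^esub> y) = ?g x \<oplus>\<^bsub>M\<^esub> ?g y"
      using gf[of "?g x \<oplus>\<^bsub>M\<^esub> ?g y"] mod_hom_add[OF assms(2), of "?g x" "?g y"] g xy by simp
  next
    fix a y assume ay: "a \<in> carrier R" "y \<in> carrier N"
    show "?g (a \<odot>\<^bsub>N\<^esub> y) = a \<odot>\<^bsub>M\<^esub> ?g y"
      using gf[of "a \<odot>\<^bsub>M\<^esub> ?g y"] mod_hom_smult[OF assms(2), of a "?g y"] g ay by simp
  qed (use g in auto)
qed

lemma mod_hom_inj_on:
  assumes "left_module R M" "left_module R N" "f \<in> mod_hom R M N"
    and "\<And>x. \<lbrakk>x \<in> carrier M; f x = \<zero>\<^bsub>N\<^esub>\<rbrakk> \<Longrightarrow> x = \<zero>\<^bsub>M\<^esub>"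
  shows "inj_on f (carrier M)"
proof (rule inj_onI)
  interpret M: left_module R M by fact
  interpret N: left_module R N by fact
  fix x y assume xy: "x \<in> carrier M" "y \<in> carrier M" "f x = f y"
  then have "f (mdiff R M x y) = \<zero>\<^bsub>N\<^esub>"
    using mod_homD[OF assms(3)] by (simp add: mod_hom_mdiff[OF assms(1,3)])
  then show "x = y"
    using assms(4)[of "mdiff R M x y"] xy by (simp add: M.mdiff_eq_zero_iff)
qed

text \<open>The axioms are equations, so they pass to the image of a surjection compatible with the
  operations. With \<open>\<theta>\<close> the identity this serves transport along an injection,
  with \<open>\<theta>\<close> the projection to a quotient ring it serves quotient modules.\<close>

lemma left_module_hom_image:
  assumes "left_module R M" "ring S" "\<theta> ` carrier R = carrier S" "h ` carrier M = carrier N"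
    and "\<zero>\<^bsub>N\<^esub> = h \<zero>\<^bsub>M\<^esub>" "\<theta> \<in> ring_hom R S"
    and add: "\<And>x y. \<lbrakk>x \<in> carrier M; y \<in> carrier M\<rbrakk> \<Longrightarrow> h x \<oplus>\<^bsub>N\<^esub> h y = h (x \<oplus>\<^bsub>M\<^esub> y)"
    and smult: "\<And>a x. \<lbrakk>a \<in> carrier R; x \<in> carrier M\<rbrakk> \<Longrightarrow> \<theta> a \<odot>\<^bsub>N\<^esub> h x = h (a \<odot>\<^bsub>M\<^esub> x)"
  shows "left_module S N"
proof -
  interpret M: left_module R M by fact
  interpret S: ring S by fact
  note th = ring_hom_memE[OF assms(6)]
  have one: "\<theta> (\<ominus>\<^bsub>R\<^esub> \<one>\<^bsub>R\<^esub>) = \<ominus>\<^bsub>S\<^esub> \<one>\<^bsub>S\<^esub>"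
    using th(3)[of "\<ominus>\<^bsub>R\<^esub> \<one>\<^bsub>R\<^esub>" "\<one>\<^bsub>R\<^esub>"] th(3)[of "\<zero>\<^bsub>R\<^esub>" "\<zero>\<^bsub>R\<^esub>"] th(1) th(4)
    by (metis M.R.add.inv_closed M.R.l_neg M.R.l_zero M.R.one_closed M.R.zero_closed S.add.l_cancel_one
        S.minus_equality)
  have C: "\<And>x. x \<in> carrier M \<Longrightarrow> h x \<in> carrier N" "\<And>a. a \<in> carrier R \<Longrightarrow> \<theta> a \<in> carrier S"
    using assms(3,4) by auto
  show ?thesis
  proof (rule left_moduleI[OF \<open>ring S\<close>])
    show "x \<oplus>\<^bsub>N\<^esub> y \<in> carrier N" if "x \<in> carrier N" "y \<in> carrier N" for x y
      using that unfolding assms(4)[symmetric] by (auto simp: add)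
    show "\<zero>\<^bsub>N\<^esub> \<in> carrier N" using C by (simp add: assms(5))
    show "x \<oplus>\<^bsub>N\<^esub> y \<oplus>\<^bsub>N\<^esub> z = x \<oplus>\<^bsub>N\<^esub> (y \<oplus>\<^bsub>N\<^esub> z)"
      if "x \<in> carrier N" "y \<in> carrier N" "z \<in> carrier N" for x y z
      using that unfolding assms(4)[symmetric] by (auto simp: add M.a_assoc)
    show "x \<oplus>\<^bsub>N\<^esub> y = y \<oplus>\<^bsub>N\<^esub> x" if "x \<in> carrier N" "y \<in> carrier N" for x y
      using that unfolding assms(4)[symmetric] by (auto simp: add M.a_comm)
    show "\<zero>\<^bsub>N\<^esub> \<oplus>\<^bsub>N\<^esub> x = x" if "x \<in> carrier N" for x
      using that unfolding assms(4)[symmetric] by (auto simp: add assms(5))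
    show "(\<ominus>\<^bsub>S\<^esub> \<one>\<^bsub>S\<^esub>) \<odot>\<^bsub>N\<^esub> x \<oplus>\<^bsub>N\<^esub> x = \<zero>\<^bsub>N\<^esub>" if "x \<in> carrier N" for x
      using that unfolding assms(4)[symmetric] one[symmetric]
      by (auto simp: add smult assms(5) M.smult_minus_one_l)
    show "a \<odot>\<^bsub>N\<^esub> x \<in> carrier N" if "a \<in> carrier S" "x \<in> carrier N" for a x
      using that unfolding assms(3,4)[symmetric] by (auto simp: smult)
    show "(a \<oplus>\<^bsub>S\<^esub> b) \<odot>\<^bsub>N\<^esub> x = a \<odot>\<^bsub>N\<^esub> x \<oplus>\<^bsub>N\<^esub> b \<odot>\<^bsub>N\<^esub> x"
      if "a \<in> carrier S" "b \<in> carrier S" "x \<in> carrier N" for a b x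
      using that unfolding assms(3,4)[symmetric]
      by (auto simp: smult add th(3)[symmetric] M.smult_l_distr)
    show "a \<odot>\<^bsub>N\<^esub> (x \<oplus>\<^bsub>N\<^esub> y) = a \<odot>\<^bsub>N\<^esub> x \<oplus>\<^bsub>N\<^esub> a \<odot>\<^bsub>N\<^esub> y"
      if "a \<in> carrier S" "x \<in> carrier N" "y \<in> carrier N" for a x y
      using that unfolding assms(3,4)[symmetric] by (auto simp: smult add M.smult_r_distr)
    show "(a \<otimes>\<^bsub>S\<^esub> b) \<odot>\<^bsub>N\<^esub> x = a \<odot>\<^bsub>N\<^esub> (b \<odot>\<^bsub>N\<^esub> x)"
      if "a \<in> carrier S" "b \<in> carrier S" "x \<in> carrier N" for a b x
      using that unfolding assms(3,4)[symmetric]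
      by (auto simp: smult th(2)[symmetric] M.smult_assoc)
    show "\<one>\<^bsub>S\<^esub> \<odot>\<^bsub>N\<^esub> x = x" if "x \<in> carrier N" for x
      using that unfolding assms(4)[symmetric] th(4)[symmetric] by (auto simp: smult)
  qed
qed

definition transport :: "('m \<Rightarrow> 'n) \<Rightarrow> ('r, 'm) module \<Rightarrow> ('r, 'n) module" where
  "transport h M = \<lparr>carrier = h ` carrier M, mult = undefined, one = undefined, zero = h \<zero>\<^bsub>M\<^esub>,
     add = (\<lambda>x y. h (inv_into (carrier M) h x \<oplus>\<^bsub>M\<^esub> inv_into (carrier M) h y)),
     smult = (\<lambda>a x. h (a \<odot>\<^bsub>M\<^esub> inv_into (carrier M) h x))\<rparr>"

lemma transport:
  assumes "left_module R M" "inj_on h (carrier M)"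
  shows left_module_transport: "left_module R (transport h M)"
    and transport_mod_hom: "h \<in> mod_hom R M (transport h M)"
    and transport_bij: "bij_betw h (carrier M) (carrier (transport h M))"
proof -
  interpret M: left_module R M by fact
  show "left_module R (transport h M)"
    by (rule left_module_hom_image[OF assms(1) M.R.ring_axioms, of "\<lambda>x. x" h])
      (auto simp: transport_def assms(2) ring_hom_def)
  show "h \<in> mod_hom R M (transport h M)"
    by (rule mod_homI) (auto simp: transport_def assms(2))
  show "bij_betw h (carrier M) (carrier (transport h M))"
    using assms(2) by (simp add: transport_def bij_betw_def)
qed

definition mod_epi :: "('r, 'x) ring_scheme \<Rightarrow> ('r, 'm) module \<Rightarrow> ('r, 'n) module \<Rightarrow> ('m \<Rightarrow> 'n) set" where
  "mod_epi R M N = {f \<in> mod_hom R M N. f ` carrier M = carrier N}"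

lemma mod_epiD:
  assumes "f \<in> mod_epi R M N"
  shows "f \<in> mod_hom R M N" "f ` carrier M = carrier N"
  using assms by (auto simp: mod_epi_def)

lemma mod_epiI:
  assumes "f \<in> mod_hom R M N" "\<And>y. y \<in> carrier N \<Longrightarrow> \<exists>x\<in>carrier M. f x = y"
  shows "f \<in> mod_epi R M N"
  using assms by (auto simp: mod_epi_def mod_homD[OF assms(1)])

lemma mod_epiE:
  assumes "f \<in> mod_epi R M N" "y \<in> carrier N"
  obtains x where "x \<in> carrier M" "f x = y"
proof -
  have "y \<in> f ` carrier M" using assms by (simp add: mod_epi_def)
  then show thesis using that by (elim imageE) simp
qed

lemma mod_epi_comp:
  assumes "f \<in> mod_epi R M N" "g \<in> mod_epi R N L"
  shows "(\<lambda>x. g (f x)) \<in> mod_epi R M L"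
  using assms image_image[of g f "carrier M"] mod_hom_comp[of f R M N g L]
  by (simp add: mod_epi_def)

subsection \<open>Tuples\<close>

text \<open>Powers of all lengths share one type, as sequences that vanish from index
  \<open>k\<close> on. Lengthening a tuple is then the identity, and the tuples with zero upper part
  are equal, not merely isomorphic, to the shorter ones.\<close>

definition tuples :: "('r, 'x) ring_scheme \<Rightarrow> 'r set \<Rightarrow> nat \<Rightarrow> ('r, nat \<Rightarrow> 'r) module" where
  "tuples R S k = \<lparr>carrier = {x. (\<forall>i<k. x i \<in> S) \<and> (\<forall>i\<ge>k. x i = \<zero>\<^bsub>R\<^esub>)},
     mult = undefined, one = undefined, zero = (\<lambda>_. \<zero>\<^bsub>R\<^esub>),
     add = (\<lambda>x y i. x i \<oplus>\<^bsub>R\<^esub> y i), smult = (\<lambda>a x i. a \<otimes>\<^bsub>R\<^esub> x i)\<rparr>"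

lemma tuples_simps [simp]:
  "zero (tuples R S k) = (\<lambda>_. \<zero>\<^bsub>R\<^esub>)"
  "add (tuples R S k) = (\<lambda>x y i. x i \<oplus>\<^bsub>R\<^esub> y i)"
  "smult (tuples R S k) = (\<lambda>a x i. a \<otimes>\<^bsub>R\<^esub> x i)"
  by (simp_all add: tuples_def)

definition left_ideal :: "'r set \<Rightarrow> ('r, 'x) ring_scheme \<Rightarrow> bool" where
  "left_ideal S R \<longleftrightarrow> S \<subseteq> carrier R \<and> \<zero>\<^bsub>R\<^esub> \<in> S \<and>
     (\<forall>x\<in>S. \<forall>y\<in>S. x \<oplus>\<^bsub>R\<^esub> y \<in> S) \<and> (\<forall>a\<in>carrier R. \<forall>x\<in>S. a \<otimes>\<^bsub>R\<^esub> x \<in> S)"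

lemma left_idealD:
  assumes "left_ideal S R"
  shows "x \<in> S \<Longrightarrow> x \<in> carrier R" "\<zero>\<^bsub>R\<^esub> \<in> S"
    and "\<lbrakk>x \<in> S; y \<in> S\<rbrakk> \<Longrightarrow> x \<oplus>\<^bsub>R\<^esub> y \<in> S"
    and "\<lbrakk>a \<in> carrier R; x \<in> S\<rbrakk> \<Longrightarrow> a \<otimes>\<^bsub>R\<^esub> x \<in> S"
  using assms by (auto simp: left_ideal_def)

lemma tuples_mem:
  assumes "left_ideal S R"
  shows "x \<in> carrier (tuples R S k) \<longleftrightarrow> (\<forall>i. x i \<in> S) \<and> (\<forall>i\<ge>k. x i = \<zero>\<^bsub>R\<^esub>)"
  using left_idealD(2)[OF assms] by (auto simp: tuples_def not_less) (metis not_less)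

lemma left_module_tuples:
  assumes "ring R" "left_ideal S R"
  shows "left_module R (tuples R S k)"
proof -
  interpret ring R by fact
  note D = left_idealD[OF assms(2)]
  have c: "x i \<in> carrier R" if "x \<in> carrier (tuples R S k)" for x i
    using that D by (simp add: tuples_mem[OF assms(2)])
  show ?thesis
  proof (rule left_moduleI[OF assms(1)], goal_cases)
    case (6 x)
    show ?case using c[OF 6] by (auto simp: l_minus l_neg)
  qed (auto simp: tuples_mem[OF assms(2)] D fun_eq_iff c
      a_assoc l_distr r_distr m_assoc l_minus l_neg intro!: a_comm)
qed

lemma tuples_embed:
  assumes "left_ideal S R" "ring R"
  shows tuples_fst: "(\<lambda>x i. if i < k then x i else \<zero>\<^bsub>R\<^esub>) \<in> mod_hom R (tuples R S l) (tuples R S k)"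
    and tuples_snd: "(\<lambda>x i. x (i + k)) \<in> mod_hom R (tuples R S (k + l)) (tuples R S l)"
    and tuples_inr: "(\<lambda>x i. if i < k then \<zero>\<^bsub>R\<^esub> else x (i - k)) \<in>
      mod_hom R (tuples R S l) (tuples R S (k + l))"
proof -
  interpret ring R by fact
  show "(\<lambda>x i. if i < k then x i else \<zero>\<^bsub>R\<^esub>) \<in> mod_hom R (tuples R S l) (tuples R S k)"
    by (rule mod_homI) (auto simp: tuples_mem assms fun_eq_iff left_idealD[OF assms(1)])
  show "(\<lambda>x i. x (i + k)) \<in> mod_hom R (tuples R S (k + l)) (tuples R S l)"
    by (rule mod_homI) (auto simp: tuples_mem assms fun_eq_iff)
  show "(\<lambda>x i. if i < k then \<zero>\<^bsub>R\<^esub> else x (i - k)) \<in>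
      mod_hom R (tuples R S l) (tuples R S (k + l))"
    by (rule mod_homI) (auto simp: tuples_mem assms fun_eq_iff left_idealD[OF assms(1)])
qed

abbreviation (input) lower :: "('r, 'x) ring_scheme \<Rightarrow> nat \<Rightarrow> (nat \<Rightarrow> 'r) \<Rightarrow> nat \<Rightarrow> 'r" where
  "lower R k x \<equiv> (\<lambda>i. if i < k then x i else \<zero>\<^bsub>R\<^esub>)"

abbreviation (input) upper :: "nat \<Rightarrow> (nat \<Rightarrow> 'r) \<Rightarrow> nat \<Rightarrow> 'r" where
  "upper k x \<equiv> (\<lambda>i. x (i + k))"

abbreviation (input) shift :: "('r, 'x) ring_scheme \<Rightarrow> nat \<Rightarrow> (nat \<Rightarrow> 'r) \<Rightarrow> nat \<Rightarrow> 'r" where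
  "shift R k x \<equiv> (\<lambda>i. if i < k then \<zero>\<^bsub>R\<^esub> else x (i - k))"

definition join :: "nat \<Rightarrow> (nat \<Rightarrow> 'r) \<Rightarrow> (nat \<Rightarrow> 'r) \<Rightarrow> nat \<Rightarrow> 'r" where
  "join k x y = (\<lambda>i. if i < k then x i else y (i - k))"

lemma join_mem:
  assumes "left_ideal S R" "x \<in> carrier (tuples R S k)" "y \<in> carrier (tuples R S l)"
  shows "join k x y \<in> carrier (tuples R S (k + l))"
  using assms by (auto simp: tuples_mem join_def)

lemma lower_join:
  assumes "left_ideal S R" "x \<in> carrier (tuples R S k)"
  shows "lower R k (join k x y) = x"
  using assms by (auto simp: tuples_mem join_def fun_eq_iff)

lemma upper_join [simp]: "upper k (join k x y) = y"
  by (auto simp: join_def)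

lemma mod_hom_join:
  assumes "left_ideal S R" "f \<in> mod_hom R M (tuples R S k)" "g \<in> mod_hom R M (tuples R S l)"
  shows "(\<lambda>x. join k (f x) (g x)) \<in> mod_hom R M (tuples R S (k + l))"
  by (rule mod_homI) (auto simp: join_mem assms mod_homD[OF assms(2)] mod_homD[OF assms(3)],
    auto simp: join_def)

definition unit_tuple :: "('r, 'x) ring_scheme \<Rightarrow> 'r \<Rightarrow> nat \<Rightarrow> nat \<Rightarrow> 'r" where
  "unit_tuple R e i = (\<lambda>j. if j = i then e else \<zero>\<^bsub>R\<^esub>)"

locale idempotent = ring R for R (structure) +
  fixes e
  assumes e_closed [simp, intro]: "e \<in> carrier R" and e_idem [simp]: "e \<otimes> e = e"

lemma (in ring) idempotent_one: "idempotent R \<one>"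
  by (intro idempotent.intro ring_axioms idempotent_axioms.intro) auto

text \<open>The left ideal \<open>Re\<close>: the multiples of \<open>e\<close> are exactly the
  elements fixed by right multiplication with \<open>e\<close>, which makes membership an
  equation.\<close>

definition idem_ideal :: "('r, 'x) ring_scheme \<Rightarrow> 'r \<Rightarrow> 'r set" where
  "idem_ideal R e = {a \<in> carrier R. a \<otimes>\<^bsub>R\<^esub> e = a}"

text \<open>This is \<open>(Re)\<^sup>k\<close>; for \<open>e = 1\<close> it is free of rank \<open>k\<close>.\<close>

definition relfree :: "('r, 'x) ring_scheme \<Rightarrow> 'r \<Rightarrow> nat \<Rightarrow> ('r, nat \<Rightarrow> 'r) module" where
  "relfree R e k = tuples R (idem_ideal R e) k"

lemma relfree_simps [simp]:
  "zero (relfree R e k) = (\<lambda>_. \<zero>\<^bsub>R\<^esub>)"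
  "add (relfree R e k) = (\<lambda>x y i. x i \<oplus>\<^bsub>R\<^esub> y i)"
  "smult (relfree R e k) = (\<lambda>a x i. a \<otimes>\<^bsub>R\<^esub> x i)"
  by (simp_all add: relfree_def)

context idempotent
begin

lemma left_ideal_idem [simp]: "left_ideal (idem_ideal R e) R"
  by (auto simp: left_ideal_def idem_ideal_def l_distr m_assoc)

lemma relfree_mem:
  "x \<in> carrier (relfree R e k) \<longleftrightarrow>
    (\<forall>i. x i \<in> carrier R) \<and> (\<forall>i. x i \<otimes> e = x i) \<and> (\<forall>i\<ge>k. x i = \<zero>)"
  unfolding relfree_def tuples_mem[OF left_ideal_idem] by (auto simp: idem_ideal_def)

lemma left_module_relfree [simp, intro]: "left_module R (relfree R e k)"
  by (simp add: relfree_def left_module_tuples ring_axioms)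

lemma unit_tuple_mem: "i < k \<Longrightarrow> unit_tuple R e i \<in> carrier (relfree R e k)"
  by (auto simp: relfree_mem unit_tuple_def)

lemma smult_unit_tuple: "e \<odot>\<^bsub>relfree R e k\<^esub> unit_tuple R e i = unit_tuple R e i"
  by (auto simp: unit_tuple_def fun_eq_iff)

lemma relfree_generated:
  assumes "left_submodule N R (relfree R e k)" "\<And>i. i < k \<Longrightarrow> unit_tuple R e i \<in> N"
  shows "N = carrier (relfree R e k)"
proof -
  interpret F: left_module R "relfree R e k" by simp
  note D = left_submoduleD[OF assms(1)]
  \<comment> \<open>Induction on a bound \<open>j\<close> of the support. The top entry is split off
    as a multiple of a generator, which reproduces it because
    \<open>x j \<otimes> e = x j\<close>.\<close>
  have "x \<in> N" if "x \<in> carrier (relfree R e k)" "\<forall>i\<ge>j. x i = \<zero>" "j \<le> k" for x j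
    using that
  proof (induction j arbitrary: x)
    case 0
    then have "x = (\<lambda>_. \<zero>)" by auto
    then show ?case using D(3) by simp
  next
    case (Suc j)
    let ?y = "\<lambda>i. if i = j then \<zero> else x i"
    have xc: "x i \<in> carrier R" "x i \<otimes> e = x i" for i using Suc.prems(1) by (auto simp: relfree_mem)
    have "?y \<in> carrier (relfree R e k)"
      using Suc.prems(1) by (auto simp: relfree_mem)
    moreover have "\<forall>i\<ge>j. ?y i = \<zero>"
      using Suc.prems(2) by auto
    ultimately have y: "?y \<in> N" using Suc by auto
    have "x j \<odot>\<^bsub>relfree R e k\<^esub> unit_tuple R e j \<in> N"
      using D(5) assms(2) Suc.prems(3) xc by auto
    from D(4)[OF y this] have "(\<lambda>i. ?y i \<oplus> x j \<otimes> unit_tuple R e j i) \<in> N" by simp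
    also have "(\<lambda>i. ?y i \<oplus> x j \<otimes> unit_tuple R e j i) = x"
      using xc by (auto simp: unit_tuple_def fun_eq_iff)
    finally show ?case .
  qed
  then have "x \<in> N" if "x \<in> carrier (relfree R e k)" for x
    using that relfree_mem by blast
  then show ?thesis
    using D(2) by blast
qed

lemma relfree_hom_ext:
  assumes "left_module R M" "f \<in> mod_hom R (relfree R e k) M" "g \<in> mod_hom R (relfree R e k) M"
    and "\<And>i. i < k \<Longrightarrow> f (unit_tuple R e i) = g (unit_tuple R e i)"
    and "x \<in> carrier (relfree R e k)"
  shows "f x = g x"
proof -
  have "{x \<in> carrier (relfree R e k). f x = g x} = carrier (relfree R e k)"
    by (rule relfree_generated[OF left_submodule_eq]) (use assms unit_tuple_mem in auto)
  then show ?thesis using assms(5) by blast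
qed

text \<open>This is \<open>Hom(Re, M) = eM\<close> in several coordinates: the image of a generator
  is subject to the single condition of being fixed by \<open>e\<close>.\<close>

lemma relfree_hom_ex:
  assumes "left_module R M" "\<And>i. i < k \<Longrightarrow> v i \<in> carrier M" "\<And>i. i < k \<Longrightarrow> e \<odot>\<^bsub>M\<^esub> v i = v i"
  shows "\<exists>f\<in>mod_hom R (relfree R e k) M. \<forall>i<k. f (unit_tuple R e i) = v i"
proof -
  interpret M: left_module R M by fact
  show ?thesis
    using assms(2,3)
  proof (induction k)
    case 0
    show ?case using mod_hom_const_zero[OF assms(1)] by auto
  next
    case (Suc k)
    then obtain f where f: "f \<in> mod_hom R (relfree R e k) M"
        "\<And>i. i < k \<Longrightarrow> f (unit_tuple R e i) = v i" by auto
    let ?g = "\<lambda>x. f (lower R k x) \<oplus>\<^bsub>M\<^esub> x k \<odot>\<^bsub>M\<^esub> v k"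
    have vk: "v k \<in> carrier M" "e \<odot>\<^bsub>M\<^esub> v k = v k" using Suc.prems by auto
    have "(\<lambda>x. x k \<odot>\<^bsub>M\<^esub> v k) \<in> mod_hom R (relfree R e (Suc k)) M"
      by (rule mod_homI) (auto simp: relfree_mem vk M.smult_l_distr M.smult_assoc)
    moreover have "(\<lambda>x. f (lower R k x)) \<in> mod_hom R (relfree R e (Suc k)) M"
      using mod_hom_comp[OF tuples_fst[OF left_ideal_idem ring_axioms, of k "Suc k"] f(1)[unfolded relfree_def]]
      by (simp add: relfree_def)
    ultimately have g: "?g \<in> mod_hom R (relfree R e (Suc k)) M"
      using mod_hom_sum[OF assms(1)] by blast
    have z: "f (\<lambda>_. \<zero>) = \<zero>\<^bsub>M\<^esub>"
      using mod_hom_zero[OF left_module_relfree assms(1) f(1)] by simp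
    have u: "lower R k (unit_tuple R e i) = (if i < k then unit_tuple R e i else (\<lambda>_. \<zero>))" for i
      by (auto simp: unit_tuple_def fun_eq_iff)
    have "?g (unit_tuple R e i) = v i" if "i < Suc k" for i
    proof (cases "i = k")
      case True
      then show ?thesis using vk by (simp add: z u) (simp add: unit_tuple_def vk)
    next
      case False
      then have "i < k" "unit_tuple R e i k = \<zero>" using that by (auto simp: unit_tuple_def)
      then show ?thesis
        using vk(1) Suc.prems by (simp add: u f(2))
    qed
    then show ?case by (intro bexI[OF _ g]) simp
  qed
qed

text \<open>A preimage of the value at a generator need not be fixed by \<open>e\<close>, but
  \<open>e\<close> times it is, and that is still a preimage because the generator is fixed by
  \<open>e\<close>.\<close>

lemma relfree_lift:
  assumes "left_module R M" "left_module R X" "p \<in> mod_epi R M X" "f \<in> mod_hom R (relfree R e k) X"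
  obtains g where "g \<in> mod_hom R (relfree R e k) M"
    "\<And>x. x \<in> carrier (relfree R e k) \<Longrightarrow> p (g x) = f x"
proof -
  interpret M: left_module R M by fact
  interpret X: left_module R X by fact
  have "\<exists>v\<in>carrier M. e \<odot>\<^bsub>M\<^esub> v = v \<and> p v = f (unit_tuple R e i)" if "i < k" for i
  proof -
    have fi: "f (unit_tuple R e i) \<in> carrier X"
      using unit_tuple_mem[OF that] mod_homD[OF assms(4)] by blast
    then obtain v where v: "v \<in> carrier M" "p v = f (unit_tuple R e i)"
      using assms(3) by (auto elim: mod_epiE)
    have "p (e \<odot>\<^bsub>M\<^esub> v) = f (e \<odot>\<^bsub>relfree R e k\<^esub> unit_tuple R e i)"
      using v mod_homD(3)[OF mod_epiD(1)[OF assms(3)], of e v]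
        mod_homD(3)[OF assms(4) e_closed unit_tuple_mem[OF that]] by simp
    moreover have "e \<odot>\<^bsub>M\<^esub> (e \<odot>\<^bsub>M\<^esub> v) = e \<odot>\<^bsub>M\<^esub> v"
      using M.smult_assoc[of e e v] v by simp
    ultimately show ?thesis
      using v by (intro bexI[of _ "e \<odot>\<^bsub>M\<^esub> v"]) (auto simp: smult_unit_tuple simp del: relfree_simps)
  qed
  then obtain v where v: "\<And>i. i < k \<Longrightarrow> v i \<in> carrier M" "\<And>i. i < k \<Longrightarrow> e \<odot>\<^bsub>M\<^esub> v i = v i"
      "\<And>i. i < k \<Longrightarrow> p (v i) = f (unit_tuple R e i)" by metis
  obtain g where g: "g \<in> mod_hom R (relfree R e k) M" "\<And>i. i < k \<Longrightarrow> g (unit_tuple R e i) = v i"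
    using relfree_hom_ex[of M k v] assms(1) v(1,2) by auto
  have "p (g x) = f x" if "x \<in> carrier (relfree R e k)" for x
    by (rule relfree_hom_ext[OF assms(2) mod_hom_comp[OF g(1) mod_epiD(1)[OF assms(3)]] assms(4) _ that])
      (use g v in auto)
  then show ?thesis using that g by blast
qed

end

subsection \<open>Relative projective dimension\<close>

text \<open>The direct summands of powers of \<open>Re\<close>, written as retracts so that no
  complement has to be named. For \<open>e = 1\<close> these are the finitely generated projective
  modules, see \<open>fg_projective_iff\<close>.\<close>

definition relproj :: "('r, 'x) ring_scheme \<Rightarrow> 'r \<Rightarrow> ('r, 'm) module \<Rightarrow> bool" where
  "relproj R e P \<longleftrightarrow> left_module R P \<and>
     (\<exists>k. \<exists>j\<in>mod_hom R P (relfree R e k). \<exists>p\<in>mod_hom R (relfree R e k) P.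
        \<forall>x\<in>carrier P. p (j x) = x)"

lemma relprojI:
  assumes "left_module R P" "j \<in> mod_hom R P (relfree R e k)" "p \<in> mod_hom R (relfree R e k) P"
    and "\<And>x. x \<in> carrier P \<Longrightarrow> p (j x) = x"
  shows "relproj R e P"
  using assms by (auto simp: relproj_def)

lemma relprojE:
  assumes "relproj R e P"
  obtains k j p where "left_module R P" "j \<in> mod_hom R P (relfree R e k)"
    "p \<in> mod_hom R (relfree R e k) P" "\<And>x. x \<in> carrier P \<Longrightarrow> p (j x) = x"
  using assms by (auto simp: relproj_def)

lemma relproj_retract:
  assumes "left_module R P" "relproj R e Q" "j \<in> mod_hom R P Q" "p \<in> mod_hom R Q P"
    and "\<And>x. x \<in> carrier P \<Longrightarrow> p (j x) = x"
  shows "relproj R e P"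
proof -
  obtain k j' p' where *: "j' \<in> mod_hom R Q (relfree R e k)"
    "p' \<in> mod_hom R (relfree R e k) Q" "\<And>x. x \<in> carrier Q \<Longrightarrow> p' (j' x) = x"
    using assms(2) by (elim relprojE) blast
  show ?thesis
    by (rule relprojI[OF assms(1) mod_hom_comp[OF assms(3) *(1)] mod_hom_comp[OF *(2) assms(4)]])
      (use assms(5) *(3) mod_homD[OF assms(3)] in auto)
qed

context idempotent
begin

lemma relproj_lift:
  assumes "relproj R e P" "left_module R M" "left_module R X" "p \<in> mod_epi R M X" "f \<in> mod_hom R P X"
  obtains g where "g \<in> mod_hom R P M" "\<And>x. x \<in> carrier P \<Longrightarrow> p (g x) = f x"
proof -
  obtain k j q where *: "j \<in> mod_hom R P (relfree R e k)" "q \<in> mod_hom R (relfree R e k) P"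
      "\<And>x. x \<in> carrier P \<Longrightarrow> q (j x) = x"
    using assms(1) by (elim relprojE) blast
  obtain g where g: "g \<in> mod_hom R (relfree R e k) M"
      "\<And>x. x \<in> carrier (relfree R e k) \<Longrightarrow> p (g x) = f (q x)"
    using relfree_lift[OF assms(2-4) mod_hom_comp[OF *(2) assms(5)]] by blast
  show ?thesis
    by (rule that[OF mod_hom_comp[OF *(1) g(1)]]) (use g(2) * mod_homD[OF *(1)] in auto)
qed

lemma relproj_relfree [simp, intro]: "relproj R e (relfree R e k)"
  by (rule relprojI[OF left_module_relfree mod_hom_id mod_hom_id]) auto

end

text \<open>
  The recursion runs through kernels inside tuple modules, so that it stays on the single type
  \<open>nat \<Rightarrow> 'r\<close>; only the module resolved first has an arbitrary type.
\<close>

primrec pd_le_tuples :: "('r, 'x) ring_scheme \<Rightarrow> 'r \<Rightarrow> nat \<Rightarrow> ('r, nat \<Rightarrow> 'r) module \<Rightarrow> bool" where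
  "pd_le_tuples R e 0 X \<longleftrightarrow> relproj R e X"
| "pd_le_tuples R e (Suc n) X \<longleftrightarrow> left_module R X \<and>
     (\<exists>k. \<exists>f\<in>mod_epi R (relfree R e k) X. pd_le_tuples R e n (kerm (relfree R e k) X f))"

text \<open>For \<open>e = 1\<close> this bounds the projective dimension, see
  \<open>proj_dim_le_iff\<close>. For general \<open>e\<close> the resolution may use only summands
  of powers of \<open>Re\<close>, so a module that has one is in particular generated by its
  \<open>e\<close>-fixed vectors.\<close>

definition pd_le :: "('r, 'x) ring_scheme \<Rightarrow> 'r \<Rightarrow> nat \<Rightarrow> ('r, 'm) module \<Rightarrow> bool" where
  "pd_le R e n X = (case n of 0 \<Rightarrow> relproj R e X | Suc m \<Rightarrow> left_module R X \<and>
     (\<exists>k. \<exists>f\<in>mod_epi R (relfree R e k) X. pd_le_tuples R e m (kerm (relfree R e k) X f)))"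

lemma pd_le_tuples_eq: "pd_le_tuples R e n X = pd_le R e n X"
  by (cases n) (auto simp: pd_le_def)

lemma pd_le_0 [simp]: "pd_le R e 0 X \<longleftrightarrow> relproj R e X"
  by (simp add: pd_le_def)

lemma pd_le_Suc: "pd_le R e (Suc n) X \<longleftrightarrow> left_module R X \<and>
     (\<exists>k. \<exists>f\<in>mod_epi R (relfree R e k) X. pd_le R e n (kerm (relfree R e k) X f))"
  unfolding pd_le_tuples_eq[symmetric] by (simp add: pd_le_def)

lemma pd_le_SucI:
  assumes "left_module R X" "f \<in> mod_epi R (relfree R e k) X"
    "pd_le R e n (kerm (relfree R e k) X f)"
  shows "pd_le R e (Suc n) X"
  using assms by (auto simp: pd_le_Suc)

lemma pd_le_SucE:
  assumes "pd_le R e (Suc n) X"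
  obtains k f where "left_module R X" "f \<in> mod_epi R (relfree R e k) X"
    "pd_le R e n (kerm (relfree R e k) X f)"
  using assms by (auto simp: pd_le_Suc)

lemma pd_le_left_module: "pd_le R e n X \<Longrightarrow> left_module R X"
  by (cases n) (auto simp: relproj_def pd_le_Suc)

lemma pd_le_iso:
  assumes "left_module R N" "f \<in> mod_hom R M N" "bij_betw f (carrier M) (carrier N)" "pd_le R e n M"
  shows "pd_le R e n N"
proof -
  interpret M: left_module R M by (rule pd_le_left_module) fact
  interpret N: left_module R N by fact
  let ?g = "inv_into (carrier M) f"
  have g: "?g \<in> mod_hom R N M"
    by (rule inv_into_mod_hom[OF M.left_module_axioms assms(2,3)])
  show ?thesis
  proof (cases n)
    case 0
    show ?thesis
      using relproj_retract[OF assms(1) _ g assms(2)] assms(3,4) 0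
      by (auto simp: bij_betw_def f_inv_into_f)
  next
    case (Suc m)
    with assms(4) obtain k h where h: "h \<in> mod_epi R (relfree R e k) M"
      "pd_le R e m (kerm (relfree R e k) M h)" by (auto elim: pd_le_SucE)
    have epi: "(\<lambda>x. f (h x)) \<in> mod_epi R (relfree R e k) N"
      using mod_epi_comp[OF h(1), of f N] assms(2,3) by (auto simp: mod_epi_def bij_betw_def)
    have "f y = \<zero>\<^bsub>N\<^esub> \<longleftrightarrow> y = \<zero>\<^bsub>M\<^esub>" if "y \<in> carrier M" for y
      using mod_hom_zero[OF M.left_module_axioms assms(1,2)] assms(3) that
      by (metis M.M.zero_closed bij_betw_imp_inj_on inj_on_contraD)
    then have "kerm (relfree R e k) N (\<lambda>x. f (h x)) = kerm (relfree R e k) M h"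
      using mod_homD(1)[OF mod_epiD(1)[OF h(1)]] by (intro kerm_cong) simp
    then show ?thesis
      using pd_le_SucI[OF assms(1) epi] h(2) Suc by simp
  qed
qed

section \<open>Relative dimension in short exact sequences\<close>

text \<open>
  For a short exact sequence the kernel is always taken literally, as a submodule of the middle
  term.
\<close>

context idempotent
begin

lemma relfree_embed:
  shows relfree_lower: "(\<lambda>x. lower R k x) \<in> mod_hom R (relfree R e l) (relfree R e k)"
    and relfree_upper: "upper k \<in> mod_hom R (relfree R e (k + l)) (relfree R e l)"
  unfolding relfree_def
  by (rule tuples_embed[OF left_ideal_idem ring_axioms]; assumption)+

text \<open>If \<open>X\<close> is a summand of \<open>F = (Re)^k\<close>, the projection
  \<open>p\<close> is a cover whose kernel is the complementary summand, cut out by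
  \<open>z - j (p z)\<close>. Greater lengths follow by recursion.\<close>

lemma pd_le_mono_Suc:
  assumes "pd_le R e n X"
  shows "pd_le R e (Suc n) X"
proof -
  have 0: "pd_le R e (Suc 0) X" if X: "relproj R e X" for X :: "('a, 'm) module"
  proof -
    obtain k j p where jp: "left_module R X" "j \<in> mod_hom R X (relfree R e k)"
      "p \<in> mod_hom R (relfree R e k) X" "\<And>x. x \<in> carrier X \<Longrightarrow> p (j x) = x"
      using X by (elim relprojE) blast
    interpret X: left_module R X by fact
    interpret F: left_module R "relfree R e k" by simp
    let ?K = "kerm (relfree R e k) X p"
    have K: "left_module R ?K" by (rule left_module_kerm) (use jp in auto)
    let ?q = "\<lambda>z. mdiff R (relfree R e k) z (j (p z))"
    have q: "?q \<in> mod_hom R (relfree R e k) (relfree R e k)"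
      by (rule mod_hom_diff[OF F.left_module_axioms mod_hom_id mod_hom_comp[OF jp(3,2)]])
    have qK: "?q z \<in> carrier ?K" if "z \<in> carrier (relfree R e k)" for z
      using that mod_homD[OF jp(2)] mod_homD[OF jp(3)] jp(4)
      by (simp add: mod_hom_mdiff[OF F.left_module_axioms jp(3)] del: relfree_simps)
    have "relproj R e ?K"
    proof (rule relprojI[OF K kerm_incl])
      show "?q \<in> mod_hom R (relfree R e k) ?K"
        by (rule mod_homI) (use qK mod_homD[OF q] in auto)
      show "?q x = x" if "x \<in> carrier ?K" for x
        using that mod_hom_zero[OF X.left_module_axioms F.left_module_axioms jp(2)]
        by (simp del: relfree_simps)
    qed
    moreover have "p \<in> mod_epi R (relfree R e k) X"
      by (rule mod_epiI[OF jp(3)]) (use jp(4) mod_homD[OF jp(2)] in blast)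
    ultimately show ?thesis
      using pd_le_SucI[OF jp(1), of p e k 0] by simp
  qed
  have tup: "pd_le R e n X \<Longrightarrow> pd_le R e (Suc n) X" for X :: "('a, nat \<Rightarrow> 'a) module" and n
  proof (induction n arbitrary: X)
    case (Suc n)
    then show ?case by (metis pd_le_Suc)
  qed (use relproj_def in \<open>auto intro!: 0\<close>)
  show ?thesis
  proof (cases n)
    case (Suc m)
    then show ?thesis using assms tup by (metis pd_le_Suc)
  qed (use assms 0 in auto)
qed

lemma pd_le_mono:
  assumes "pd_le R e n X" "n \<le> m"
  shows "pd_le R e m X"
  using assms(2,1) by (induction rule: dec_induct) (auto intro: pd_le_mono_Suc)

lemma relproj_ext:
  assumes "left_module R M" "left_module R X" "p \<in> mod_epi R M X"
    and "relproj R e (kerm M X p)" "relproj R e X"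
  shows "relproj R e M"
proof -
  interpret M: left_module R M by fact
  interpret X: left_module R X by fact
  note p = mod_epiD(1)[OF assms(3)]
  obtain s where s: "s \<in> mod_hom R X M" "\<And>x. x \<in> carrier X \<Longrightarrow> p (s x) = x"
    using relproj_lift[OF assms(5,1,2,3) mod_hom_id] by blast
  obtain k j q where jq: "left_module R (kerm M X p)" "j \<in> mod_hom R (kerm M X p) (relfree R e k)"
    "q \<in> mod_hom R (relfree R e k) (kerm M X p)" "\<And>x. x \<in> carrier (kerm M X p) \<Longrightarrow> q (j x) = x"
    using assms(4) by (elim relprojE) blast
  obtain l j' q' where jq': "j' \<in> mod_hom R X (relfree R e l)"
    "q' \<in> mod_hom R (relfree R e l) X" "\<And>x. x \<in> carrier X \<Longrightarrow> q' (j' x) = x"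
    using assms(5) by (elim relprojE) blast
  define r where "r = (\<lambda>m. mdiff R M m (s (p m)))"
  have r: "r \<in> mod_hom R M M"
    unfolding r_def by (rule mod_hom_diff[OF assms(1) mod_hom_id mod_hom_comp[OF p s(1)]])
  have "r m \<in> carrier (kerm M X p)" if "m \<in> carrier M" for m
    using that mod_homD[OF p] mod_homD[OF s(1)] s(2)
    by (simp add: r_def mod_hom_mdiff[OF assms(1) p])
  then have r': "r \<in> mod_hom R M (kerm M X p)"
    by (intro mod_homI) (auto simp: mod_homD[OF r])
  let ?J = "\<lambda>m. join k (j (r m)) (j' (p m))"
  let ?Q = "\<lambda>z. q (lower R k z) \<oplus>\<^bsub>M\<^esub> s (q' (upper k z))"
  have J: "?J \<in> mod_hom R M (relfree R e (k + l))"
    unfolding relfree_def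
    by (rule mod_hom_join[OF left_ideal_idem])
      (use mod_hom_comp[OF r' jq(2)] mod_hom_comp[OF p jq'(1)] in \<open>auto simp: relfree_def\<close>)
  have Q: "?Q \<in> mod_hom R (relfree R e (k + l)) M"
    by (rule mod_hom_sum[OF assms(1)])
      (rule mod_hom_comp[OF mod_hom_comp[OF relfree_lower jq(3)] kerm_incl]
        mod_hom_comp[OF mod_hom_comp[OF relfree_upper jq'(2)] s(1)])+
  show ?thesis
  proof (rule relprojI[OF assms(1) J Q])
    fix x assume x: "x \<in> carrier M"
    have "lower R k (?J x) = j (r x)"
      using lower_join[OF left_ideal_idem] mod_homD[OF mod_hom_comp[OF r' jq(2)]] x
      by (simp add: relfree_def)
    then have "?Q (?J x) = r x \<oplus>\<^bsub>M\<^esub> s (p x)"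
      using x mod_homD[OF r'] mod_homD[OF p] by (simp add: jq(4) jq'(3))
    then show "?Q (?J x) = x"
      using x mod_homD[OF p] mod_homD[OF s(1)] by (simp add: r_def)
  qed
qed

text \<open>Horseshoe lemma. A cover of the kernel and a lift to \<open>M\<close> of a cover of
  \<open>X\<close> add up to a cover of \<open>M\<close>. The kernels of the three covers form a
  short exact sequence of modules of tuples, to which \<open>IH\<close> applies.\<close>

lemma pd_le_ext_step:
  assumes IH: "\<And>(M :: ('a, nat \<Rightarrow> 'a) module) (X :: ('a, nat \<Rightarrow> 'a) module) p.
      \<lbrakk>left_module R M; left_module R X; p \<in> mod_epi R M X; pd_le R e n (kerm M X p); pd_le R e n X\<rbrakk>
      \<Longrightarrow> pd_le R e n M"
    and "left_module R M" "left_module R X" "p \<in> mod_epi R M X"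
    and "pd_le R e (Suc n) (kerm M X p)" "pd_le R e (Suc n) X"
  shows "pd_le R e (Suc n) M"
proof -
  interpret M: left_module R M by fact
  interpret X: left_module R X by fact
  note p = mod_epiD(1)[OF assms(4)]
  let ?K = "kerm M X p"
  interpret K: left_module R ?K by (rule left_module_kerm) (use assms(2,3) p in auto)
  obtain k f where f: "f \<in> mod_epi R (relfree R e k) ?K" "pd_le R e n (kerm (relfree R e k) ?K f)"
    using assms(5) by (elim pd_le_SucE) blast
  obtain l g where g: "g \<in> mod_epi R (relfree R e l) X" "pd_le R e n (kerm (relfree R e l) X g)"
    using assms(6) by (elim pd_le_SucE) blast
  obtain h where h: "h \<in> mod_hom R (relfree R e l) M"
      "\<And>x. x \<in> carrier (relfree R e l) \<Longrightarrow> p (h x) = g x"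
    using relfree_lift[OF assms(2,3,4) mod_epiD(1)[OF g(1)]] by blast
  let ?F = "relfree R e (k + l)"
  interpret F: left_module R ?F by simp
  define G where "G = (\<lambda>z. f (lower R k z) \<oplus>\<^bsub>M\<^esub> h (upper k z))"
  note fh = mod_epiD(1)[OF f(1)] and gh = mod_epiD(1)[OF g(1)]
  have lo: "lower R k z \<in> carrier (relfree R e k)" and up: "upper k z \<in> carrier (relfree R e l)"
    if "z \<in> carrier ?F" for z
    using that mod_homD(1)[OF relfree_lower] mod_homD(1)[OF relfree_upper] by blast+
  have fc: "f z \<in> carrier M" "p (f z) = \<zero>\<^bsub>X\<^esub>" if "z \<in> carrier (relfree R e k)" for z
    using mod_homD(1)[OF fh that] by auto
  have G: "G \<in> mod_hom R ?F M"
    unfolding G_def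
    by (rule mod_hom_sum[OF assms(2)])
      (rule mod_hom_comp[OF mod_hom_comp[OF relfree_lower fh] kerm_incl]
        mod_hom_comp[OF relfree_upper h(1)])+
  have pG: "p (G z) = g (upper k z)" if "z \<in> carrier ?F" for z
    unfolding G_def
    using fc[OF lo[OF that]] h(2)[OF up[OF that]] mod_homD(1)[OF h(1) up[OF that]]
      mod_homD(1)[OF gh up[OF that]] by (simp add: mod_homD(2)[OF p])
  have Gj: "G (join k x y) = f x \<oplus>\<^bsub>M\<^esub> h y" "join k x y \<in> carrier ?F"
    if "x \<in> carrier (relfree R e k)" "y \<in> carrier (relfree R e l)" for x y
    using that lower_join[OF left_ideal_idem, of x] join_mem[OF left_ideal_idem, of x]
    by (simp_all add: G_def relfree_def)
  have Gepi: "G \<in> mod_epi R ?F M"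
  proof (rule mod_epiI[OF G])
    fix m assume m: "m \<in> carrier M"
    obtain y where y: "y \<in> carrier (relfree R e l)" "g y = p m"
      using g(1) mod_homD(1)[OF p m] by (elim mod_epiE) auto
    then have "mdiff R M m (h y) \<in> carrier ?K"
      using m mod_homD(1)[OF h(1) y(1)] mod_homD(1)[OF p m] h(2)[OF y(1)]
      by (simp add: mod_hom_mdiff[OF assms(2) p])
    then obtain x where x: "x \<in> carrier (relfree R e k)" "f x = mdiff R M m (h y)"
      using f(1) by (elim mod_epiE)
    show "\<exists>z\<in>carrier ?F. G z = m"
      using Gj[OF x(1) y(1)] x(2) m mod_homD(1)[OF h(1) y(1)] by auto
  qed
  let ?W = "kerm ?F M G" and ?N = "kerm (relfree R e l) X g"
  have W: "left_module R ?W" by (rule left_module_kerm) (use assms(2) G in auto)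
  have N: "left_module R ?N" by (rule left_module_kerm) (use assms(3) gh in auto)
  have upN: "upper k z \<in> carrier ?N" if "z \<in> carrier ?W" for z
    using that pG[of z] up[of z] mod_hom_zero[OF assms(2,3) p] by simp
  have hom: "upper k \<in> mod_hom R ?W ?N"
    by (rule mod_homI) (use upN in auto)
  have "upper k \<in> mod_epi R ?W ?N"
  proof (rule mod_epiI[OF hom])
    fix y assume y: "y \<in> carrier ?N"
    then have y': "y \<in> carrier (relfree R e l)" "g y = \<zero>\<^bsub>X\<^esub>" by auto
    \<comment> \<open>Since \<open>g y\<close> is zero, \<open>h y\<close> lies in the kernel of
      \<open>p\<close>; a tuple \<open>x\<close> with \<open>f x = - h y\<close> completes
      \<open>y\<close> to an element of the kernel of \<open>G\<close>.\<close>
    have hy: "h y \<in> carrier ?K" using y' h(2) mod_homD(1)[OF h(1)] by auto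
    then have "\<ominus>\<^bsub>?K\<^esub> h y \<in> carrier ?K" by (rule K.a_inv_closed)
    then obtain x where x: "x \<in> carrier (relfree R e k)" "f x = \<ominus>\<^bsub>?K\<^esub> h y"
      using f(1) by (elim mod_epiE)
    have "G (join k x y) = \<zero>\<^bsub>M\<^esub>"
      using Gj[OF x(1) y'(1)] x(2) K.l_neg[OF hy] by simp
    then show "\<exists>z\<in>carrier ?W. upper k z = y"
      using Gj(2)[OF x(1) y'(1)] by (intro bexI[of _ "join k x y"]) auto
  qed
  moreover have "pd_le R e n (kerm ?W ?N (upper k))"
  proof (rule pd_le_iso[OF _ _ _ f(2)])
    show WN: "left_module R (kerm ?W ?N (upper k))"
      by (rule left_module_kerm[OF W N hom])
    have h0: "h (\<lambda>_. \<zero>) = \<zero>\<^bsub>M\<^esub>" using mod_hom_zero[OF left_module_relfree assms(2) h(1)] by simp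
    have eq: "lower R k z = z \<and> upper k z = (\<lambda>_. \<zero>)" if "z \<in> carrier (relfree R e k)" for z
      using that by (auto simp: relfree_mem fun_eq_iff)
    \<comment> \<open>A tuple in \<open>?W\<close> with zero upper part is itself a tuple of length
      \<open>k\<close> killed by \<open>f\<close>, so the isomorphism is the identity.\<close>
    have *: "z \<in> carrier (kerm ?W ?N (upper k)) \<longleftrightarrow> z \<in> carrier (kerm (relfree R e k) ?K f)" for z
    proof
      assume z: "z \<in> carrier (kerm ?W ?N (upper k))"
      then have zF: "z \<in> carrier ?F" "upper k z = (\<lambda>_. \<zero>)" "G z = \<zero>\<^bsub>M\<^esub>" by auto
      have "z i = \<zero>" if "i \<ge> k" for i
        using zF(2) that by (metis le_add_diff_inverse2)
      then have zk: "z \<in> carrier (relfree R e k)" using zF(1) by (auto simp: relfree_mem)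
      then show "z \<in> carrier (kerm (relfree R e k) ?K f)"
        using zF(3) eq[OF zk] fc(1)[OF zk] by (simp add: G_def h0)
    next
      assume z: "z \<in> carrier (kerm (relfree R e k) ?K f)"
      then have zk: "z \<in> carrier (relfree R e k)" "f z = \<zero>\<^bsub>M\<^esub>" by auto
      have "z \<in> carrier ?F"
        using zk(1) by (auto simp: relfree_mem)
      then show "z \<in> carrier (kerm ?W ?N (upper k))"
        using zk(2) eq[OF zk(1)] by (simp add: G_def h0)
    qed
    show "(\<lambda>x. x) \<in> mod_hom R (kerm (relfree R e k) ?K f) (kerm ?W ?N (upper k))"
      by (rule mod_homI) (use * in auto)
    show "bij_betw (\<lambda>x. x) (carrier (kerm (relfree R e k) ?K f)) (carrier (kerm ?W ?N (upper k)))"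
      using * by (auto simp: bij_betw_def)
  qed
  ultimately have "pd_le R e n ?W"
    by (rule IH[OF W N _ _ g(2)])
  then show ?thesis by (rule pd_le_SucI[OF assms(2) Gepi])
qed

lemma pd_le_ext_tuples:
  fixes M :: "('a, nat \<Rightarrow> 'a) module" and X :: "('a, nat \<Rightarrow> 'a) module"
  assumes "left_module R M" "left_module R X" "p \<in> mod_epi R M X"
    and "pd_le R e n (kerm M X p)" "pd_le R e n X"
  shows "pd_le R e n M"
  using assms
proof (induction n arbitrary: M X p)
  case 0
  then show ?case using relproj_ext by auto
next
  case (Suc n)
  show ?case
    by (rule pd_le_ext_step[OF Suc.IH Suc.prems])
qed

lemma pd_le_ext:
  assumes "left_module R M" "left_module R X" "p \<in> mod_epi R M X"
    and "pd_le R e n (kerm M X p)" "pd_le R e n X"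
  shows "pd_le R e n M"
proof (cases n)
  case 0
  then show ?thesis using relproj_ext[OF assms(1-3)] assms(4,5) by auto
next
  case (Suc m)
  show ?thesis
    unfolding Suc
    by (rule pd_le_ext_step[OF _ assms(1-3)], erule (4) pd_le_ext_tuples) (use assms Suc in auto)
qed

text \<open>For a cover \<open>f\<close> of \<open>M\<close>, the kernel of \<open>p\<close> after
  \<open>f\<close> maps onto the kernel of \<open>p\<close>, and the kernel of that map is the
  kernel of \<open>f\<close>. It is thus an extension of two modules of length at most
  \<open>n\<close>.\<close>

lemma pd_le_cokernel:
  assumes "left_module R M" "left_module R X" "p \<in> mod_epi R M X"
    and "pd_le R e n (kerm M X p)" "pd_le R e (Suc n) M"
  shows "pd_le R e (Suc n) X"
proof -
  interpret M: left_module R M by fact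
  interpret X: left_module R X by fact
  note p = mod_epiD(1)[OF assms(3)]
  obtain k f where f: "f \<in> mod_epi R (relfree R e k) M" "pd_le R e n (kerm (relfree R e k) M f)"
    using assms(5) by (elim pd_le_SucE) blast
  note fh = mod_epiD(1)[OF f(1)]
  let ?F = "relfree R e k" and ?g = "\<lambda>x. p (f x)"
  have g: "?g \<in> mod_epi R ?F X" by (rule mod_epi_comp[OF f(1) assms(3)])
  note gh = mod_epiD(1)[OF g]
  have N: "left_module R (kerm ?F X ?g)" by (rule left_module_kerm) (use assms gh in auto)
  have K: "left_module R (kerm M X p)" by (rule left_module_kerm) (use assms p in auto)
  have hom: "f \<in> mod_hom R (kerm ?F X ?g) (kerm M X p)"
    by (rule mod_homI) (use mod_homD[OF fh] in auto)
  have epi: "f \<in> mod_epi R (kerm ?F X ?g) (kerm M X p)"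
  proof (rule mod_epiI[OF hom])
    fix y assume "y \<in> carrier (kerm M X p)"
    then have y: "y \<in> carrier M" "p y = \<zero>\<^bsub>X\<^esub>" by auto
    obtain x where "x \<in> carrier ?F" "f x = y" using f(1) y(1) by (elim mod_epiE)
    then show "\<exists>x\<in>carrier (kerm ?F X ?g). f x = y" using y by auto
  qed
  have "kerm (kerm ?F X ?g) (kerm M X p) f = kerm ?F M f"
    using mod_hom_zero[OF assms(1,2) p] by (auto simp: kerm_kerm kerm_def intro!: arg_cong[of _ _ "\<lambda>C. ?F\<lparr>carrier := C\<rparr>"])
  then have "pd_le R e n (kerm ?F X ?g)"
    using pd_le_ext[OF N K epi _ assms(4)] f(2) by simp
  then show ?thesis by (rule pd_le_SucI[OF assms(2) g])
qed

end

context idempotent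
begin

text \<open>Schanuel's argument. The pullback \<open>?Q\<close> of \<open>g\<close> and of the cover
  \<open>f\<close> given by the resolution maps onto the source of \<open>g\<close> with the kernel
  of \<open>f\<close>, which bounds \<open>?Q\<close>. It also maps onto the source of
  \<open>f\<close> with the kernel of \<open>g\<close>, and this second sequence splits. Closure
  under retracts is a hypothesis because its own proof in length \<open>n + 1\<close> calls this
  lemma in length \<open>n\<close>.\<close>

lemma pd_le_kernel_relfree_step:
  assumes retract: "\<And>(M :: ('a, nat \<Rightarrow> 'a) module) (X :: ('a, nat \<Rightarrow> 'a) module) j q.
      \<lbrakk>left_module R X; pd_le R e n M; j \<in> mod_hom R X M; q \<in> mod_hom R M X;
        \<forall>x\<in>carrier X. q (j x) = x\<rbrakk> \<Longrightarrow> pd_le R e n X"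
    and "pd_le R e (Suc n) X" "g \<in> mod_epi R (relfree R e k') X"
  shows "pd_le R e n (kerm (relfree R e k') X g)"
proof -
  obtain k f where f: "left_module R X" "f \<in> mod_epi R (relfree R e k) X"
      "pd_le R e n (kerm (relfree R e k) X f)"
    using assms(2) by (elim pd_le_SucE) blast
  interpret X: left_module R X by fact
  let ?F = "relfree R e (k' + k)" and ?F1 = "relfree R e k'" and ?F2 = "relfree R e k"
  interpret F: left_module R ?F by simp
  interpret F2: left_module R ?F2 by simp
  note fh = mod_epiD(1)[OF f(2)] and gh = mod_epiD(1)[OF assms(3)]
  \<comment> \<open>The kernel of the difference of the two maps is the pullback.\<close>
  let ?d = "\<lambda>z. mdiff R X (g (lower R k' z)) (f (upper k' z))"
  let ?Q = "kerm ?F X ?d" and ?K = "kerm ?F1 X g" and ?L = "kerm ?F2 X f"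
  have d: "?d \<in> mod_hom R ?F X"
    by (rule mod_hom_diff[OF X.left_module_axioms mod_hom_comp[OF relfree_lower gh]
          mod_hom_comp[OF relfree_upper fh]])
  have Q: "left_module R ?Q" by (rule left_module_kerm) (use d f(1) in auto)
  interpret Q: left_module R ?Q by fact
  have K: "left_module R ?K" by (rule left_module_kerm) (use gh f(1) in auto)
  have lo: "lower R k' z \<in> carrier ?F1" and up: "upper k' z \<in> carrier ?F2" if "z \<in> carrier ?F" for z
    using that mod_homD(1)[OF relfree_lower] mod_homD(1)[OF relfree_upper] by blast+
  have Qmem: "z \<in> carrier ?Q \<longleftrightarrow> z \<in> carrier ?F \<and> g (lower R k' z) = f (upper k' z)" for z
    using mod_homD(1)[OF gh lo] mod_homD(1)[OF fh up] by (auto simp: X.mdiff_eq_zero_iff)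
  have jn: "join k' x y \<in> carrier ?Q" "lower R k' (join k' x y) = x"
    if "x \<in> carrier ?F1" "y \<in> carrier ?F2" "g x = f y" for x y
  proof -
    show lj: "lower R k' (join k' x y) = x"
      using that lower_join[OF left_ideal_idem] by (simp add: relfree_def)
    have "join k' x y \<in> carrier ?F"
      using that join_mem[OF left_ideal_idem, of x k' y k] by (simp add: relfree_def)
    then show "join k' x y \<in> carrier ?Q"
      unfolding Qmem lj using that by simp
  qed
  have lohom: "(\<lambda>z. lower R k' z) \<in> mod_hom R ?Q ?F1"
    by (rule mod_hom_comp[OF kerm_incl relfree_lower])
  have uphom: "upper k' \<in> mod_hom R ?Q ?F2"
    by (rule mod_hom_comp[OF kerm_incl relfree_upper])
  have loepi: "(\<lambda>z. lower R k' z) \<in> mod_epi R ?Q ?F1"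
  proof (rule mod_epiI[OF lohom])
    fix x assume x: "x \<in> carrier ?F1"
    obtain y where y: "y \<in> carrier ?F2" "f y = g x"
      by (rule mod_epiE[OF f(2) mod_homD(1)[OF gh x]])
    note xy = x y(1) y(2)[symmetric]
    show "\<exists>z\<in>carrier ?Q. lower R k' z = x"
      using jn(2)[OF xy] jn(1)[OF xy] by (rule bexI)
  qed
  have upepi: "upper k' \<in> mod_epi R ?Q ?F2"
  proof (rule mod_epiI[OF uphom])
    fix y assume y: "y \<in> carrier ?F2"
    obtain x where x: "x \<in> carrier ?F1" "g x = f y"
      by (rule mod_epiE[OF assms(3) mod_homD(1)[OF fh y]])
    show "\<exists>z\<in>carrier ?Q. upper k' z = y"
      using upper_join jn(1)[OF x(1) y x(2)] by (rule bexI)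
  qed
  have f0: "f (\<lambda>_. \<zero>) = \<zero>\<^bsub>X\<^esub>"
    using mod_hom_zero[OF left_module_relfree f(1) fh] by simp
  have g0: "g (\<lambda>_. \<zero>) = \<zero>\<^bsub>X\<^esub>"
    using mod_hom_zero[OF left_module_relfree f(1) gh] by simp
  have "pd_le R e n (kerm ?Q ?F1 (\<lambda>z. lower R k' z))"
  proof (rule pd_le_iso[OF _ _ _ f(3)])
    show "left_module R (kerm ?Q ?F1 (\<lambda>z. lower R k' z))"
      by (rule left_module_kerm[OF Q left_module_relfree lohom])
    have sh: "shift R k' y \<in> carrier (kerm ?Q ?F1 (\<lambda>z. lower R k' z))" if "y \<in> carrier ?L" for y
    proof -
      have y: "y \<in> carrier ?F2" "f y = \<zero>\<^bsub>X\<^esub>" using that by auto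
      have "shift R k' y = join k' (\<lambda>_. \<zero>) y" by (simp add: join_def)
      moreover have "(\<lambda>_. \<zero>) \<in> carrier ?F1" by (auto simp: relfree_mem)
      ultimately show ?thesis
        using jn[of "\<lambda>_. \<zero>" y] y g0 by simp
    qed
    show "shift R k' \<in> mod_hom R ?L (kerm ?Q ?F1 (\<lambda>z. lower R k' z))"
      by (rule mod_homI, rule sh) auto
    show "bij_betw (shift R k') (carrier ?L) (carrier (kerm ?Q ?F1 (\<lambda>z. lower R k' z)))"
    proof (rule bij_betw_byWitness[where f' = "upper k'"])
      show "shift R k' ` carrier ?L \<subseteq> carrier (kerm ?Q ?F1 (\<lambda>z. lower R k' z))" using sh by blast
      have z: "upper k' z \<in> carrier ?L" "shift R k' (upper k' z) = z"
        if "z \<in> carrier (kerm ?Q ?F1 (\<lambda>z. lower R k' z))" for z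
      proof -
        have z: "z \<in> carrier ?F" "lower R k' z = (\<lambda>_. \<zero>)" "g (lower R k' z) = f (upper k' z)"
          using that Qmem[of z] by auto
        then show "upper k' z \<in> carrier ?L" using up g0 by simp
        have "z i = \<zero>" if "i < k'" for i
          using fun_cong[OF z(2), of i] that by simp
        then show "shift R k' (upper k' z) = z"
          by (auto simp: fun_eq_iff)
      qed
      then show "\<forall>z\<in>carrier (kerm ?Q ?F1 (\<lambda>z. lower R k' z)). shift R k' (upper k' z) = z" by blast
      show "upper k' ` carrier (kerm ?Q ?F1 (\<lambda>z. lower R k' z)) \<subseteq> carrier ?L" using z by blast
    qed simp
  qed
  then have pdQ: "pd_le R e n ?Q"
    by (rule pd_le_ext[OF Q left_module_relfree loepi]) (rule pd_le_mono[of 0], auto)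
  obtain \<sigma> where \<sigma>: "\<sigma> \<in> mod_hom R ?F2 ?Q" "\<And>y. y \<in> carrier ?F2 \<Longrightarrow> upper k' (\<sigma> y) = y"
    using relfree_lift[OF Q left_module_relfree upepi mod_hom_id] by blast
  have \<sigma>0: "\<sigma> (\<lambda>_. \<zero>) = (\<lambda>_. \<zero>)"
    using mod_hom_zero[OF left_module_relfree Q \<sigma>(1)] by simp
  \<comment> \<open>The projection of \<open>?Q\<close> onto the kernel of \<open>upper k'\<close>
    along the splitting \<open>\<sigma>\<close>.\<close>
  let ?r = "\<lambda>z. mdiff R ?Q z (\<sigma> (upper k' z))"
  have r: "?r \<in> mod_hom R ?Q ?Q"
    by (rule mod_hom_diff[OF Q mod_hom_id mod_hom_comp[OF uphom \<sigma>(1)]])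
  have q: "(\<lambda>z. lower R k' (?r z)) \<in> mod_hom R ?Q ?F1"
    by (rule mod_hom_comp[OF r lohom])
  have qK: "lower R k' (?r z) \<in> carrier ?K" if z: "z \<in> carrier ?Q" for z
  proof -
    have rz: "?r z \<in> carrier ?Q" by (rule mod_homD(1)[OF r z])
    have uz: "upper k' z \<in> carrier ?F2" by (rule mod_homD(1)[OF uphom z])
    have "upper k' (?r z) = mdiff R ?F2 (upper k' z) (upper k' (\<sigma> (upper k' z)))"
      by (rule mod_hom_mdiff[OF Q uphom z mod_homD(1)[OF \<sigma>(1) uz]])
    also have "\<dots> = (\<lambda>_. \<zero>)" using uz \<sigma>(2)[OF uz] F2.mdiff_self by simp
    finally have "g (lower R k' (?r z)) = \<zero>\<^bsub>X\<^esub>"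
      using rz f0 unfolding Qmem by metis
    then show ?thesis
      using mod_homD(1)[OF q z] by simp
  qed
  show ?thesis
  proof (rule retract[OF K pdQ])
    have eq: "lower R k' x = x" "upper k' x = (\<lambda>_. \<zero>)" "x \<in> carrier ?Q" if "x \<in> carrier ?K" for x
    proof -
      have x: "x \<in> carrier ?F1" "g x = \<zero>\<^bsub>X\<^esub>" using that by auto
      then show 1: "lower R k' x = x" "upper k' x = (\<lambda>_. \<zero>)"
        by (auto simp: relfree_mem fun_eq_iff)
      have "x \<in> carrier ?F" using x(1) by (auto simp: relfree_mem)
      then show "x \<in> carrier ?Q" unfolding Qmem 1 using x f0 by simp
    qed
    show "(\<lambda>x. x) \<in> mod_hom R ?K ?Q"
      by (rule mod_homI) (use eq in auto)
    show "(\<lambda>z. lower R k' (?r z)) \<in> mod_hom R ?Q ?K"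
      by (rule mod_homI) (use qK mod_homD(2,3)[OF q] in auto)
    have "lower R k' (?r x) = x" if "x \<in> carrier ?K" for x
    proof -
      have "?r x = x" using eq[OF that] \<sigma>0 Q.mdiff_zero_r[OF eq(3)[OF that]] by simp
      then show ?thesis using eq(1)[OF that] by (simp only:)
    qed
    then show "\<forall>x\<in>carrier ?K. lower R k' (?r x) = x" by blast
  qed
qed

text \<open>For a cover \<open>f\<close> of \<open>M\<close> there is no evident retraction from the
  kernel of \<open>f\<close> to the kernel of \<open>q\<close> after \<open>f\<close>. A doubled
  cover adapted to the idempotent \<open>\<pi> = j q\<close> has one: it is \<open>\<pi> f\<close>
  on the first copy and \<open>(1 - \<pi>) f\<close> on the second. The kernel of \<open>q\<close>
  after \<open>f\<close> sits in its kernel as the tuples with zero second half, and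
  \<open>lower\<close> retracts onto it.\<close>

lemma pd_le_retract_step:
  assumes retract: "\<And>(M :: ('a, nat \<Rightarrow> 'a) module) (X :: ('a, nat \<Rightarrow> 'a) module) j q.
      \<lbrakk>left_module R X; pd_le R e n M; j \<in> mod_hom R X M; q \<in> mod_hom R M X;
        \<forall>x\<in>carrier X. q (j x) = x\<rbrakk> \<Longrightarrow> pd_le R e n X"
    and "left_module R X" "pd_le R e (Suc n) M" "j \<in> mod_hom R X M" "q \<in> mod_hom R M X"
    and qj: "\<And>x. x \<in> carrier X \<Longrightarrow> q (j x) = x"
  shows "pd_le R e (Suc n) X"
proof -
  obtain k f where f: "left_module R M" "f \<in> mod_epi R (relfree R e k) M"
    using assms(3) by (elim pd_le_SucE) blast
  interpret M: left_module R M by fact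
  interpret X: left_module R X by fact
  let ?F = "relfree R e k" and ?FF = "relfree R e (k + k)"
  note fh = mod_epiD(1)[OF f(2)]
  define \<pi> where "\<pi> = (\<lambda>m. j (q m))"
  have \<pi>: "\<pi> \<in> mod_hom R M M" unfolding \<pi>_def by (rule mod_hom_comp[OF assms(5,4)])
  have q\<pi>: "q (\<pi> m) = q m" if "m \<in> carrier M" for m
    using qj mod_homD(1)[OF assms(5) that] by (simp add: \<pi>_def)
  let ?G = "\<lambda>z. \<pi> (f (lower R k z)) \<oplus>\<^bsub>M\<^esub> mdiff R M (f (upper k z)) (\<pi> (f (upper k z)))"
  have G: "?G \<in> mod_hom R ?FF M"
    by (intro mod_hom_sum mod_hom_diff mod_hom_comp[OF mod_hom_comp[OF relfree_lower fh] \<pi>]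
        mod_hom_comp[OF mod_hom_comp[OF relfree_upper fh] \<pi>] mod_hom_comp[OF relfree_upper fh] f(1))
  have Gepi: "?G \<in> mod_epi R ?FF M"
  proof (rule mod_epiI[OF G])
    fix m assume m: "m \<in> carrier M"
    then obtain x where x: "x \<in> carrier ?F" "f x = m" using f(2) by (elim mod_epiE)
    have "?G (join k x x) = m"
      using x m lower_join[OF left_ideal_idem, of x] mod_homD(1)[OF \<pi>] by (simp add: relfree_def)
    moreover have "join k x x \<in> carrier ?FF"
      using x join_mem[OF left_ideal_idem, of x k x k] by (simp add: relfree_def)
    ultimately show "\<exists>z\<in>carrier ?FF. ?G z = m" by (rule bexI[where x = "join k x x"])
  qed
  have qf: "(\<lambda>x. q (f x)) \<in> mod_epi R ?F X"
  proof (rule mod_epi_comp[OF f(2) mod_epiI[OF assms(5)]])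
    show "\<exists>m\<in>carrier M. q m = x" if "x \<in> carrier X" for x
      using qj that mod_homD(1)[OF assms(4)] by blast
  qed
  let ?W = "kerm ?FF M ?G" and ?K = "kerm ?F X (\<lambda>x. q (f x))"
  have f0: "f (\<lambda>_. \<zero>) = \<zero>\<^bsub>M\<^esub>" using mod_hom_zero[OF left_module_relfree f(1) fh] by simp
  have \<pi>0: "\<pi> \<zero>\<^bsub>M\<^esub> = \<zero>\<^bsub>M\<^esub>" using mod_hom_zero[OF f(1) f(1) \<pi>] by simp
  have lo: "lower R k z \<in> carrier ?F" and up: "upper k z \<in> carrier ?F" if "z \<in> carrier ?FF" for z
    using that mod_homD(1)[OF relfree_lower] mod_homD(1)[OF relfree_upper] by blast+
  have "pd_le R e n ?K"
  proof (rule retract)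
    show K: "left_module R ?K"
      by (rule left_module_kerm[OF left_module_relfree assms(2) mod_epiD(1)[OF qf]])
    show "pd_le R e n ?W"
      by (rule pd_le_kernel_relfree_step[OF retract assms(3) Gepi])
    have eq: "x \<in> carrier ?W" "lower R k x = x" if "x \<in> carrier ?K" for x
    proof -
      have x: "x \<in> carrier ?F" "q (f x) = \<zero>\<^bsub>X\<^esub>" using that by auto
      then have 1: "lower R k x = x" "upper k x = (\<lambda>_. \<zero>)"
        by (auto simp: relfree_mem fun_eq_iff)
      have "x \<in> carrier ?FF" using x(1) by (auto simp: relfree_mem)
      moreover have "\<pi> (f x) = \<zero>\<^bsub>M\<^esub>"
        using x(2) mod_hom_zero[OF assms(2) f(1) assms(4)] by (simp add: \<pi>_def)
      ultimately show "x \<in> carrier ?W" by (simp add: 1 f0 \<pi>0)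
      show "lower R k x = x" by (rule 1)
    qed
    show "(\<lambda>x. x) \<in> mod_hom R ?K ?W"
      by (rule mod_homI) (use eq in auto)
    have "lower R k z \<in> carrier ?K" if z: "z \<in> carrier ?W" for z
    proof -
      have zF: "z \<in> carrier ?FF" "?G z = \<zero>\<^bsub>M\<^esub>" using z by auto
      have c: "f (lower R k z) \<in> carrier M" "f (upper k z) \<in> carrier M"
        using mod_homD(1)[OF fh lo[OF zF(1)]] mod_homD(1)[OF fh up[OF zF(1)]] by auto
      have c': "\<pi> (f (lower R k z)) \<in> carrier M" "\<pi> (f (upper k z)) \<in> carrier M"
        using mod_homD(1)[OF \<pi>] c by auto
      have "q (?G z) = q (f (lower R k z))"
        using c c' q\<pi> mod_homD(1)[OF assms(5)]
        by (simp add: mod_homD(2)[OF assms(5)] mod_hom_mdiff[OF f(1) assms(5)])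
      then show ?thesis
        using zF lo mod_hom_zero[OF f(1) assms(2,5)] by simp
    qed
    then show "(\<lambda>z. lower R k z) \<in> mod_hom R ?W ?K"
      by (intro mod_homI) (use mod_homD(2,3)[OF relfree_lower] in auto)
    show "\<forall>x\<in>carrier ?K. lower R k x = x"
      using eq(2) by blast
  qed
  then show ?thesis by (rule pd_le_SucI[OF assms(2) qf])
qed

lemma pd_le_retract_tuples:
  fixes M :: "('a, nat \<Rightarrow> 'a) module" and X :: "('a, nat \<Rightarrow> 'a) module"
  assumes "left_module R X" "pd_le R e n M" "j \<in> mod_hom R X M" "q \<in> mod_hom R M X"
    "\<forall>x\<in>carrier X. q (j x) = x"
  shows "pd_le R e n X"
  using assms
proof (induction n arbitrary: M X j q)
  case 0
  then show ?case using relproj_retract[of R X e M j q] by auto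
next
  case (Suc n)
  show ?case
    by (rule pd_le_retract_step[OF _ Suc.prems(1-4)], erule (4) Suc.IH) (use Suc.prems(5) in auto)
qed

lemma pd_le_retract:
  assumes "left_module R X" "pd_le R e n M" "j \<in> mod_hom R X M" "q \<in> mod_hom R M X"
    "\<And>x. x \<in> carrier X \<Longrightarrow> q (j x) = x"
  shows "pd_le R e n X"
proof (cases n)
  case 0
  then show ?thesis using assms relproj_retract[of R X e M j q] by auto
next
  case (Suc m)
  show ?thesis
    unfolding Suc
    by (rule pd_le_retract_step[OF _ assms(1) assms(2)[unfolded Suc] assms(3,4)],
        erule (4) pd_le_retract_tuples) (rule assms(5))
qed

lemma pd_le_kernel_relfree:
  assumes "pd_le R e (Suc n) X" "g \<in> mod_epi R (relfree R e k) X"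
  shows "pd_le R e n (kerm (relfree R e k) X g)"
  by (rule pd_le_kernel_relfree_step[OF _ assms], erule (4) pd_le_retract_tuples)

text \<open>Here \<open>M\<close> need not be projective. If it is a summand of a power
  \<open>F\<close>, the kernel of \<open>p\<close> is a retract of the kernel of
  \<open>F -> X\<close>. Otherwise, for a cover \<open>F -> M\<close>, the kernel of
  \<open>F -> X\<close> has length at most \<open>n\<close> and maps onto the kernel of
  \<open>p\<close>; the kernel of that map has length one less, so \<open>pd_le_cokernel\<close>
  applies.\<close>

lemma pd_le_kernel:
  assumes "pd_le R e n M" "pd_le R e (Suc n) X" "p \<in> mod_epi R M X"
  shows "pd_le R e n (kerm M X p)"
proof -
  note M = pd_le_left_module[OF assms(1)] and X = pd_le_left_module[OF assms(2)]
  interpret M: left_module R M by (rule M)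
  interpret X: left_module R X by (rule X)
  note p = mod_epiD(1)[OF assms(3)]
  have K: "left_module R (kerm M X p)" by (rule left_module_kerm[OF M X p])
  show ?thesis
  proof (cases n)
    case 0
    then have "relproj R e M" using assms(1) by simp
    then obtain k j q where jq: "j \<in> mod_hom R M (relfree R e k)"
      "q \<in> mod_hom R (relfree R e k) M" "\<And>x. x \<in> carrier M \<Longrightarrow> q (j x) = x"
      by (elim relprojE) blast
    have "q \<in> mod_epi R (relfree R e k) M"
      by (rule mod_epiI[OF jq(2)]) (use jq(3) mod_homD(1)[OF jq(1)] in blast)
    from mod_epi_comp[OF this assms(3)]
    have "pd_le R e n (kerm (relfree R e k) X (\<lambda>x. p (q x)))"
      by (rule pd_le_kernel_relfree[OF assms(2)])
    then show ?thesis
    proof (rule pd_le_retract[OF K])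
      show "j \<in> mod_hom R (kerm M X p) (kerm (relfree R e k) X (\<lambda>x. p (q x)))"
        by (rule mod_homI) (use mod_homD[OF jq(1)] jq(3) in auto)
      show "q \<in> mod_hom R (kerm (relfree R e k) X (\<lambda>x. p (q x))) (kerm M X p)"
        by (rule mod_homI) (use mod_homD[OF jq(2)] in auto)
    qed (use jq(3) in auto)
  next
    case (Suc m)
    then obtain k f where f: "f \<in> mod_epi R (relfree R e k) M"
        "pd_le R e m (kerm (relfree R e k) M f)"
      using assms(1) unfolding Suc by (elim pd_le_SucE) blast
    note fh = mod_epiD(1)[OF f(1)]
    let ?F = "relfree R e k" and ?g = "\<lambda>x. p (f x)"
    have g: "?g \<in> mod_epi R ?F X" by (rule mod_epi_comp[OF f(1) assms(3)])
    have L: "pd_le R e n (kerm ?F X ?g)"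
      by (rule pd_le_kernel_relfree[OF assms(2) g])
    have hom: "f \<in> mod_hom R (kerm ?F X ?g) (kerm M X p)"
      by (rule mod_homI) (use mod_homD[OF fh] in auto)
    have epi: "f \<in> mod_epi R (kerm ?F X ?g) (kerm M X p)"
    proof (rule mod_epiI[OF hom])
      fix y assume "y \<in> carrier (kerm M X p)"
      then have y: "y \<in> carrier M" "p y = \<zero>\<^bsub>X\<^esub>" by auto
      obtain x where "x \<in> carrier ?F" "f x = y" using f(1) y(1) by (elim mod_epiE)
      then show "\<exists>x\<in>carrier (kerm ?F X ?g). f x = y" using y by auto
    qed
    have "kerm (kerm ?F X ?g) (kerm M X p) f = kerm ?F M f"
      using mod_hom_zero[OF M X p]
      by (auto simp: kerm_kerm kerm_def intro!: arg_cong[of _ _ "\<lambda>C. ?F\<lparr>carrier := C\<rparr>"])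
    then have "pd_le R e m (kerm (kerm ?F X ?g) (kerm M X p) f)" using f(2) by simp
    then show ?thesis
      unfolding Suc
      by (rule pd_le_cokernel[OF pd_le_left_module[OF L] K epi _ L[unfolded Suc]])
  qed
qed

end

subsection \<open>Change of rings\<close>

lemma kerm_tuples_upper:
  assumes "left_ideal S R"
  shows "kerm (tuples R S (k + l)) (tuples R S l) (upper k) = tuples R S k"
proof -
  have *: "x \<in> carrier (tuples R S (k + l)) \<and> upper k x = (\<lambda>_. \<zero>\<^bsub>R\<^esub>) \<longleftrightarrow> x \<in> carrier (tuples R S k)" for x
  proof
    assume x: "x \<in> carrier (tuples R S (k + l)) \<and> upper k x = (\<lambda>_. \<zero>\<^bsub>R\<^esub>)"
    then have "x i = \<zero>\<^bsub>R\<^esub>" if "i \<ge> k" for i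
      using that by (metis le_add_diff_inverse2)
    then show "x \<in> carrier (tuples R S k)" using x by (auto simp: tuples_mem[OF assms])
  next
    assume "x \<in> carrier (tuples R S k)"
    then show "x \<in> carrier (tuples R S (k + l)) \<and> upper k x = (\<lambda>_. \<zero>\<^bsub>R\<^esub>)"
      by (auto simp: tuples_mem[OF assms])
  qed
  then have "{x \<in> carrier (tuples R S (k + l)). upper k x = (\<lambda>_. \<zero>\<^bsub>R\<^esub>)} = carrier (tuples R S k)"
    by blast
  then show ?thesis by (simp add: kerm_def) (simp add: tuples_def)
qed

text \<open>
  Let \<open>\<psi> : S \<rightarrow> R\<close> preserve sums and products but not necessarily the unit. The idempotent
  \<open>\<psi>(1)\<close> cuts an \<open>S\<close>-module out of every \<open>R\<close>-module. This covers both restriction of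
  scalars and the functor sending an \<open>R\<close>-module \<open>M\<close> to the \<open>eRe\<close>-module \<open>eM\<close>.
\<close>

definition corner_module ::
  "('s, 'y) ring_scheme \<Rightarrow> ('s \<Rightarrow> 'r) \<Rightarrow> ('r, 'm) module \<Rightarrow> ('s, 'm) module" where
  "corner_module S \<psi> M = \<lparr>carrier = {x \<in> carrier M. \<psi> \<one>\<^bsub>S\<^esub> \<odot>\<^bsub>M\<^esub> x = x}, mult = mult M, one = \<one>\<^bsub>M\<^esub>,
     zero = \<zero>\<^bsub>M\<^esub>, add = add M, smult = (\<lambda>s x. \<psi> s \<odot>\<^bsub>M\<^esub> x)\<rparr>"

lemma corner_module_simps [simp]:
  "x \<in> carrier (corner_module S \<psi> M) \<longleftrightarrow> x \<in> carrier M \<and> \<psi> \<one>\<^bsub>S\<^esub> \<odot>\<^bsub>M\<^esub> x = x"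
  "zero (corner_module S \<psi> M) = zero M" "add (corner_module S \<psi> M) = add M"
  "smult (corner_module S \<psi> M) = (\<lambda>s x. \<psi> s \<odot>\<^bsub>M\<^esub> x)"
  by (simp_all add: corner_module_def)

locale corner_map = S: ring S + R: ring R
  for S :: "('s, 'y) ring_scheme" and R :: "('r, 'x) ring_scheme" +
  fixes \<psi> :: "'s \<Rightarrow> 'r"
  assumes \<psi>_closed [simp, intro]: "s \<in> carrier S \<Longrightarrow> \<psi> s \<in> carrier R"
    and \<psi>_add: "\<lbrakk>s \<in> carrier S; t \<in> carrier S\<rbrakk> \<Longrightarrow> \<psi> (s \<oplus>\<^bsub>S\<^esub> t) = \<psi> s \<oplus>\<^bsub>R\<^esub> \<psi> t"
    and \<psi>_mult: "\<lbrakk>s \<in> carrier S; t \<in> carrier S\<rbrakk> \<Longrightarrow> \<psi> (s \<otimes>\<^bsub>S\<^esub> t) = \<psi> s \<otimes>\<^bsub>R\<^esub> \<psi> t"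
begin

lemma \<psi>_zero: "\<psi> \<zero>\<^bsub>S\<^esub> = \<zero>\<^bsub>R\<^esub>"
proof -
  have "\<psi> \<zero>\<^bsub>S\<^esub> \<oplus>\<^bsub>R\<^esub> \<psi> \<zero>\<^bsub>S\<^esub> = \<psi> \<zero>\<^bsub>S\<^esub>" using \<psi>_add[of "\<zero>\<^bsub>S\<^esub>" "\<zero>\<^bsub>S\<^esub>"] by simp
  then show ?thesis by (simp add: R.add.l_cancel_one)
qed

lemma left_module_corner:
  assumes "left_module R M"
  shows "left_module S (corner_module S \<psi> M)"
proof -
  interpret M: left_module R M by fact
  have u: "\<psi> s \<odot>\<^bsub>M\<^esub> (\<psi> t \<odot>\<^bsub>M\<^esub> x) = \<psi> (s \<otimes>\<^bsub>S\<^esub> t) \<odot>\<^bsub>M\<^esub> x"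
    if "s \<in> carrier S" "t \<in> carrier S" "x \<in> carrier M" for s t x
    using that by (simp add: \<psi>_mult M.smult_assoc)
  show ?thesis
  proof (rule left_moduleI[OF S.ring_axioms], goal_cases)
    case (6 x)
    have "\<psi> (\<ominus>\<^bsub>S\<^esub> \<one>\<^bsub>S\<^esub>) \<odot>\<^bsub>M\<^esub> x \<oplus>\<^bsub>M\<^esub> \<psi> \<one>\<^bsub>S\<^esub> \<odot>\<^bsub>M\<^esub> x = \<psi> (\<ominus>\<^bsub>S\<^esub> \<one>\<^bsub>S\<^esub> \<oplus>\<^bsub>S\<^esub> \<one>\<^bsub>S\<^esub>) \<odot>\<^bsub>M\<^esub> x"
      using 6 by (simp add: \<psi>_add M.smult_l_distr)
    then show ?case using 6 by (simp add: S.l_neg \<psi>_zero)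
  qed (auto simp: M.a_assoc M.smult_l_distr M.smult_r_distr \<psi>_add u intro!: M.a_comm)
qed

lemma mod_hom_corner:
  assumes "f \<in> mod_hom R M N"
  shows "f \<in> mod_hom S (corner_module S \<psi> M) (corner_module S \<psi> N)"
proof (rule mod_homI)
  fix x assume "x \<in> carrier (corner_module S \<psi> M)"
  then show "f x \<in> carrier (corner_module S \<psi> N)"
    using mod_homD(1)[OF assms, of x] mod_homD(3)[OF assms, of "\<psi> \<one>\<^bsub>S\<^esub>" x] by simp
qed (simp_all add: mod_homD(2,3)[OF assms])

text \<open>This makes the functor exact: a preimage of a vector fixed by \<open>\<psi> 1\<close>
  becomes fixed after multiplication by \<open>\<psi> 1\<close> and stays a preimage.\<close>

lemma mod_epi_corner:
  assumes "f \<in> mod_epi R M N" "left_module R M"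
  shows "f \<in> mod_epi S (corner_module S \<psi> M) (corner_module S \<psi> N)"
proof (rule mod_epiI[OF mod_hom_corner[OF mod_epiD(1)[OF assms(1)]]])
  interpret M: left_module R M by fact
  fix y assume y: "y \<in> carrier (corner_module S \<psi> N)"
  then obtain x where x: "x \<in> carrier M" "f x = y"
    using assms(1) by (auto elim: mod_epiE)
  have "\<psi> \<one>\<^bsub>S\<^esub> \<odot>\<^bsub>M\<^esub> (\<psi> \<one>\<^bsub>S\<^esub> \<odot>\<^bsub>M\<^esub> x) = \<psi> \<one>\<^bsub>S\<^esub> \<odot>\<^bsub>M\<^esub> x"
    using x M.smult_assoc[of "\<psi> \<one>\<^bsub>S\<^esub>" "\<psi> \<one>\<^bsub>S\<^esub>" x] \<psi>_mult[of "\<one>\<^bsub>S\<^esub>" "\<one>\<^bsub>S\<^esub>"] by simp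
  moreover have "f (\<psi> \<one>\<^bsub>S\<^esub> \<odot>\<^bsub>M\<^esub> x) = y"
    using x y mod_homD(3)[OF mod_epiD(1)[OF assms(1)]] by simp
  ultimately show "\<exists>x\<in>carrier (corner_module S \<psi> M). f x = y"
    using x by (intro bexI[of _ "\<psi> \<one>\<^bsub>S\<^esub> \<odot>\<^bsub>M\<^esub> x"]) auto
qed

lemma kerm_corner: "kerm (corner_module S \<psi> M) (corner_module S \<psi> N) f = corner_module S \<psi> (kerm M N f)"
proof -
  have "{x. (x \<in> carrier M \<and> \<psi> \<one>\<^bsub>S\<^esub> \<odot>\<^bsub>M\<^esub> x = x) \<and> f x = \<zero>\<^bsub>N\<^esub>} =
      {x. (x \<in> carrier M \<and> f x = \<zero>\<^bsub>N\<^esub>) \<and> \<psi> \<one>\<^bsub>S\<^esub> \<odot>\<^bsub>M\<^esub> x = x}" by blast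
  then show ?thesis by (simp add: kerm_def corner_module_def)
qed

lemma pd_le_corner_tuples:
  assumes "idempotent S d'" "left_ideal T R" "pd_le S d' c (corner_module S \<psi> (tuples R T 1))"
  shows "pd_le S d' c (corner_module S \<psi> (tuples R T k))"
proof -
  interpret I: idempotent S d' by fact
  have T: "left_module R (tuples R T k)" for k
    by (rule left_module_tuples[OF R.ring_axioms assms(2)])
  show ?thesis
  proof (induction k)
    case 0
    let ?Z = "corner_module S \<psi> (tuples R T 0)"
    have "left_module S ?Z" by (rule left_module_corner[OF T])
    moreover have "(\<lambda>x. (\<lambda>_. \<zero>\<^bsub>S\<^esub>)) \<in> mod_hom S ?Z (relfree S d' 0)"
      by (rule mod_homI) (auto simp: I.relfree_mem)
    moreover have "(\<lambda>x. (\<lambda>_. \<zero>\<^bsub>R\<^esub>)) \<in> mod_hom S (relfree S d' 0) ?Z"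
      by (rule mod_homI) (auto simp: tuples_mem[OF assms(2)] left_idealD[OF assms(2)])
    ultimately have "relproj S d' ?Z"
      by (rule relprojI) (auto simp: tuples_mem[OF assms(2)])
    then show ?case using I.pd_le_mono[of 0] by simp
  next
    case (Suc k)
    have "upper k \<in> mod_epi R (tuples R T (k + 1)) (tuples R T 1)"
    proof (rule mod_epiI[OF tuples_snd[OF assms(2) R.ring_axioms]])
      fix y assume y: "y \<in> carrier (tuples R T 1)"
      show "\<exists>x\<in>carrier (tuples R T (k + 1)). upper k x = y"
        using mod_homD(1)[OF tuples_inr[OF assms(2) R.ring_axioms] y]
        by (intro bexI[of _ "shift R k y"]) auto
    qed
    from mod_epi_corner[OF this T]
    have "pd_le S d' c (corner_module S \<psi> (tuples R T (k + 1)))"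
      by (rule I.pd_le_ext[OF left_module_corner[OF T] left_module_corner[OF T]])
        (use Suc assms(3) in \<open>simp_all add: kerm_corner kerm_tuples_upper[OF assms(2), of k 1, simplified]\<close>)
    then show ?case by simp
  qed
qed

text \<open>An exact functor turns a resolution of length \<open>n\<close> by powers of
  \<open>Rd\<close> into one whose terms have dimension at most \<open>c\<close>, and each cokernel
  adds one. The constant is 0 for multiplication by \<open>e\<close> on powers of \<open>Re\<close>,
  the dimension of \<open>eR\<close> for multiplication by \<open>e\<close> on free modules, and
  \<open>m + 1\<close> for restriction from \<open>R/I\<close> to \<open>R\<close>.\<close>

lemma pd_le_corner:
  assumes "idempotent S d'" "idempotent R d" "pd_le S d' c (corner_module S \<psi> (relfree R d 1))"
    and "pd_le R d n X"
  shows "pd_le S d' (n + c) (corner_module S \<psi> X)"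
proof -
  interpret I: idempotent S d' by fact
  interpret J: idempotent R d by fact
  have F: "pd_le S d' c (corner_module S \<psi> (relfree R d k))" for k
    unfolding relfree_def
    by (rule pd_le_corner_tuples[OF assms(1) J.left_ideal_idem]) (use assms(3) in \<open>simp add: relfree_def\<close>)
  have 0: "pd_le S d' c (corner_module S \<psi> X)" if P: "relproj R d X" for X :: "('r, 'm) module"
  proof -
    obtain k j q where jq: "left_module R X" "j \<in> mod_hom R X (relfree R d k)"
      "q \<in> mod_hom R (relfree R d k) X" "\<And>x. x \<in> carrier X \<Longrightarrow> q (j x) = x"
      using P by (elim relprojE) blast
    show ?thesis
      by (rule I.pd_le_retract[OF left_module_corner[OF jq(1)] F mod_hom_corner[OF jq(2)]
            mod_hom_corner[OF jq(3)]]) (use jq(4) in auto)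
  qed
  have step: "pd_le S d' (Suc n + c) (corner_module S \<psi> X)"
    if X: "left_module R X" "f \<in> mod_epi R (relfree R d k) X"
      "pd_le S d' (n + c) (corner_module S \<psi> (kerm (relfree R d k) X f))"
    for X :: "('r, 'm) module" and n k f
  proof -
    have "pd_le S d' (Suc (n + c)) (corner_module S \<psi> X)"
      by (rule I.pd_le_cokernel[OF left_module_corner[OF J.left_module_relfree] left_module_corner[OF X(1)]
            mod_epi_corner[OF X(2) J.left_module_relfree]])
        (use X(3) in \<open>simp add: kerm_corner\<close>, rule I.pd_le_mono[OF F], simp)
    then show ?thesis by simp
  qed
  have tup: "pd_le S d' (n + c) (corner_module S \<psi> X)" if "pd_le R d n X"
    for X :: "('r, nat \<Rightarrow> 'r) module" and n
    using that
  proof (induction n arbitrary: X)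
    case (Suc n)
    then obtain k f where f: "left_module R X" "f \<in> mod_epi R (relfree R d k) X"
        "pd_le R d n (kerm (relfree R d k) X f)"
      by (elim pd_le_SucE) blast
    show ?case by (rule step[OF f(1,2) Suc.IH[OF f(3)]])
  next
    case base: 0
    then show ?case using 0[of X] by simp
  qed
  show ?thesis
  proof (cases n)
    case (Suc m)
    then obtain k f where f: "left_module R X" "f \<in> mod_epi R (relfree R d k) X"
        "pd_le R d m (kerm (relfree R d k) X f)"
      using assms(4) unfolding Suc by (elim pd_le_SucE) blast
    show ?thesis unfolding Suc by (rule step[OF f(1,2) tup[OF f(3)]])
  next
    case zero: 0
    then show ?thesis using 0[of X] assms(4) by simp
  qed
qed

end

lemma mod_hom_factor:
  assumes "left_module R F" "left_module R N" "f \<in> mod_epi R F W" "g \<in> mod_hom R F N" "left_module R W"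
    and "\<And>x. \<lbrakk>x \<in> carrier F; f x = \<zero>\<^bsub>W\<^esub>\<rbrakk> \<Longrightarrow> g x = \<zero>\<^bsub>N\<^esub>"
  obtains t where "t \<in> mod_hom R W N" "\<And>x. x \<in> carrier F \<Longrightarrow> t (f x) = g x"
proof -
  interpret F: left_module R F by fact
  interpret N: left_module R N by fact
  interpret W: left_module R W by fact
  note fh = mod_epiD(1)[OF assms(3)]
  define t where "t = (\<lambda>w. g (SOME x. x \<in> carrier F \<and> f x = w))"
  have eq: "g x = g y" if "x \<in> carrier F" "y \<in> carrier F" "f x = f y" for x y
  proof -
    have "f (mdiff R F x y) = \<zero>\<^bsub>W\<^esub>"
      using that mod_homD(1)[OF fh] by (simp add: mod_hom_mdiff[OF assms(1) fh])
    then have "mdiff R N (g x) (g y) = \<zero>\<^bsub>N\<^esub>"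
      using assms(6)[of "mdiff R F x y"] that by (simp add: mod_hom_mdiff[OF assms(1,4)])
    then show ?thesis using that mod_homD(1)[OF assms(4)] by (simp add: N.mdiff_eq_zero_iff)
  qed
  have t: "t (f x) = g x" if x: "x \<in> carrier F" for x
  proof -
    let ?y = "SOME y. y \<in> carrier F \<and> f y = f x"
    have "?y \<in> carrier F \<and> f ?y = f x" by (rule someI[of _ x]) (use x in simp)
    then show ?thesis unfolding t_def using eq x by blast
  qed
  have "t \<in> mod_hom R W N"
  proof (rule mod_homI)
    fix x y assume "x \<in> carrier W" "y \<in> carrier W"
    then obtain u v where uv: "u \<in> carrier F" "v \<in> carrier F" "x = f u" "y = f v"
      using mod_epiE[OF assms(3)] by metis
    have "t (f (u \<oplus>\<^bsub>F\<^esub> v)) = t (f u) \<oplus>\<^bsub>N\<^esub> t (f v)"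
      using uv by (simp add: t mod_homD(2)[OF assms(4)])
    then show "t (x \<oplus>\<^bsub>W\<^esub> y) = t x \<oplus>\<^bsub>N\<^esub> t y" using uv by (simp add: mod_homD(2)[OF fh])
  next
    fix x assume "x \<in> carrier W"
    then obtain u where u: "u \<in> carrier F" "x = f u" using mod_epiE[OF assms(3)] by metis
    then show "t x \<in> carrier N" using mod_homD(1)[OF assms(4)] by (simp add: t)
    fix a assume a: "a \<in> carrier R"
    have "t (f (a \<odot>\<^bsub>F\<^esub> u)) = a \<odot>\<^bsub>N\<^esub> t (f u)"
      using u a by (simp add: t mod_homD(3)[OF assms(4)])
    then show "t (a \<odot>\<^bsub>W\<^esub> x) = a \<odot>\<^bsub>N\<^esub> t x" using u a by (simp add: mod_homD(3)[OF fh])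
  qed
  then show thesis using that t by blast
qed

subsection \<open>Direct products\<close>

definition prod_module :: "('r, 'm) module \<Rightarrow> ('r, 'n) module \<Rightarrow> ('r, 'm \<times> 'n) module" where
  "prod_module M N = \<lparr>carrier = carrier M \<times> carrier N, mult = undefined, one = undefined,
     zero = (\<zero>\<^bsub>M\<^esub>, \<zero>\<^bsub>N\<^esub>), add = (\<lambda>x y. (fst x \<oplus>\<^bsub>M\<^esub> fst y, snd x \<oplus>\<^bsub>N\<^esub> snd y)),
     smult = (\<lambda>a x. (a \<odot>\<^bsub>M\<^esub> fst x, a \<odot>\<^bsub>N\<^esub> snd x))\<rparr>"

lemma prod_module_simps [simp]:
  "x \<in> carrier (prod_module M N) \<longleftrightarrow> fst x \<in> carrier M \<and> snd x \<in> carrier N"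
  "zero (prod_module M N) = (\<zero>\<^bsub>M\<^esub>, \<zero>\<^bsub>N\<^esub>)"
  "x \<oplus>\<^bsub>prod_module M N\<^esub> y = (fst x \<oplus>\<^bsub>M\<^esub> fst y, snd x \<oplus>\<^bsub>N\<^esub> snd y)"
  "a \<odot>\<^bsub>prod_module M N\<^esub> x = (a \<odot>\<^bsub>M\<^esub> fst x, a \<odot>\<^bsub>N\<^esub> snd x)"
  by (auto simp: prod_module_def mem_Times_iff)

lemma left_module_prod:
  assumes "left_module R M" "left_module R N"
  shows "left_module R (prod_module M N)"
proof -
  interpret M: left_module R M by fact
  interpret N: left_module R N by fact
  show ?thesis
    by (rule left_moduleI)
      (auto simp: M.a_assoc N.a_assoc M.smult_l_distr N.smult_l_distr M.smult_r_distr N.smult_r_distr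
        M.smult_assoc N.smult_assoc M.smult_minus_one_l N.smult_minus_one_l M.R.ring_axioms
        intro!: M.a_comm N.a_comm)
qed

lemma mod_hom_fst: "fst \<in> mod_hom R (prod_module M N) M"
  and mod_hom_snd: "snd \<in> mod_hom R (prod_module M N) N"
  by (auto intro!: mod_homI)

lemma mod_hom_Pair:
  assumes "f \<in> mod_hom R L M" "g \<in> mod_hom R L N"
  shows "(\<lambda>x. (f x, g x)) \<in> mod_hom R L (prod_module M N)"
  by (rule mod_homI) (auto simp: mod_homD[OF assms(1)] mod_homD[OF assms(2)])

lemma (in idempotent) pd_le_prod:
  assumes "pd_le R e n M" "pd_le R e n N"
  shows "pd_le R e n (prod_module M N)"
proof -
  note M = pd_le_left_module[OF assms(1)] and N = pd_le_left_module[OF assms(2)]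
  interpret M: left_module R M by (rule M)
  interpret N: left_module R N by (rule N)
  note P = left_module_prod[OF M N]
  have epi: "snd \<in> mod_epi R (prod_module M N) N"
    by (rule mod_epiI[OF mod_hom_snd]) (auto intro!: bexI[of _ "(\<zero>\<^bsub>M\<^esub>, _)"])
  have "pd_le R e n (kerm (prod_module M N) N snd)"
  proof (rule pd_le_iso[OF left_module_kerm[OF P N mod_hom_snd] _ _ assms(1)])
    show "(\<lambda>x. (x, \<zero>\<^bsub>N\<^esub>)) \<in> mod_hom R M (kerm (prod_module M N) N snd)"
      by (rule mod_homI) auto
    show "bij_betw (\<lambda>x. (x, \<zero>\<^bsub>N\<^esub>)) (carrier M) (carrier (kerm (prod_module M N) N snd))"
      by (rule bij_betw_byWitness[where f' = fst]) (auto simp: prod_eq_iff)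
  qed
  then show ?thesis by (rule pd_le_ext[OF P N epi _ assms(2)])
qed

subsection \<open>Corner rings and the trace of an idempotent\<close>

definition idem_generated :: "('r, 'x) ring_scheme \<Rightarrow> 'r \<Rightarrow> ('r, 'm) module \<Rightarrow> bool" where
  "idem_generated R e M \<longleftrightarrow> left_module R M \<and> (\<exists>k. \<exists>f. f \<in> mod_epi R (relfree R e k) M)"

text \<open>The submodule \<open>ReM\<close>, as the least submodule containing \<open>eM\<close>.
  To place it inside another submodule only vectors fixed by \<open>e\<close> have to be
  considered.\<close>

definition trace_module :: "('r, 'x) ring_scheme \<Rightarrow> 'r \<Rightarrow> ('r, 'm) module \<Rightarrow> ('r, 'm) module" where
  "trace_module R e M = M\<lparr>carrier :=
     \<Inter>{N. left_submodule N R M \<and> {x \<in> carrier M. e \<odot>\<^bsub>M\<^esub> x = x} \<subseteq> N}\<rparr>"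

lemma trace_module_simps [simp]:
  "zero (trace_module R e M) = zero M" "add (trace_module R e M) = add M"
  "smult (trace_module R e M) = smult M" "mdiff S (trace_module R e M) = mdiff S M"
  by (simp_all add: trace_module_def)

lemma trace_module_eq: "carrier (trace_module R e M) = C \<Longrightarrow> trace_module R e M = M\<lparr>carrier := C\<rparr>"
  by (auto simp: trace_module_def)

lemma trace_module_mem:
  assumes "left_module R M"
  shows trace_submodule: "left_submodule (carrier (trace_module R e M)) R M"
    and trace_fixed: "\<lbrakk>x \<in> carrier M; e \<odot>\<^bsub>M\<^esub> x = x\<rbrakk> \<Longrightarrow> x \<in> carrier (trace_module R e M)"
    and trace_least: "\<lbrakk>left_submodule N R M; \<And>x. \<lbrakk>x \<in> carrier M; e \<odot>\<^bsub>M\<^esub> x = x\<rbrakk> \<Longrightarrow> x \<in> N\<rbrakk> \<Longrightarrow>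
      carrier (trace_module R e M) \<subseteq> N"
proof -
  show "left_submodule (carrier (trace_module R e M)) R M"
    using left_submodule_carrier[OF assms] unfolding trace_module_def
    by (auto simp: left_submodule_def)
qed (auto simp: trace_module_def)

lemma trace_subset:
  assumes "left_module R M" "x \<in> carrier (trace_module R e M)"
  shows "x \<in> carrier M"
  by (rule left_submoduleD(1)[OF trace_submodule[OF assms(1)] assms(2)])

lemma left_module_trace:
  assumes "left_module R M"
  shows "left_module R (trace_module R e M)"
  unfolding trace_module_def
  by (rule left_submodule_left_module[OF assms])
    (use trace_submodule[OF assms, of e] in \<open>simp add: trace_module_def\<close>)

lemma trace_incl:
  assumes "left_module R M"
  shows "(\<lambda>x. x) \<in> mod_hom R (trace_module R e M) M"
  by (rule mod_homI, erule trace_subset[OF assms]) simp_all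

lemma mod_hom_trace:
  assumes "left_module R M" "left_module R N" "f \<in> mod_hom R M N" "e \<in> carrier R"
  shows "f \<in> mod_hom R (trace_module R e M) (trace_module R e N)"
proof -
  have "carrier (trace_module R e M) \<subseteq> {x \<in> carrier M. f x \<in> carrier (trace_module R e N)}"
  proof (rule trace_least[OF assms(1) left_submodule_vimage[OF assms(1-3) trace_submodule[OF assms(2)]]])
    fix x assume "x \<in> carrier M" "e \<odot>\<^bsub>M\<^esub> x = x"
    then show "x \<in> {x \<in> carrier M. f x \<in> carrier (trace_module R e N)}"
      using trace_fixed[OF assms(2), of "f x" e] mod_homD(1)[OF assms(3), of x]
        mod_homD(3)[OF assms(3,4), of x] by simp
  qed
  then show ?thesis
    using mod_homD(2,3)[OF assms(3)] trace_subset[OF assms(1), of _ e]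
    by (intro mod_homI) (blast, simp_all)
qed

definition idem_corner :: "('r, 'x) ring_scheme \<Rightarrow> 'r \<Rightarrow> ('r, 'm) module \<Rightarrow> ('r, 'm) module" where
  "idem_corner R e M = corner_module (corner_ring R e) (\<lambda>x. x) M"

lemma corner_ring_simps [simp]:
  "\<one>\<^bsub>corner_ring R e\<^esub> = e" "zero (corner_ring R e) = zero R" "add (corner_ring R e) = add R"
  "mult (corner_ring R e) = mult R"
  by (simp_all add: corner_ring_def)

lemma idem_corner_simps [simp]:
  "x \<in> carrier (idem_corner R e M) \<longleftrightarrow> x \<in> carrier M \<and> e \<odot>\<^bsub>M\<^esub> x = x"
  "zero (idem_corner R e M) = zero M" "add (idem_corner R e M) = add M"
  "smult (idem_corner R e M) = smult M"
  by (simp_all add: idem_corner_def)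

context idempotent
begin

text \<open>If \<open>f x = y\<close> and \<open>y\<close> is fixed by \<open>e\<close>, then
  \<open>e x\<close> is a fixed preimage. So the image of the trace of \<open>M\<close> contains the
  generators of the trace of \<open>N\<close>.\<close>

lemma mod_epi_trace:
  assumes "left_module R M" "left_module R N" "f \<in> mod_epi R M N"
  shows "f \<in> mod_epi R (trace_module R e M) (trace_module R e N)"
proof (rule mod_epiI)
  interpret M: left_module R M by fact
  note fh = mod_epiD(1)[OF assms(3)]
  show "f \<in> mod_hom R (trace_module R e M) (trace_module R e N)"
    by (rule mod_hom_trace[OF assms(1,2) fh]) simp
  have "carrier (trace_module R e N) \<subseteq> f ` carrier (trace_module R e M)"
  proof (rule trace_least[OF assms(2) left_submodule_image[OF assms(1,2) fh trace_submodule[OF assms(1)]]])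
    fix y assume y: "y \<in> carrier N" "e \<odot>\<^bsub>N\<^esub> y = y"
    obtain x where x: "x \<in> carrier M" "f x = y" by (rule mod_epiE[OF assms(3) y(1)])
    have "e \<odot>\<^bsub>M\<^esub> x \<in> carrier (trace_module R e M)"
      using x M.smult_assoc[of e e x] by (intro trace_fixed[OF assms(1)]) auto
    then show "y \<in> f ` carrier (trace_module R e M)"
      using x y mod_homD(3)[OF fh e_closed x(1)] by (intro image_eqI[of y f "e \<odot>\<^bsub>M\<^esub> x"]) auto
  qed
  then show "\<exists>x\<in>carrier (trace_module R e M). f x = y" if "y \<in> carrier (trace_module R e N)" for y
    using that by blast
qed

lemma idem_generated_relfree: "idem_generated R e (relfree R e k)"
proof -
  have "(\<lambda>x. x) \<in> mod_epi R (relfree R e k) (relfree R e k)"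
    by (rule mod_epiI[OF mod_hom_id]) auto
  then show ?thesis unfolding idem_generated_def by blast
qed

lemma pd_le_idem_generated:
  assumes "pd_le R e n M"
  shows "idem_generated R e M"
proof -
  have "pd_le R e (Suc n) M" by (rule pd_le_mono_Suc) fact
  then show ?thesis
    unfolding idem_generated_def by (elim pd_le_SucE) blast
qed

text \<open>The principle by which claims are tested on \<open>eM\<close> alone: it is applied to
  equalizers, kernels, images and traces.\<close>

lemma idem_generated_eq:
  assumes "idem_generated R e M" "left_submodule N R M"
    and "\<And>x. \<lbrakk>x \<in> carrier M; e \<odot>\<^bsub>M\<^esub> x = x\<rbrakk> \<Longrightarrow> x \<in> N"
  shows "N = carrier M"
proof -
  obtain k f where f: "left_module R M" "f \<in> mod_epi R (relfree R e k) M"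
    using assms(1) by (auto simp: idem_generated_def)
  note fh = mod_epiD(1)[OF f(2)]
  have "{x \<in> carrier (relfree R e k). f x \<in> N} = carrier (relfree R e k)"
  proof (rule relfree_generated[OF left_submodule_vimage[OF left_module_relfree f(1) fh assms(2)]])
    fix i assume i: "i < k"
    have "f (unit_tuple R e i) \<in> N"
      using mod_homD(1)[OF fh unit_tuple_mem[OF i]] mod_homD(3)[OF fh e_closed unit_tuple_mem[OF i]]
        smult_unit_tuple[of k i] by (intro assms(3)) (simp_all del: relfree_simps)
    then show "unit_tuple R e i \<in> {x \<in> carrier (relfree R e k). f x \<in> N}"
      using unit_tuple_mem[OF i] by simp
  qed
  then have "carrier M \<subseteq> N" unfolding mod_epiD(2)[OF f(2), symmetric] by blast
  then show ?thesis using left_submoduleD(2)[OF assms(2)] by blast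
qed

lemma idem_generated_trace: "idem_generated R e M \<Longrightarrow> carrier (trace_module R e M) = carrier M"
  by (rule idem_generated_eq[OF _ trace_submodule])
    (auto simp: idem_generated_def intro: trace_fixed)

lemma corner_ring_mem: "a \<in> carrier (corner_ring R e) \<longleftrightarrow> a \<in> carrier R \<and> e \<otimes> a = a \<and> a \<otimes> e = a"
proof
  assume "a \<in> carrier (corner_ring R e)"
  then obtain b where b: "b \<in> carrier R" "a = e \<otimes> b \<otimes> e" by (auto simp: corner_ring_def)
  then show "a \<in> carrier R \<and> e \<otimes> a = a \<and> a \<otimes> e = a"
    by (simp add: m_assoc) (simp add: m_assoc[symmetric])
next
  assume "a \<in> carrier R \<and> e \<otimes> a = a \<and> a \<otimes> e = a"
  then show "a \<in> carrier (corner_ring R e)"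
    by (auto simp: corner_ring_def intro!: exI[of _ a])
qed

lemma ring_corner: "ring (corner_ring R e)"
proof (rule ringI)
  show "abelian_group (corner_ring R e)"
  proof (rule abelian_groupI)
    show "\<exists>y\<in>carrier (corner_ring R e). y \<oplus>\<^bsub>corner_ring R e\<^esub> x = \<zero>\<^bsub>corner_ring R e\<^esub>"
      if "x \<in> carrier (corner_ring R e)" for x
      using that by (intro bexI[of _ "\<ominus> x"]) (auto simp: corner_ring_mem l_neg l_minus r_minus)
  qed (auto simp: corner_ring_mem a_assoc l_distr r_distr intro!: a_comm)
  show "monoid (corner_ring R e)"
    by (rule monoidI) (auto simp: corner_ring_mem m_assoc, auto simp: m_assoc[symmetric])
qed (auto simp: corner_ring_mem l_distr r_distr)

lemma corner_map_incl: "corner_map (corner_ring R e) R (\<lambda>x. x)"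
  by (intro corner_map.intro ring_corner ring_axioms corner_map_axioms.intro)
    (auto simp: corner_ring_mem)

lemma idempotent_corner: "idempotent (corner_ring R e) e"
  by (intro idempotent.intro ring_corner idempotent_axioms.intro) (auto simp: corner_ring_mem)

interpretation C: idempotent "corner_ring R e" e
  rewrites "zero (corner_ring R e) = zero R"
  by (rule idempotent_corner) simp

interpretation CM: corner_map "corner_ring R e" R "\<lambda>x. x"
  rewrites "zero (corner_ring R e) = zero R"
  by (rule corner_map_incl) simp

lemmas left_module_idem_corner = CM.left_module_corner[folded idem_corner_def]
lemmas mod_hom_idem_corner = CM.mod_hom_corner[folded idem_corner_def]
lemmas mod_epi_idem_corner = CM.mod_epi_corner[folded idem_corner_def]
lemmas kerm_idem_corner = CM.kerm_corner[folded idem_corner_def]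

lemma idem_corner_trace:
  assumes "left_module R M"
  shows "idem_corner R e (trace_module R e M) = idem_corner R e M"
proof -
  have "{x. x \<in> carrier (trace_module R e M) \<and> e \<odot>\<^bsub>M\<^esub> x = x} = {x. x \<in> carrier M \<and> e \<odot>\<^bsub>M\<^esub> x = x}"
    using trace_fixed[OF assms] trace_subset[OF assms] by (intro Collect_cong) metis
  then show ?thesis
    unfolding idem_corner_def corner_module_def by (simp add: trace_module_def)
qed

text \<open>\<open>e(Re)^k = (eRe)^k\<close> holds as an equality of records, so resolutions over
  the corner ring are obtained by rewriting.\<close>

lemma idem_corner_relfree: "idem_corner R e (relfree R e k) = relfree (corner_ring R e) e k"
proof -
  have "{x. x \<in> carrier (relfree R e k) \<and> e \<odot>\<^bsub>relfree R e k\<^esub> x = x} =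
      carrier (relfree (corner_ring R e) e k)"
    unfolding set_eq_iff mem_Collect_eq relfree_mem C.relfree_mem corner_ring_mem relfree_simps
      corner_ring_simps fun_eq_iff
    by blast
  then have "carrier (idem_corner R e (relfree R e k)) = carrier (relfree (corner_ring R e) e k)"
    unfolding idem_corner_def corner_module_def module.simps partial_object.simps corner_ring_simps .
  then show ?thesis
    by (rule module.equality) (simp_all, simp_all add: idem_corner_def corner_module_def relfree_def tuples_def)
qed

lemma pd_le_idem_corner:
  assumes "pd_le R e n M"
  shows "pd_le (corner_ring R e) e n (idem_corner R e M)"
proof -
  have "pd_le (corner_ring R e) e (n + 0) (corner_module (corner_ring R e) (\<lambda>x. x) M)"
    by (rule CM.pd_le_corner[OF idempotent_corner idempotent_axioms _ assms])
      (simp add: idem_corner_relfree[unfolded idem_corner_def] C.relproj_relfree)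
  then show ?thesis by (simp add: idem_corner_def)
qed

text \<open>Both \<open>Hom(Re, M)\<close> over \<open>R\<close> and \<open>Hom(eRe, eM)\<close>
  over \<open>eRe\<close> are \<open>eM\<close>, so maps out of powers of \<open>eRe\<close> come
  from maps out of powers of \<open>Re\<close>.\<close>

lemma relfree_hom_extend:
  assumes "left_module R M"
    and "h \<in> mod_hom (corner_ring R e) (idem_corner R e (relfree R e k)) (idem_corner R e M)"
  obtains H where "H \<in> mod_hom R (relfree R e k) M"
    "\<And>x. x \<in> carrier (idem_corner R e (relfree R e k)) \<Longrightarrow> H x = h x"
proof -
  let ?v = "\<lambda>i. h (unit_tuple R e i)"
  have u: "unit_tuple R e i \<in> carrier (idem_corner R e (relfree R e k))" if "i < k" for i
    using unit_tuple_mem[OF that] smult_unit_tuple[of k i] by (simp del: relfree_simps)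
  have v: "?v i \<in> carrier M" "e \<odot>\<^bsub>M\<^esub> ?v i = ?v i" if "i < k" for i
    using mod_homD(1)[OF assms(2) u[OF that]] by auto
  obtain H where H: "H \<in> mod_hom R (relfree R e k) M" "\<And>i. i < k \<Longrightarrow> H (unit_tuple R e i) = ?v i"
    using relfree_hom_ex[of M k ?v] assms(1) v by blast
  have "H x = h x" if "x \<in> carrier (idem_corner R e (relfree R e k))" for x
  proof (rule C.relfree_hom_ext[of "idem_corner R e M" H k h])
    show "left_module (corner_ring R e) (idem_corner R e M)"
      by (rule left_module_idem_corner[OF assms(1)])
    show "H \<in> mod_hom (corner_ring R e) (relfree (corner_ring R e) e k) (idem_corner R e M)"
      using mod_hom_idem_corner[OF H(1)] by (simp add: idem_corner_relfree)
    show "h \<in> mod_hom (corner_ring R e) (relfree (corner_ring R e) e k) (idem_corner R e M)"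
      using assms(2) by (simp add: idem_corner_relfree)
    show "H (unit_tuple (corner_ring R e) e i) = h (unit_tuple (corner_ring R e) e i)" if "i < k" for i
    proof -
      have "unit_tuple (corner_ring R e) e i = unit_tuple R e i"
        by (auto simp: unit_tuple_def fun_eq_iff)
      then show ?thesis using H(2)[OF that] by simp
    qed
    show "x \<in> carrier (relfree (corner_ring R e) e k)"
      using that by (simp only: idem_corner_relfree)
  qed
  then show thesis using that H(1) by blast
qed

text \<open>A section \<open>s\<close> of \<open>eF -> eW\<close> starts at \<open>eW\<close>, where
  no extension to \<open>W\<close> is available. The complementary projection
  \<open>1 - s f : eF -> eK\<close> starts at \<open>eF\<close> and extends to
  \<open>H : F -> K\<close>. It fixes \<open>eK\<close>, hence \<open>K\<close>, because
  \<open>K\<close> is generated by \<open>eK\<close>. So \<open>1 - H\<close> vanishes on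
  \<open>K\<close> and descends to a section of \<open>f\<close>.\<close>

lemma relproj_idem_corner_reflect:
  assumes "pd_le R e n W" "relproj (corner_ring R e) e (idem_corner R e W)"
  shows "relproj R e W"
proof (cases n)
  case 0
  then show ?thesis using assms by simp
next
  case (Suc m)
  let ?e = "idem_corner R e"
  obtain k f where f: "left_module R W" "f \<in> mod_epi R (relfree R e k) W"
      "pd_le R e m (kerm (relfree R e k) W f)"
    using assms(1) unfolding Suc by (elim pd_le_SucE) blast
  let ?F = "relfree R e k" and ?K = "kerm (relfree R e k) W f"
  interpret F: left_module R ?F by simp
  interpret W: left_module R W by fact
  note fh = mod_epiD(1)[OF f(2)]
  have K: "left_module R ?K" by (rule pd_le_left_module[OF f(3)])
  interpret K: left_module R ?K by fact
  have eF: "left_module (corner_ring R e) (?e ?F)" by (rule left_module_idem_corner) simp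
  have eW: "left_module (corner_ring R e) (?e W)" by (rule left_module_idem_corner) fact
  interpret eF: left_module "corner_ring R e" "?e ?F" by fact
  interpret eW: left_module "corner_ring R e" "?e W" by fact
  have ef: "f \<in> mod_epi (corner_ring R e) (?e ?F) (?e W)"
    by (rule mod_epi_idem_corner[OF f(2)]) simp
  obtain s where s: "s \<in> mod_hom (corner_ring R e) (?e W) (?e ?F)"
      "\<And>x. x \<in> carrier (?e W) \<Longrightarrow> f (s x) = x"
    using C.relproj_lift[OF assms(2) eF eW ef mod_hom_id] by blast
  let ?\<rho> = "\<lambda>x. mdiff (corner_ring R e) (?e ?F) x (s (f x))"
  have \<rho>: "?\<rho> \<in> mod_hom (corner_ring R e) (?e ?F) (?e ?F)"
    by (rule mod_hom_diff[OF eF mod_hom_id mod_hom_comp[OF mod_epiD(1)[OF ef] s(1)]])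
  have \<rho>K: "?\<rho> x \<in> carrier (?e ?K)" if x: "x \<in> carrier (?e ?F)" for x
  proof -
    have fx: "f x \<in> carrier (?e W)" by (rule mod_homD(1)[OF mod_epiD(1)[OF ef] x])
    have "f (?\<rho> x) = \<zero>\<^bsub>?e W\<^esub>"
      using mod_hom_mdiff[OF eF mod_epiD(1)[OF ef] x mod_homD(1)[OF s(1) fx]] s(2)[OF fx]
        eW.mdiff_self[OF fx] by simp
    then show ?thesis
      using mod_homD(1)[OF \<rho> x] by simp
  qed
  have "?\<rho> \<in> mod_hom (corner_ring R e) (?e ?F) (?e ?K)"
    by (rule mod_homI, rule \<rho>K) (use mod_homD(2,3)[OF \<rho>] in auto)
  then obtain H where H: "H \<in> mod_hom R ?F ?K" "\<And>x. x \<in> carrier (?e ?F) \<Longrightarrow> H x = ?\<rho> x"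
    using relfree_hom_extend[OF K] by blast
  have HF: "H \<in> mod_hom R ?F ?F" by (rule mod_hom_comp[OF H(1) kerm_incl])
  have "{x \<in> carrier ?K. H x = x} = carrier ?K"
  proof (rule idem_generated_eq[OF pd_le_idem_generated[OF f(3)]])
    show "left_submodule {x \<in> carrier ?K. H x = x} R ?K"
      by (rule left_submodule_eq[OF K K mod_hom_comp[OF kerm_incl H(1)] mod_hom_id])
    fix x assume x: "x \<in> carrier ?K" "e \<odot>\<^bsub>?K\<^esub> x = x"
    then have xe: "x \<in> carrier (?e ?F)" "f x = \<zero>\<^bsub>W\<^esub>" by auto
    have "s (f x) = \<zero>\<^bsub>?e ?F\<^esub>"
      using mod_hom_zero[OF eW eF s(1)] xe(2) by simp
    then have "H x = x" using H(2)[OF xe(1)] eF.mdiff_zero_r[OF xe(1)] by simp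
    then show "x \<in> {x \<in> carrier ?K. H x = x}" using x by simp
  qed
  then have HK: "H x = x" if "x \<in> carrier ?F" "f x = \<zero>\<^bsub>W\<^esub>" for x
    using that unfolding carrier_kerm by blast
  have g: "(\<lambda>x. mdiff R ?F x (H x)) \<in> mod_hom R ?F ?F"
    by (rule mod_hom_diff[OF F.left_module_axioms mod_hom_id HF])
  obtain t where t: "t \<in> mod_hom R W ?F" "\<And>x. x \<in> carrier ?F \<Longrightarrow> t (f x) = mdiff R ?F x (H x)"
    by (rule mod_hom_factor[OF F.left_module_axioms F.left_module_axioms f(2) g f(1)])
      (use HK F.mdiff_self in auto)
  show ?thesis
  proof (rule relprojI[OF f(1) t(1) fh])
    fix y assume "y \<in> carrier W"
    then obtain x where x: "x \<in> carrier ?F" "f x = y" using f(2) by (auto elim: mod_epiE)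
    have Hx: "H x \<in> carrier ?F" "f (H x) = \<zero>\<^bsub>W\<^esub>" using mod_homD(1)[OF H(1) x(1)] by auto
    have "f (t (f x)) = mdiff R W (f x) (f (H x))"
      using t(2)[OF x(1)] mod_hom_mdiff[OF F.left_module_axioms fh x(1) Hx(1)] by simp
    then show "f (t y) = y" using x Hx mod_homD(1)[OF fh x(1)] by simp
  qed
qed

lemma pd_le_idem_corner_reflect_step:
  assumes IH: "\<And>(X :: ('a, nat \<Rightarrow> 'a) module) m. \<lbrakk>pd_le R e m X;
      pd_le (corner_ring R e) e n (idem_corner R e X)\<rbrakk> \<Longrightarrow> pd_le R e n X"
    and "pd_le R e m W" "pd_le (corner_ring R e) e (Suc n) (idem_corner R e W)"
  shows "pd_le R e (Suc n) W"
proof -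
  have "pd_le R e (Suc m) W" by (rule pd_le_mono_Suc) fact
  then obtain k f where f: "left_module R W" "f \<in> mod_epi R (relfree R e k) W"
      "pd_le R e m (kerm (relfree R e k) W f)"
    by (elim pd_le_SucE) blast
  have "pd_le (corner_ring R e) e n (kerm (idem_corner R e (relfree R e k)) (idem_corner R e W) f)"
  proof (rule C.pd_le_kernel[OF _ assms(3)])
    show "pd_le (corner_ring R e) e n (idem_corner R e (relfree R e k))"
      unfolding idem_corner_relfree by (rule C.pd_le_mono[of 0]) (simp_all add: C.relproj_relfree)
    show "f \<in> mod_epi (corner_ring R e) (idem_corner R e (relfree R e k)) (idem_corner R e W)"
      by (rule mod_epi_idem_corner[OF f(2)]) simp
  qed
  then have "pd_le R e n (kerm (relfree R e k) W f)"
    by (intro IH[OF f(3)]) (simp add: kerm_idem_corner)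
  then show ?thesis by (rule pd_le_SucI[OF f(1,2)])
qed

text \<open>Given some finite resolution by powers of \<open>Re\<close>, the shortest length can be
  read off over the corner ring: take syzygies until the \<open>e\<close>-part is projective, and
  apply \<open>relproj_idem_corner_reflect\<close> to the syzygy reached.\<close>

lemma pd_le_idem_corner_reflect:
  assumes "pd_le R e m W" "pd_le (corner_ring R e) e n (idem_corner R e W)"
  shows "pd_le R e n W"
proof -
  have tup: "pd_le R e n X" if "pd_le R e m X" "pd_le (corner_ring R e) e n (idem_corner R e X)"
    for X :: "('a, nat \<Rightarrow> 'a) module" and m n
    using that
  proof (induction n arbitrary: X m)
    case 0
    then show ?case using relproj_idem_corner_reflect by auto
  next
    case (Suc n)
    show ?case by (rule pd_le_idem_corner_reflect_step[OF Suc.IH Suc.prems])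
  qed
  show ?thesis
  proof (cases n)
    case 0
    then show ?thesis using assms relproj_idem_corner_reflect by auto
  next
    case (Suc l)
    show ?thesis
      unfolding Suc by (rule pd_le_idem_corner_reflect_step[OF tup assms(1) assms(2)[unfolded Suc]])
  qed
qed

text \<open>\<open>D\<close> plays the part of \<open>Re \<otimes> eN\<close>. The idempotent
  \<open>j q\<close> on \<open>(eRe)^k\<close>, whose image is a copy of \<open>eN\<close>, extends
  to an idempotent \<open>\<pi>\<close> on \<open>(Re)^k\<close>; its fixed points form a summand
  \<open>D\<close>, and \<open>f\<close> identifies \<open>eD\<close> with
  \<open>eN\<close>.\<close>

lemma relproj_idem_corner_lift:
  assumes "left_module R N" "relproj (corner_ring R e) e (idem_corner R e N)"
  obtains D :: "('a, nat \<Rightarrow> 'a) module" and f where "relproj R e D" "f \<in> mod_hom R D N"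
    "\<forall>y\<in>carrier N. e \<odot>\<^bsub>N\<^esub> y = y \<longrightarrow> (\<exists>x\<in>carrier D. e \<odot>\<^bsub>D\<^esub> x = x \<and> f x = y)"
    "\<forall>x\<in>carrier D. e \<odot>\<^bsub>D\<^esub> x = x \<and> f x = \<zero>\<^bsub>N\<^esub> \<longrightarrow> x = \<zero>\<^bsub>D\<^esub>"
proof -
  let ?e = "idem_corner R e"
  obtain k j q where jq: "j \<in> mod_hom (corner_ring R e) (?e N) (relfree (corner_ring R e) e k)"
      "q \<in> mod_hom (corner_ring R e) (relfree (corner_ring R e) e k) (?e N)"
      "\<And>x. x \<in> carrier (?e N) \<Longrightarrow> q (j x) = x"
    using assms(2) by (elim relprojE) blast
  let ?F = "relfree R e k"
  interpret F: left_module R ?F by simp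
  have eN: "left_module (corner_ring R e) (?e N)" by (rule left_module_idem_corner) fact
  have eF: "left_module (corner_ring R e) (?e ?F)" by (rule left_module_idem_corner) simp
  note j = jq(1)[folded idem_corner_relfree] and q = jq(2)[folded idem_corner_relfree]
  obtain f where f: "f \<in> mod_hom R ?F N" "\<And>x. x \<in> carrier (?e ?F) \<Longrightarrow> f x = q x"
    using relfree_hom_extend[OF assms(1) q] by blast
  obtain \<pi> where \<pi>: "\<pi> \<in> mod_hom R ?F ?F" "\<And>x. x \<in> carrier (?e ?F) \<Longrightarrow> \<pi> x = j (q x)"
    using relfree_hom_extend[OF left_module_relfree mod_hom_comp[OF q j]] by blast
  have "{x \<in> carrier ?F. \<pi> (\<pi> x) = \<pi> x} = carrier ?F"
  proof (rule idem_generated_eq[OF idem_generated_relfree])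
    show "left_submodule {x \<in> carrier ?F. \<pi> (\<pi> x) = \<pi> x} R ?F"
      by (rule left_submodule_eq[OF F.left_module_axioms F.left_module_axioms
            mod_hom_comp[OF \<pi>(1) \<pi>(1)] \<pi>(1)])
    fix x assume "x \<in> carrier ?F" "e \<odot>\<^bsub>?F\<^esub> x = x"
    then have x: "x \<in> carrier (?e ?F)" by simp
    have qx: "q x \<in> carrier (?e N)" by (rule mod_homD(1)[OF q x])
    have "\<pi> (\<pi> x) = \<pi> x"
      using \<pi>(2)[OF x] \<pi>(2)[OF mod_homD(1)[OF j qx]] jq(3)[OF qx] by simp
    then show "x \<in> {x \<in> carrier ?F. \<pi> (\<pi> x) = \<pi> x}" using x by simp
  qed
  then have \<pi>\<pi>: "\<pi> (\<pi> x) = \<pi> x" if "x \<in> carrier ?F" for x using that by blast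
  let ?D = "?F\<lparr>carrier := {x \<in> carrier ?F. \<pi> x = x}\<rparr>"
  have D: "left_module R ?D"
    by (rule left_submodule_left_module[OF F.left_module_axioms
          left_submodule_eq[OF F.left_module_axioms F.left_module_axioms \<pi>(1) mod_hom_id]])
  have incl: "(\<lambda>x. x) \<in> mod_hom R ?D ?F" by (rule mod_homI) auto
  show thesis
  proof (rule that)
    show "relproj R e ?D"
      by (rule relprojI[OF D incl, of \<pi>]) (use mod_homD[OF \<pi>(1)] \<pi>\<pi> in \<open>auto intro!: mod_homI\<close>)
    show "f \<in> mod_hom R ?D N" by (rule mod_hom_comp[OF incl f(1)])
    have "\<exists>x\<in>carrier ?D. e \<odot>\<^bsub>?D\<^esub> x = x \<and> f x = y" if "y \<in> carrier N" "e \<odot>\<^bsub>N\<^esub> y = y" for y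
    proof -
      have y: "y \<in> carrier (?e N)" using that by simp
      have jy: "j y \<in> carrier (?e ?F)" by (rule mod_homD(1)[OF j y])
      then show ?thesis
        using jq(3)[OF y] \<pi>(2)[OF jy] f(2)[OF jy] by (intro bexI[of _ "j y"]) auto
    qed
    then show "\<forall>y\<in>carrier N. e \<odot>\<^bsub>N\<^esub> y = y \<longrightarrow> (\<exists>x\<in>carrier ?D. e \<odot>\<^bsub>?D\<^esub> x = x \<and> f x = y)"
      by blast
    have "x = \<zero>\<^bsub>?D\<^esub>" if "x \<in> carrier ?D" "e \<odot>\<^bsub>?D\<^esub> x = x" "f x = \<zero>\<^bsub>N\<^esub>" for x
    proof -
      have x: "x \<in> carrier (?e ?F)" "\<pi> x = x" using that by auto
      then have "x = j (f x)" using \<pi>(2)[OF x(1)] f(2)[OF x(1)] by simp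
      then show ?thesis using that(3) mod_hom_zero[OF eN eF j] by simp
    qed
    then show "\<forall>x\<in>carrier ?D. e \<odot>\<^bsub>?D\<^esub> x = x \<and> f x = \<zero>\<^bsub>N\<^esub> \<longrightarrow> x = \<zero>\<^bsub>?D\<^esub>"
      by blast
  qed
qed

end

section \<open>Finite relative dimension\<close>

definition fin_pd :: "('r, 'x) ring_scheme \<Rightarrow> 'r \<Rightarrow> ('r, 'm) module \<Rightarrow> bool" where
  "fin_pd R e M \<longleftrightarrow> (\<exists>n. pd_le R e n M)"

lemma corner_module_id:
  assumes "left_module R M"
  shows "corner_module R (\<lambda>x. x) M = M"
proof -
  interpret M: left_module R M by fact
  show ?thesis by (rule module.equality) (auto simp: corner_module_def)
qed

lemma corner_map_id: "ring R \<Longrightarrow> corner_map R R (\<lambda>x. x)"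
  by (intro corner_map.intro corner_map_axioms.intro) auto

context idempotent
begin

lemma fin_pd_idem_generated: "fin_pd R e M \<Longrightarrow> idem_generated R e M"
  by (auto simp: fin_pd_def intro: pd_le_idem_generated)

lemma fin_pd_relproj: "relproj R e M \<Longrightarrow> fin_pd R e M"
  unfolding fin_pd_def by (rule exI[of _ 0]) simp

lemma fin_pd_kernel:
  assumes "fin_pd R e M" "fin_pd R e X" "p \<in> mod_epi R M X"
  shows "fin_pd R e (kerm M X p)"
proof -
  obtain m n where "pd_le R e m M" "pd_le R e n X" using assms by (auto simp: fin_pd_def)
  then have "pd_le R e (max m n) M" "pd_le R e (Suc (max m n)) X" by (auto elim: pd_le_mono)
  then show ?thesis unfolding fin_pd_def by (metis pd_le_kernel assms(3))
qed

lemma fin_pd_cokernel: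
  assumes "left_module R X" "fin_pd R e M" "fin_pd R e (kerm M X p)" "p \<in> mod_epi R M X"
  shows "fin_pd R e X"
proof -
  obtain m n where "pd_le R e m M" "pd_le R e n (kerm M X p)" using assms by (auto simp: fin_pd_def)
  then have *: "pd_le R e (Suc (max m n)) M" "pd_le R e (max m n) (kerm M X p)"
    by (auto elim: pd_le_mono)
  show ?thesis
    unfolding fin_pd_def
    using pd_le_cokernel[OF pd_le_left_module[OF *(1)] assms(1,4) *(2,1)] by blast
qed

lemma fin_pd_prod:
  assumes "fin_pd R e M" "fin_pd R e N"
  shows "fin_pd R e (prod_module M N)"
proof -
  obtain m n where "pd_le R e m M" "pd_le R e n N" using assms by (auto simp: fin_pd_def)
  then have "pd_le R e (max m n) M" "pd_le R e (max m n) N" by (auto elim: pd_le_mono)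
  then show ?thesis unfolding fin_pd_def using pd_le_prod by blast
qed

lemma fin_pd_iso:
  assumes "left_module R N" "f \<in> mod_hom R M N" "bij_betw f (carrier M) (carrier N)" "fin_pd R e M"
  shows "fin_pd R e N"
proof -
  obtain n where "pd_le R e n M" using assms(4) by (auto simp: fin_pd_def)
  then have "pd_le R e n N" by (rule pd_le_iso[OF assms(1-3)])
  then show ?thesis by (auto simp: fin_pd_def)
qed

text \<open>Change of rings along the identity of \<open>R\<close>, where
  \<open>corner_module\<close> does nothing.\<close>

lemma pd_le_tuples_power:
  assumes "left_ideal T R" "pd_le R e n (tuples R T 1)"
  shows "pd_le R e n (tuples R T k)"
  using corner_map.pd_le_corner_tuples[OF corner_map_id[OF ring_axioms] idempotent_axioms assms(1), of n k]
    assms(2) corner_module_id[OF left_module_tuples[OF ring_axioms assms(1)]] by simp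

lemma relfree_one_mem:
  "x \<in> carrier (relfree R \<one> k) \<longleftrightarrow> (\<forall>i. x i \<in> carrier R) \<and> (\<forall>i\<ge>k. x i = \<zero>)"
  by (auto simp: idempotent.relfree_mem[OF idempotent_one])

lemma left_module_relfree_one: "left_module R (relfree R \<one> k)"
  by (rule idempotent.left_module_relfree[OF idempotent_one])

text \<open>\<open>Re\<close> is a summand of \<open>R\<close> through right multiplication by
  \<open>e\<close>, so change of rings along the identity applies with \<open>c = 0\<close>.\<close>

lemma pd_le_one:
  assumes "pd_le R e n M"
  shows "pd_le R \<one> n M"
proof -
  have "relproj R \<one> (relfree R e 1)"
  proof (rule relprojI[OF left_module_relfree])
    show "(\<lambda>x. x) \<in> mod_hom R (relfree R e 1) (relfree R \<one> 1)"
      by (rule mod_homI) (auto simp: relfree_mem relfree_one_mem)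
    show "(\<lambda>x i. x i \<otimes> e) \<in> mod_hom R (relfree R \<one> 1) (relfree R e 1)"
      by (rule mod_homI) (auto simp: relfree_mem relfree_one_mem l_distr m_assoc)
    show "(\<lambda>i. x i \<otimes> e) = x" if "x \<in> carrier (relfree R e 1)" for x
      using that by (auto simp: relfree_mem)
  qed
  then have "pd_le R \<one> 0 (corner_module R (\<lambda>x. x) (relfree R e 1))"
    by (simp add: corner_module_id)
  from corner_map.pd_le_corner[OF corner_map_id[OF ring_axioms] idempotent_one idempotent_axioms this assms]
  show ?thesis
    by (simp add: corner_module_id[OF pd_le_left_module[OF assms]])
qed

subsection \<open>The idempotent ideal\<close>

abbreviation I where "I \<equiv> genideal R {e}"

lemma ideal_I: "ideal I R"
  by (rule genideal_ideal) simp

lemma e_in_I: "e \<in> I"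
  by (rule genideal_self') simp

lemma I_closed: "a \<in> I \<Longrightarrow> a \<in> carrier R"
  using ideal.Icarr[OF ideal_I] .

lemma left_ideal_I: "left_ideal I R"
  using ideal.I_l_closed[OF ideal_I] additive_subgroup.a_closed[OF ideal.axioms(1)[OF ideal_I]]
    additive_subgroup.zero_closed[OF ideal.axioms(1)[OF ideal_I]]
  by (auto simp: left_ideal_def I_closed)

text \<open>The elements that map \<open>M\<close> into its trace form a two-sided ideal containing
  \<open>e\<close>, so they include the least such ideal.\<close>

lemma ideal_smult_trace:
  assumes "left_module R M" "a \<in> I" "x \<in> carrier M"
  shows "a \<odot>\<^bsub>M\<^esub> x \<in> carrier (trace_module R e M)"
proof -
  interpret M: left_module R M by fact
  let ?T = "carrier (trace_module R e M)"
  note T = left_submoduleD[OF trace_submodule[OF assms(1), of e]]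
  let ?J = "{a \<in> carrier R. \<forall>x\<in>carrier M. a \<odot>\<^bsub>M\<^esub> x \<in> ?T}"
  have neg: "(\<ominus> a) \<odot>\<^bsub>M\<^esub> x = (\<ominus> \<one>) \<odot>\<^bsub>M\<^esub> (a \<odot>\<^bsub>M\<^esub> x)" if "a \<in> carrier R" "x \<in> carrier M" for a x
    using that M.smult_assoc[of "\<ominus> \<one>" a x] by (simp add: l_minus)
  have "ideal ?J R"
  proof (rule idealI[OF ring_axioms])
    show "subgroup ?J (add_monoid R)"
    proof (rule add.subgroupI)
      show "?J \<noteq> {}" using T(3) by (auto intro!: exI[of _ \<zero>])
      show "\<ominus> a \<in> ?J" if "a \<in> ?J" for a
      proof -
        have "(\<ominus> a) \<odot>\<^bsub>M\<^esub> x \<in> ?T" if x: "x \<in> carrier M" for x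
          using \<open>a \<in> ?J\<close> x neg[of a x] T(5)[of "\<ominus> \<one>" "a \<odot>\<^bsub>M\<^esub> x"] by simp
        then show ?thesis using that by simp
      qed
      show "a \<oplus> b \<in> ?J" if "a \<in> ?J" "b \<in> ?J" for a b
        using that by (auto simp: M.smult_l_distr intro!: T(4))
    qed auto
  qed (auto simp: M.smult_assoc intro: T(5))
  moreover have "e \<in> ?J"
  proof -
    have "e \<odot>\<^bsub>M\<^esub> y \<in> ?T" if "y \<in> carrier M" for y
      by (rule trace_fixed[OF assms(1)]) (use that M.smult_assoc[of e e y] in auto)
    then show ?thesis by simp
  qed
  ultimately have "I \<subseteq> ?J" using genideal_minimal[of ?J "{e}"] by simp
  then show ?thesis using assms(2,3) by blast
qed

text \<open>The trace of a free module consists of the tuples with entries in \<open>I\<close>: an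
  entry fixed by \<open>e\<close> is a multiple of \<open>e\<close>, and conversely an entry in
  \<open>I\<close> times a standard generator lies in the trace by
  \<open>ideal_smult_trace\<close>.\<close>

lemma trace_relfree_one: "trace_module R e (relfree R \<one> k) = tuples R I k"
proof -
  let ?P = "relfree R \<one> k"
  note P = left_module_relfree_one[of k]
  interpret P: left_module R ?P by (rule P)
  note T = left_submoduleD[OF trace_submodule[OF P, of e]]
  have "carrier (trace_module R e ?P) \<subseteq> carrier (tuples R I k)"
  proof (rule trace_least[OF P])
    show "left_submodule (carrier (tuples R I k)) R ?P"
      by (rule left_submoduleI)
        (auto simp: tuples_mem[OF left_ideal_I] relfree_one_mem I_closed left_idealD[OF left_ideal_I])
    fix x assume x: "x \<in> carrier ?P" "e \<odot>\<^bsub>?P\<^esub> x = x"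
    have "x i \<in> I" for i
    proof -
      have "e \<otimes> x i = x i" using fun_cong[OF x(2), of i] by simp
      moreover have "x i \<in> carrier R" using x(1) relfree_one_mem by blast
      ultimately show ?thesis using ideal.I_r_closed[OF ideal_I e_in_I] by metis
    qed
    then show "x \<in> carrier (tuples R I k)" using x(1) relfree_one_mem tuples_mem[OF left_ideal_I] by blast
  qed
  moreover have "x \<in> carrier (trace_module R e ?P)"
    if "x \<in> carrier (tuples R I k)" "\<forall>i\<ge>j. x i = \<zero>" "j \<le> k" for x j
    using that
  proof (induction j arbitrary: x)
    case 0
    then have "x = (\<lambda>_. \<zero>)" by auto
    then show ?case using T(3) by simp
  next
    case (Suc j)
    let ?y = "\<lambda>i. if i = j then \<zero> else x i"
    have xi: "x i \<in> I" for i using Suc.prems(1) tuples_mem[OF left_ideal_I] by blast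
    have "?y \<in> carrier (tuples R I k)"
      using Suc.prems(1) left_idealD(2)[OF left_ideal_I] unfolding tuples_mem[OF left_ideal_I] by auto
    moreover have "\<forall>i\<ge>j. ?y i = \<zero>" using Suc.prems(2) by auto
    ultimately have y: "?y \<in> carrier (trace_module R e ?P)" using Suc by auto
    have "x j \<odot>\<^bsub>?P\<^esub> unit_tuple R \<one> j \<in> carrier (trace_module R e ?P)"
      by (rule ideal_smult_trace[OF P xi])
        (rule idempotent.unit_tuple_mem[OF idempotent_one], use Suc.prems(3) in simp)
    from T(4)[OF y this] have "(\<lambda>i. ?y i \<oplus> x j \<otimes> unit_tuple R \<one> j i) \<in> carrier (trace_module R e ?P)"
      by simp
    also have "(\<lambda>i. ?y i \<oplus> x j \<otimes> unit_tuple R \<one> j i) = x"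
      using I_closed[OF xi] by (auto simp: unit_tuple_def fun_eq_iff)
    finally show ?case .
  qed
  ultimately have "carrier (trace_module R e ?P) = carrier (tuples R I k)"
    using tuples_mem[OF left_ideal_I, of _ k] by blast
  then have "trace_module R e ?P = ?P\<lparr>carrier := carrier (tuples R I k)\<rparr>"
    by (rule trace_module_eq)
  also have "\<dots> = tuples R I k" by (simp add: relfree_def tuples_def)
  finally show ?thesis .
qed

subsection \<open>Modules whose trace is resolved by the idempotent\<close>

definition trace_fin_pd :: "('a, 'm) module \<Rightarrow> bool" where
  "trace_fin_pd X \<longleftrightarrow> left_module R X \<and> fin_pd R e (trace_module R e X)"

text \<open>Taking traces does not preserve kernels in general. The trace of the kernel lies in the
  kernel of the traces and has the same fixed vectors; the two agree once the larger one is
  generated by these.\<close>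

lemma trace_kerm:
  assumes "left_module R M" "left_module R X" "p \<in> mod_hom R M X"
    and "idem_generated R e (kerm (trace_module R e M) (trace_module R e X) p)"
  shows "trace_module R e (kerm M X p) = kerm (trace_module R e M) (trace_module R e X) p"
proof -
  let ?K = "kerm M X p" and ?T = "kerm (trace_module R e M) (trace_module R e X) p"
  have K: "left_module R ?K" by (rule left_module_kerm[OF assms(1-3)])
  have T: "left_module R ?T"
    by (rule left_module_kerm[OF left_module_trace[OF assms(1)] left_module_trace[OF assms(2)]
          mod_hom_trace[OF assms(1-3) e_closed]])
  have mem: "x \<in> carrier ?T \<Longrightarrow> x \<in> carrier ?K" for x
    using trace_subset[OF assms(1)] by auto
  have "left_submodule (carrier ?T) R ?K"
    using left_submodule_carrier[OF T] mem by (auto simp: left_submodule_def)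
  then have sub: "carrier (trace_module R e ?K) \<subseteq> carrier ?T"
    by (rule trace_least[OF K]) (auto intro: trace_fixed[OF assms(1)])
  have "left_submodule (carrier (trace_module R e ?K)) R ?T"
    using trace_submodule[OF K, of e] sub by (auto simp: left_submodule_def)
  then have "carrier (trace_module R e ?K) = carrier ?T"
    by (rule idem_generated_eq[OF assms(4)]) (rule trace_fixed[OF K], use mem in auto)
  then show ?thesis
    unfolding trace_module_eq[OF \<open>carrier (trace_module R e ?K) = carrier ?T\<close>]
    by (simp add: kerm_def) (simp add: trace_module_def)
qed

lemma fin_pd_relfree_trace:
  assumes "fin_pd R e (tuples R I 1)"
  shows "fin_pd R e (trace_module R e (relfree R \<one> k))"
  using assms pd_le_tuples_power[OF left_ideal_I] unfolding trace_relfree_one fin_pd_def by blast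

text \<open>The kernel of the map of traces is a kernel between two modules with finite resolutions
  by powers of \<open>Re\<close>, so it has one too and is generated by its fixed vectors. The
  finite resolution of \<open>I\<close> enters through the trace of the free module.\<close>

lemma trace_fin_pd_syzygy:
  assumes "fin_pd R e (tuples R I 1)" "trace_fin_pd X" "g \<in> mod_epi R (relfree R \<one> k) X"
  shows "trace_fin_pd (kerm (relfree R \<one> k) X g)"
    and "trace_module R e (kerm (relfree R \<one> k) X g) =
      kerm (trace_module R e (relfree R \<one> k)) (trace_module R e X) g"
proof -
  let ?P = "relfree R \<one> k"
  note P = left_module_relfree_one[of k]
  have X: "left_module R X" "fin_pd R e (trace_module R e X)"
    using assms(2) by (auto simp: trace_fin_pd_def)
  have fin: "fin_pd R e (kerm (trace_module R e ?P) (trace_module R e X) g)"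
    by (rule fin_pd_kernel[OF fin_pd_relfree_trace[OF assms(1)] X(2) mod_epi_trace[OF P X(1) assms(3)]])
  show eq: "trace_module R e (kerm ?P X g) = kerm (trace_module R e ?P) (trace_module R e X) g"
    by (rule trace_kerm[OF P X(1) mod_epiD(1)[OF assms(3)] fin_pd_idem_generated[OF fin]])
  show "trace_fin_pd (kerm ?P X g)"
    using fin left_module_kerm[OF P X(1) mod_epiD(1)[OF assms(3)]] by (simp add: trace_fin_pd_def eq)
qed

text \<open>
  The pullback of a map \<open>\<phi> : N \<rightarrow> X\<close> along the trace of a free cover \<open>P \<rightarrow> X\<close>. If
  \<open>N \<rightarrow> X\<close> compares a syzygy over the corner ring with a syzygy over \<open>R\<close>, this is a module of
  cycles in the mapping cone of the comparison of the two resolutions; the point is that it is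
  resolved by the idempotent although \<open>N\<close> and \<open>X\<close> are not.
\<close>

definition cone_cycles ::
  "('a, 'n) module \<Rightarrow> ('n \<Rightarrow> 'm) \<Rightarrow> ('a, 'm) module \<Rightarrow> nat \<Rightarrow> ((nat \<Rightarrow> 'a) \<Rightarrow> 'm) \<Rightarrow>
   ('a, 'n \<times> (nat \<Rightarrow> 'a)) module" where
  "cone_cycles N \<phi> X k g = kerm (prod_module N (trace_module R e (relfree R \<one> k))) X
     (\<lambda>x. mdiff R X (\<phi> (fst x)) (g (snd x)))"

lemma cone_cycles:
  assumes "left_module R N" "left_module R X" "\<phi> \<in> mod_hom R N X" "g \<in> mod_hom R (relfree R \<one> k) X"
  shows left_module_cone_cycles: "left_module R (cone_cycles N \<phi> X k g)"
    and cone_cycles_mem: "x \<in> carrier (cone_cycles N \<phi> X k g) \<longleftrightarrow> fst x \<in> carrier N \<and>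
      snd x \<in> carrier (trace_module R e (relfree R \<one> k)) \<and> \<phi> (fst x) = g (snd x)"
proof -
  interpret X: left_module R X by fact
  note P = left_module_relfree_one[of k]
  note T = left_module_trace[OF P, of e]
  show "left_module R (cone_cycles N \<phi> X k g)"
    unfolding cone_cycles_def
    by (intro left_module_kerm left_module_prod assms T mod_hom_diff mod_hom_comp[OF mod_hom_fst assms(3)]
        mod_hom_comp[OF mod_hom_comp[OF mod_hom_snd trace_incl[OF P]] assms(4)])
  show "x \<in> carrier (cone_cycles N \<phi> X k g) \<longleftrightarrow> fst x \<in> carrier N \<and>
      snd x \<in> carrier (trace_module R e (relfree R \<one> k)) \<and> \<phi> (fst x) = g (snd x)"
    using mod_homD(1)[OF assms(3)] mod_homD(1)[OF assms(4)] trace_subset[OF P, of "snd x" e]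
    by (auto simp: cone_cycles_def X.mdiff_eq_zero_iff)
qed

lemma cone_cycles_simps [simp]:
  "zero (cone_cycles N \<phi> X k g) = (\<zero>\<^bsub>N\<^esub>, \<lambda>_. \<zero>)"
  "x \<oplus>\<^bsub>cone_cycles N \<phi> X k g\<^esub> y = (fst x \<oplus>\<^bsub>N\<^esub> fst y, \<lambda>i. snd x i \<oplus> snd y i)"
  "a \<odot>\<^bsub>cone_cycles N \<phi> X k g\<^esub> x = (a \<odot>\<^bsub>N\<^esub> fst x, \<lambda>i. a \<otimes> snd x i)"
  by (simp_all add: cone_cycles_def)

text \<open>One step of the mapping cone. With \<open>h\<close> a lift of \<open>\<phi> f\<close>
  along \<open>g\<close>, the map \<open>(x, y) -> (f x, h x - g1 y)\<close> covers the old cycles,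
  and its kernel is the new module of cycles. Since \<open>f\<close> need only cover the
  \<open>e\<close>-part of \<open>N\<close>, surjectivity depends on the old cycles being generated
  by fixed vectors.\<close>

lemma cone_step:
  assumes I1: "fin_pd R e (tuples R I 1)"
    and N: "left_module R N" and X: "left_module R X" and \<phi>: "\<phi> \<in> mod_hom R N X"
    and g: "g \<in> mod_epi R (relfree R \<one> k) X"
    and fin: "fin_pd R e (cone_cycles N \<phi> X k g)"
    and D: "relproj R e D" and f: "f \<in> mod_hom R D N"
    and f_onto: "\<And>y. \<lbrakk>y \<in> carrier N; e \<odot>\<^bsub>N\<^esub> y = y\<rbrakk> \<Longrightarrow> \<exists>x\<in>carrier D. e \<odot>\<^bsub>D\<^esub> x = x \<and> f x = y"
    and g1: "g1 \<in> mod_epi R (relfree R \<one> l) (kerm (relfree R \<one> k) X g)"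
  obtains h where "h \<in> mod_hom R (kerm D N f) (kerm (relfree R \<one> k) X g)"
    "fin_pd R e (cone_cycles (kerm D N f) h (kerm (relfree R \<one> k) X g) l g1)"
proof -
  let ?P = "relfree R \<one> k" and ?Q = "relfree R \<one> l"
  let ?X1 = "kerm ?P X g" and ?N1 = "kerm D N f"
  let ?TP = "trace_module R e ?P" and ?TQ = "trace_module R e ?Q"
  note P = left_module_relfree_one[of k] and Q = left_module_relfree_one[of l]
  interpret P: left_module R ?P by (rule P)
  interpret Q: left_module R ?Q by (rule Q)
  interpret N: left_module R N by fact
  interpret X: left_module R X by fact
  have Dm: "left_module R D" using D by (auto simp: relproj_def)
  interpret D: left_module R D by fact
  note gh = mod_epiD(1)[OF g] and g1h = mod_epiD(1)[OF g1]
  have X1: "left_module R ?X1" by (rule left_module_kerm[OF P X gh])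
  have N1: "left_module R ?N1" by (rule left_module_kerm[OF Dm N f])
  note TQ = left_module_trace[OF Q, of e]
  obtain h where h: "h \<in> mod_hom R D ?P" "\<And>x. x \<in> carrier D \<Longrightarrow> g (h x) = \<phi> (f x)"
    using relproj_lift[OF D P X g mod_hom_comp[OF f \<phi>]] by blast
  have DT: "carrier (trace_module R e D) = carrier D"
    by (rule idem_generated_trace[OF fin_pd_idem_generated[OF fin_pd_relproj[OF D]]])
  \<comment> \<open>\<open>D\<close> is generated by its fixed vectors, so any map from it to
    \<open>?P\<close> lands in the trace.\<close>
  have hT: "h x \<in> carrier ?TP" if "x \<in> carrier D" for x
    using mod_homD(1)[OF mod_hom_trace[OF Dm P h(1) e_closed]] that DT by blast
  have hN1: "h \<in> mod_hom R ?N1 ?X1"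
    by (rule mod_homI) (use mod_homD[OF h(1)] h(2) mod_hom_zero[OF N X \<phi>] in auto)
  have g1T: "g1 y \<in> carrier ?TP" "g (g1 y) = \<zero>\<^bsub>X\<^esub>" if "y \<in> carrier ?TQ" for y
  proof -
    have "g1 y \<in> carrier (trace_module R e ?X1)"
      by (rule mod_homD(1)[OF mod_hom_trace[OF Q X1 g1h e_closed] that])
    then show "g1 y \<in> carrier ?TP"
      by (rule mod_homD(1)[OF mod_hom_trace[OF X1 P kerm_incl e_closed]])
    show "g (g1 y) = \<zero>\<^bsub>X\<^esub>"
      using mod_homD(1)[OF g1h trace_subset[OF Q that]] by simp
  qed
  let ?M = "prod_module D ?TQ" and ?K = "cone_cycles N \<phi> X k g"
  let ?p = "\<lambda>x. (f (fst x), mdiff R ?P (h (fst x)) (g1 (snd x)))"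
  have M: "left_module R ?M" by (rule left_module_prod[OF Dm TQ])
  note K = left_module_cone_cycles[OF N X \<phi> gh]
  note Kmem = cone_cycles_mem[OF N X \<phi> gh]
  have g1P: "g1 \<in> mod_hom R ?TQ ?P"
    by (rule mod_hom_comp[OF mod_hom_comp[OF trace_incl[OF Q] g1h] kerm_incl])
  have p0: "?p \<in> mod_hom R ?M (prod_module N ?P)"
    by (intro mod_hom_Pair mod_hom_comp[OF mod_hom_fst f] mod_hom_diff P
        mod_hom_comp[OF mod_hom_fst h(1)] mod_hom_comp[OF mod_hom_snd g1P])
  have pK: "?p x \<in> carrier ?K" if "x \<in> carrier ?M" for x
  proof -
    have x: "fst x \<in> carrier D" "snd x \<in> carrier ?TQ" using that by auto
    have "mdiff R ?P (h (fst x)) (g1 (snd x)) \<in> carrier ?TP"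
      by (rule left_submodule_mdiff[OF trace_submodule[OF P] ring_axioms hT[OF x(1)] g1T(1)[OF x(2)]])
    moreover have "g (mdiff R ?P (h (fst x)) (g1 (snd x))) = \<phi> (f (fst x))"
      using mod_hom_mdiff[OF P gh mod_homD(1)[OF h(1) x(1)] mod_homD(1)[OF g1P x(2)]]
        h(2)[OF x(1)] g1T(2)[OF x(2)] mod_homD(1)[OF \<phi> mod_homD(1)[OF f x(1)]] by simp
    ultimately show ?thesis
      unfolding Kmem using mod_homD(1)[OF f x(1)] by simp
  qed
  have p: "?p \<in> mod_hom R ?M ?K"
    by (rule mod_homI, erule pK) (use mod_homD(2,3)[OF p0] in simp_all)
  \<comment> \<open>It suffices to reach a fixed cycle \<open>(x, w)\<close>: lift \<open>x\<close>
    to a fixed \<open>q\<close> in \<open>D\<close>, then lift the remaining difference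
    \<open>h q - w\<close>, which lies in the kernel of \<open>g\<close>, along
    \<open>g1\<close>.\<close>
  have "?p ` carrier ?M = carrier ?K"
  proof (rule idem_generated_eq[OF fin_pd_idem_generated[OF fin]])
    show "left_submodule (?p ` carrier ?M) R ?K"
      by (rule left_submodule_image[OF M K p left_submodule_carrier[OF M]])
    fix z assume z: "z \<in> carrier ?K" "e \<odot>\<^bsub>?K\<^esub> z = z"
    obtain x w where xw: "z = (x, w)" by (cases z)
    have zx: "x \<in> carrier N" "w \<in> carrier ?TP" "\<phi> x = g w" "e \<odot>\<^bsub>N\<^esub> x = x" "e \<odot>\<^bsub>?P\<^esub> w = w"
      using z unfolding Kmem xw by auto
    obtain q where q: "q \<in> carrier D" "e \<odot>\<^bsub>D\<^esub> q = q" "f q = x"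
      using f_onto[OF zx(1,4)] by blast
    have w: "w \<in> carrier ?P" by (rule trace_subset[OF P zx(2)])
    have hq: "h q \<in> carrier ?P" "e \<odot>\<^bsub>?P\<^esub> h q = h q"
      using mod_homD(1)[OF h(1) q(1)] mod_homD(3)[OF h(1) e_closed q(1)] q(2) by simp_all
    have "mdiff R ?P (h q) w \<in> carrier ?X1"
      using hq w h(2)[OF q(1)] q(3) zx(3) mod_homD(1)[OF gh w]
      by (simp add: mod_hom_mdiff[OF P gh] del: relfree_simps)
    then obtain y where y: "y \<in> carrier ?Q" "g1 y = mdiff R ?P (h q) w"
      using g1 by (elim mod_epiE)
    \<comment> \<open>The vector \<open>y\<close> need not lie in the trace. \<open>e y\<close>
      does, and it has the same image because \<open>h q - w\<close> is fixed by
      \<open>e\<close>.\<close>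
    have y': "e \<odot>\<^bsub>?Q\<^esub> y \<in> carrier ?TQ"
      by (rule ideal_smult_trace[OF Q e_in_I y(1)])
    have ed: "e \<odot>\<^bsub>?P\<^esub> mdiff R ?P (h q) w = mdiff R ?P (h q) w"
    proof -
      have "e \<odot>\<^bsub>?P\<^esub> mdiff R ?P (h q) w \<oplus>\<^bsub>?P\<^esub> w = e \<odot>\<^bsub>?P\<^esub> (mdiff R ?P (h q) w \<oplus>\<^bsub>?P\<^esub> w)"
        using hq w zx(5) P.smult_r_distr[OF e_closed P.mdiff_closed[OF hq(1) w] w] by simp
      also have "\<dots> = h q" using hq w P.mdiff_add_cancel by simp
      finally have "mdiff R ?P (e \<odot>\<^bsub>?P\<^esub> mdiff R ?P (h q) w \<oplus>\<^bsub>?P\<^esub> w) w = mdiff R ?P (h q) w" by simp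
      then show ?thesis
        using P.add_mdiff_cancel[OF P.smult_closed[OF e_closed P.mdiff_closed[OF hq(1) w]] w] by simp
    qed
    have g1y: "g1 (e \<odot>\<^bsub>?Q\<^esub> y) = mdiff R ?P (h q) w"
      using mod_homD(3)[OF g1h e_closed y(1)] y(2) ed by simp
    have "mdiff R ?P (h q) (mdiff R ?P (h q) w) = w"
    proof -
      have d: "mdiff R ?P (h q) w \<in> carrier ?P" using hq w by blast
      have "w \<oplus>\<^bsub>?P\<^esub> mdiff R ?P (h q) w = h q" by (rule P.add_mdiff_swap[OF hq(1) w])
      then show ?thesis using P.add_mdiff_cancel[OF w d] by simp
    qed
    then have pz: "?p (q, e \<odot>\<^bsub>?Q\<^esub> y) = z"
      using g1y q(3) by (simp add: xw del: relfree_simps)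
    have "(q, e \<odot>\<^bsub>?Q\<^esub> y) \<in> carrier ?M" using q y' by simp
    from image_eqI[where f = ?p, OF pz[symmetric] this] show "z \<in> ?p ` carrier ?M" .
  qed
  then have epi: "?p \<in> mod_epi R ?M ?K" using p by (simp add: mod_epi_def)
  have "fin_pd R e (kerm ?M ?K ?p)"
    by (rule fin_pd_kernel[OF fin_pd_prod[OF fin_pd_relproj[OF D] fin_pd_relfree_trace[OF I1]] fin epi])
  moreover have "kerm ?M ?K ?p = cone_cycles ?N1 h ?X1 l g1"
  proof -
    have "{x \<in> carrier ?M. ?p x = \<zero>\<^bsub>?K\<^esub>} = carrier (cone_cycles ?N1 h ?X1 l g1)"
    proof -
      have *: "?p x = \<zero>\<^bsub>?K\<^esub> \<longleftrightarrow> f (fst x) = \<zero>\<^bsub>N\<^esub> \<and> h (fst x) = g1 (snd x)"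
        if "x \<in> carrier ?M" for x
        using P.mdiff_eq_zero_iff[of "h (fst x)" "g1 (snd x)"] mod_homD(1)[OF h(1), of "fst x"]
          mod_homD(1)[OF g1P, of "snd x"] that by simp
      have "{x \<in> carrier ?M. ?p x = \<zero>\<^bsub>?K\<^esub>} =
          {x \<in> carrier ?M. f (fst x) = \<zero>\<^bsub>N\<^esub> \<and> h (fst x) = g1 (snd x)}"
        by (rule Collect_cong, rule conj_cong[OF refl], erule *)
      also have "\<dots> = carrier (cone_cycles ?N1 h ?X1 l g1)"
        by (auto simp: set_eq_iff cone_cycles_mem[OF N1 X1 hN1 g1h])
      finally show ?thesis .
    qed
    then show ?thesis
      by (intro module.equality) (simp_all add: kerm_def cone_cycles_def prod_module_def)
  qed
  ultimately show thesis using that hN1 by simp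
qed

text \<open>If \<open>eN = 0\<close>, fixed cycles have first component zero, and hence so do all
  cycles. The cycles are then the kernel of the map of traces \<open>ReP -> ReX\<close>, which
  presents \<open>ReX\<close> as a quotient of finitely resolved modules.\<close>

lemma cone_final:
  assumes I1: "fin_pd R e (tuples R I 1)"
    and N: "left_module R N" and X: "left_module R X" and \<phi>: "\<phi> \<in> mod_hom R N X"
    and g: "g \<in> mod_epi R (relfree R \<one> k) X"
    and fin: "fin_pd R e (cone_cycles N \<phi> X k g)"
    and N0: "\<And>x. \<lbrakk>x \<in> carrier N; e \<odot>\<^bsub>N\<^esub> x = x\<rbrakk> \<Longrightarrow> x = \<zero>\<^bsub>N\<^esub>"
  shows "trace_fin_pd X"
proof -
  let ?P = "relfree R \<one> k" and ?K = "cone_cycles N \<phi> X k g"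
  let ?L = "kerm (trace_module R e ?P) (trace_module R e X) g"
  note P = left_module_relfree_one[of k]
  interpret N: left_module R N by fact
  note gh = mod_epiD(1)[OF g]
  note K = left_module_cone_cycles[OF N X \<phi> gh] and Kmem = cone_cycles_mem[OF N X \<phi> gh]
  have fstK: "fst \<in> mod_hom R ?K N" by (rule mod_homI) (auto simp: Kmem)
  have "{x \<in> carrier ?K. fst x = \<zero>\<^bsub>N\<^esub>} = carrier ?K"
  proof (rule idem_generated_eq[OF fin_pd_idem_generated[OF fin] left_submodule_ker[OF K N fstK]])
    fix x assume "x \<in> carrier ?K" "e \<odot>\<^bsub>?K\<^esub> x = x"
    then show "x \<in> {x \<in> carrier ?K. fst x = \<zero>\<^bsub>N\<^esub>}" using N0[of "fst x"] by (cases x) (auto simp: Kmem)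
  qed
  then have K0: "fst x = \<zero>\<^bsub>N\<^esub>" if "x \<in> carrier ?K" for x using that by blast
  have \<phi>0: "\<phi> \<zero>\<^bsub>N\<^esub> = \<zero>\<^bsub>X\<^esub>" by (rule mod_hom_zero[OF N X \<phi>])
  have L: "left_module R ?L"
    by (rule left_module_kerm[OF left_module_trace[OF P] left_module_trace[OF X]
          mod_hom_trace[OF P X gh e_closed]])
  have sndL: "snd x \<in> carrier ?L" if "x \<in> carrier ?K" for x
    using that K0[OF that] \<phi>0 by (auto simp: Kmem)
  have "fin_pd R e ?L"
  proof (rule fin_pd_iso[OF L _ _ fin])
    show "snd \<in> mod_hom R ?K ?L" by (rule mod_homI, erule sndL) auto
    show "bij_betw snd (carrier ?K) (carrier ?L)"
      by (rule bij_betw_byWitness[where f' = "\<lambda>w. (\<zero>\<^bsub>N\<^esub>, w)"])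
        (use K0 sndL \<phi>0 in \<open>auto simp: Kmem prod_eq_iff\<close>)
  qed
  then have "fin_pd R e (trace_module R e X)"
    by (rule fin_pd_cokernel[OF left_module_trace[OF X] fin_pd_relfree_trace[OF I1] _
          mod_epi_trace[OF P X g]])
  then show ?thesis using X by (simp add: trace_fin_pd_def)
qed

text \<open>For the identity of \<open>X\<close> the pullback is the graph of \<open>g\<close> on
  the trace of the free module.\<close>

lemma cone_start:
  assumes I1: "fin_pd R e (tuples R I 1)" and X: "left_module R X"
    and g: "g \<in> mod_epi R (relfree R \<one> k) X"
  shows "fin_pd R e (cone_cycles X (\<lambda>x. x) X k g)"
proof -
  note gh = mod_epiD(1)[OF g]
  note K = left_module_cone_cycles[OF X X mod_hom_id gh] and Kmem = cone_cycles_mem[OF X X mod_hom_id gh]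
  note P = left_module_relfree_one[of k]
  show ?thesis
  proof (rule fin_pd_iso[OF K _ _ fin_pd_relfree_trace[OF I1]])
    have *: "(g w, w) \<in> carrier (cone_cycles X (\<lambda>x. x) X k g)"
      if "w \<in> carrier (trace_module R e (relfree R \<one> k))" for w
      using that mod_homD(1)[OF gh trace_subset[OF P that]] by (simp add: Kmem)
    show "(\<lambda>w. (g w, w)) \<in> mod_hom R (trace_module R e (relfree R \<one> k)) (cone_cycles X (\<lambda>x. x) X k g)"
      by (rule mod_homI, erule *) (use mod_homD(2,3)[OF gh] trace_subset[OF P, of _ e] in auto)
    show "bij_betw (\<lambda>w. (g w, w)) (carrier (trace_module R e (relfree R \<one> k)))
        (carrier (cone_cycles X (\<lambda>x. x) X k g))"
      by (rule bij_betw_byWitness[where f' = snd]) (use * in \<open>auto simp: Kmem\<close>)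
  qed
qed

text \<open>
  If \<open>eN\<close> has projective dimension at most \<open>r\<close> over the corner ring, then after \<open>r + 1\<close>
  syzygies the module \<open>X\<close> has become one whose trace is resolved by the idempotent.
\<close>

lemma pd_le_cone_step:
  assumes IH: "\<And>(N :: ('a, nat \<Rightarrow> 'a) module) (X :: ('a, nat \<Rightarrow> 'a) module) \<phi> k g n r'.
      \<lbrakk>r = Suc r'; left_module R N; left_module R X; \<phi> \<in> mod_hom R N X; g \<in> mod_epi R (relfree R \<one> k) X;
        fin_pd R e (cone_cycles N \<phi> X k g); pd_le (corner_ring R e) e r' (idem_corner R e N);
        pd_le R \<one> n X\<rbrakk> \<Longrightarrow> pd_le R \<one> (r' + 1 + c) X"
    and I1: "fin_pd R e (tuples R I 1)"
    and bound: "\<And>(X :: ('a, nat \<Rightarrow> 'a) module) n. \<lbrakk>trace_fin_pd X; pd_le R \<one> n X\<rbrakk> \<Longrightarrow> pd_le R \<one> c X"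
    and N: "left_module R N" and X: "left_module R X" and \<phi>: "\<phi> \<in> mod_hom R N X"
    and g: "g \<in> mod_epi R (relfree R \<one> k) X"
    and fin: "fin_pd R e (cone_cycles N \<phi> X k g)"
    and pdN: "pd_le (corner_ring R e) e r (idem_corner R e N)"
    and pdX: "pd_le R \<one> n X"
  shows "pd_le R \<one> (r + 1 + c) X"
proof -
  interpret One: idempotent R \<one> by (rule idempotent_one)
  interpret C: idempotent "corner_ring R e" e by (rule idempotent_corner)
  interpret N: left_module R N by fact
  let ?X1 = "kerm (relfree R \<one> k) X g"
  note P = left_module_relfree_one[of k]
  note gh = mod_epiD(1)[OF g]
  have X1: "left_module R ?X1" by (rule left_module_kerm[OF P X gh])
  have pdX1: "pd_le R \<one> n ?X1"
    by (rule One.pd_le_kernel_relfree[OF One.pd_le_mono_Suc[OF pdX] g])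
  obtain l g1 where g1: "g1 \<in> mod_epi R (relfree R \<one> l) ?X1"
    using One.pd_le_mono_Suc[OF pdX1] by (elim pd_le_SucE) blast
  \<comment> \<open>One syzygy of \<open>X\<close> is used in every case. For \<open>r = 0\<close>
    the comparison \<open>f\<close> is bijective on \<open>e\<close>-parts, so its kernel has zero
    \<open>e\<close>-part and \<open>cone_final\<close> applies; otherwise \<open>eN\<close> is
    replaced by its syzygy and \<open>r\<close> drops.\<close>
  have "pd_le R \<one> (r + c) ?X1"
  proof (cases r)
    case 0
    then have eN: "relproj (corner_ring R e) e (idem_corner R e N)" using pdN by simp
    obtain D :: "('a, nat \<Rightarrow> 'a) module" and f where D: "relproj R e D" "f \<in> mod_hom R D N"
      and onto: "\<forall>y\<in>carrier N. e \<odot>\<^bsub>N\<^esub> y = y \<longrightarrow> (\<exists>x\<in>carrier D. e \<odot>\<^bsub>D\<^esub> x = x \<and> f x = y)"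
      and inj: "\<forall>x\<in>carrier D. e \<odot>\<^bsub>D\<^esub> x = x \<and> f x = \<zero>\<^bsub>N\<^esub> \<longrightarrow> x = \<zero>\<^bsub>D\<^esub>"
      by (rule relproj_idem_corner_lift[OF N eN])
    have Dm: "left_module R D" using D(1) by (auto simp: relproj_def)
    obtain h where h: "h \<in> mod_hom R (kerm D N f) ?X1"
        "fin_pd R e (cone_cycles (kerm D N f) h ?X1 l g1)"
      by (rule cone_step[OF I1 N X \<phi> g fin D onto[rule_format] g1])
    have "trace_fin_pd ?X1"
      by (rule cone_final[OF I1 left_module_kerm[OF Dm N D(2)] X1 h(1) g1 h(2)]) (use inj in auto)
    then show ?thesis using bound pdX1 0 by simp
  next
    case (Suc r')
    obtain j f0 where f0: "f0 \<in> mod_epi (corner_ring R e) (relfree (corner_ring R e) e j) (idem_corner R e N)"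
      "pd_le (corner_ring R e) e r' (kerm (relfree (corner_ring R e) e j) (idem_corner R e N) f0)"
      using pdN unfolding Suc by (elim pd_le_SucE) blast
    note f0' = f0[folded idem_corner_relfree]
    obtain f where f: "f \<in> mod_hom R (relfree R e j) N"
      "\<And>x. x \<in> carrier (idem_corner R e (relfree R e j)) \<Longrightarrow> f x = f0 x"
      using relfree_hom_extend[OF N mod_epiD(1)[OF f0'(1)]] by blast
    have onto: "\<exists>x\<in>carrier (relfree R e j). e \<odot>\<^bsub>relfree R e j\<^esub> x = x \<and> f x = y"
      if "y \<in> carrier N" "e \<odot>\<^bsub>N\<^esub> y = y" for y
    proof -
      have "y \<in> carrier (idem_corner R e N)" using that by simp
      then obtain x where x: "x \<in> carrier (idem_corner R e (relfree R e j))" "f0 x = y"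
        using f0'(1) by (elim mod_epiE)
      then show ?thesis using f(2)[OF x(1)] by (intro bexI[of _ x]) auto
    qed
    let ?N1 = "kerm (relfree R e j) N f"
    obtain h where h: "h \<in> mod_hom R ?N1 ?X1" "fin_pd R e (cone_cycles ?N1 h ?X1 l g1)"
      by (rule cone_step[OF I1 N X \<phi> g fin relproj_relfree f(1) onto g1])
    have N1: "left_module R ?N1" by (rule left_module_kerm[OF left_module_relfree N f(1)])
    have "idem_corner R e ?N1 = kerm (idem_corner R e (relfree R e j)) (idem_corner R e N) f0"
      unfolding kerm_idem_corner[symmetric] using f(2) by (intro kerm_cong) simp
    then have "pd_le (corner_ring R e) e r' (idem_corner R e ?N1)" using f0'(2) by simp
    from IH[OF Suc N1 X1 h(1) g1 h(2) this pdX1]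
    show ?thesis using Suc by simp
  qed
  then show ?thesis
    using pd_le_SucI[OF X g] by simp
qed

lemma pd_le_cone:
  assumes I1: "fin_pd R e (tuples R I 1)"
    and bound: "\<And>(X :: ('a, nat \<Rightarrow> 'a) module) n. \<lbrakk>trace_fin_pd X; pd_le R \<one> n X\<rbrakk> \<Longrightarrow> pd_le R \<one> c X"
    and "left_module R N" "left_module R X" "\<phi> \<in> mod_hom R N X"
    and "g \<in> mod_epi R (relfree R \<one> k) X"
    and "fin_pd R e (cone_cycles N \<phi> X k g)"
    and "pd_le (corner_ring R e) e r (idem_corner R e N)"
    and "pd_le R \<one> n X"
  shows "pd_le R \<one> (r + 1 + c) X"
proof -
  have tup: "pd_le R \<one> (r + 1 + c) X"
    if "left_module R N" "left_module R X" "\<phi> \<in> mod_hom R N X"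
      "g \<in> mod_epi R (relfree R \<one> k) X" "fin_pd R e (cone_cycles N \<phi> X k g)"
      "pd_le (corner_ring R e) e r (idem_corner R e N)" "pd_le R \<one> n X"
    for N :: "('a, nat \<Rightarrow> 'a) module" and X :: "('a, nat \<Rightarrow> 'a) module" and \<phi> k g r n
    using that
  proof (induction r arbitrary: N X \<phi> k g n)
    case 0
    \<comment> \<open>The hypothesis \<open>IH\<close> of the step carries the premise
      \<open>r = Suc r'\<close>, so it is vacuous here and the step serves as base case.\<close>
    show ?case by (rule pd_le_cone_step[OF _ I1 bound 0]) auto
  next
    case (Suc r)
    show ?case by (rule pd_le_cone_step[OF _ I1 bound Suc.prems]) (use Suc.IH in auto)
  qed
  show ?thesis
    by (rule pd_le_cone_step[OF _ I1 bound assms(3-9)]) (use tup in auto)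
qed

lemma pd_le_syzygies:
  assumes "fin_pd R e (tuples R I 1)"
    and "\<And>(X :: ('a, nat \<Rightarrow> 'a) module) n. \<lbrakk>trace_fin_pd X; pd_le R \<one> n X\<rbrakk> \<Longrightarrow> pd_le R \<one> c X"
    and "pd_le (corner_ring R e) e r (idem_corner R e X)" "pd_le R \<one> n X"
  shows "pd_le R \<one> (r + 1 + c) X"
proof -
  interpret One: idempotent R \<one> by (rule idempotent_one)
  obtain k g where g: "left_module R X" "g \<in> mod_epi R (relfree R \<one> k) X"
    using One.pd_le_mono_Suc[OF assms(4)] by (elim pd_le_SucE) blast
  show ?thesis
    by (rule pd_le_cone[OF assms(1,2) g(1,1) mod_hom_id g(2) cone_start[OF assms(1) g] assms(3,4)])
qed

end

subsection \<open>Reduction modulo the idempotent ideal\<close>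

lemma left_module_corner_carrier:
  assumes "ring S" "left_module R Y" "\<psi> \<in> ring_hom S R"
  shows "carrier (corner_module S \<psi> Y) = carrier Y"
  using left_module.smult_one[OF assms(2)] ring_hom_one[OF assms(3)] by (auto simp: set_eq_iff)

lemma corner_map_ring_hom:
  assumes "ring S" "ring R" "\<psi> \<in> ring_hom S R"
  shows "corner_map S R \<psi>"
  using assms ring_hom_memE[OF assms(3)] by (intro corner_map.intro corner_map_axioms.intro) auto

text \<open>For a unital homomorphism every vector is fixed by \<open>\<psi> 1\<close>, so nothing
  is cut off. The \<open>restrict_scalars\<close> in the definition of strong idempotence is thereby
  covered by change of rings.\<close>

lemma restrict_scalars_eq_corner:
  assumes "ring S" "left_module R Y" "\<psi> \<in> ring_hom S R"
  shows "restrict_scalars \<psi> Y = corner_module S \<psi> Y"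
  using left_module_corner_carrier[OF assms]
  by (intro module.equality) (simp_all add: restrict_scalars_def, simp_all add: corner_module_def)

lemma mod_hom_corner_surj:
  assumes "ring S" "\<psi> \<in> ring_hom S R" "\<psi> ` carrier S = carrier R" "left_module R Y" "left_module R Y'"
    and "f \<in> mod_hom S (corner_module S \<psi> Y) (corner_module S \<psi> Y')"
  shows "f \<in> mod_hom R Y Y'"
proof -
  note c = left_module_corner_carrier[OF assms(1,4,2)] left_module_corner_carrier[OF assms(1,5,2)]
  note f = mod_homD[OF assms(6), unfolded c]
  show ?thesis
  proof (rule mod_homI)
    fix a x assume "a \<in> carrier R" "x \<in> carrier Y"
    moreover from this obtain s where "s \<in> carrier S" "a = \<psi> s" using assms(3) by blast
    ultimately show "f (a \<odot>\<^bsub>Y\<^esub> x) = a \<odot>\<^bsub>Y'\<^esub> f x" using f(3)[of s x] by simp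
  qed (use f in auto)
qed

context idempotent
begin

abbreviation quot_ring where "quot_ring \<equiv> R Quot I"

abbreviation quot_map where "quot_map \<equiv> (\<lambda>a. I +> a)"

lemma quot_ring: "ring quot_ring"
  by (rule ideal.quotient_is_ring[OF ideal_I])

lemma quot_map_hom: "quot_map \<in> ring_hom R quot_ring"
  using ideal.rcos_ring_hom[OF ideal_I] by simp

lemma quot_map_surj: "quot_map ` carrier R = carrier quot_ring"
  by (auto simp: FactRing_def A_RCOSETS_def')

lemma quot_zero: "\<zero>\<^bsub>quot_ring\<^esub> = I"
  by (simp add: FactRing_def)

lemma quot_map_zero_iff: "a \<in> carrier R \<Longrightarrow> I +> a = I \<longleftrightarrow> a \<in> I"
  using ideal.rcos_const_imp_mem[OF ideal_I]
    abelian_subgroup.a_rcos_const[OF abelian_subgroupI3[OF ideal.axioms(1)[OF ideal_I] abelian_group_axioms]]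
  by blast

lemma quot_map_eq_iff:
  assumes "a \<in> carrier R" "b \<in> carrier R"
  shows "I +> a = I +> b \<longleftrightarrow> a \<ominus> b \<in> I"
proof -
  interpret Q: ring quot_ring by (rule quot_ring)
  note h = ring_hom_memE[OF quot_map_hom]
  have *: "(I +> (a \<ominus> b)) \<oplus>\<^bsub>quot_ring\<^esub> (I +> b) = I +> a"
    using assms h(3)[of "a \<ominus> b" b] by (simp add: minus_eq a_assoc l_neg)
  have "I +> a = I +> b \<longleftrightarrow> (I +> (a \<ominus> b)) \<oplus>\<^bsub>quot_ring\<^esub> (I +> b) = I +> b"
    unfolding * ..
  also have "\<dots> \<longleftrightarrow> I +> (a \<ominus> b) = \<zero>\<^bsub>quot_ring\<^esub>"
    using assms h(1)[of "a \<ominus> b"] h(1)[of b] by (simp add: Q.add.r_cancel_one)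
  finally have "I +> a = I +> b \<longleftrightarrow> I +> (a \<ominus> b) = \<zero>\<^bsub>quot_ring\<^esub>" .
  then show ?thesis using quot_map_zero_iff[of "a \<ominus> b"] assms by (simp add: quot_zero)
qed

lemma corner_map_quot: "corner_map R quot_ring quot_map"
  by (rule corner_map_ring_hom[OF ring_axioms quot_ring quot_map_hom])

lemma idempotent_quot_one: "idempotent quot_ring \<one>\<^bsub>quot_ring\<^esub>"
  by (rule ring.idempotent_one[OF quot_ring])

text \<open>A relation expressing that \<open>Y\<close> is \<open>Z/ReZ\<close>, rather than a
  construction: powers of \<open>R/I\<close> and kernels over \<open>R/I\<close> then qualify
  directly as quotients.\<close>

definition trace_quotient :: "('a, 'm) module \<Rightarrow> ('a set, 'n) module \<Rightarrow> ('m \<Rightarrow> 'n) \<Rightarrow> bool" where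
  "trace_quotient Z Y q \<longleftrightarrow> left_module R Z \<and> left_module quot_ring Y \<and>
     q \<in> mod_epi R Z (corner_module R quot_map Y) \<and>
     (\<forall>z\<in>carrier Z. q z = \<zero>\<^bsub>Y\<^esub> \<longleftrightarrow> z \<in> carrier (trace_module R e Z))"

lemma trace_quotientD:
  assumes "trace_quotient Z Y q"
  shows "left_module R Z" "left_module quot_ring Y" "q \<in> mod_epi R Z (corner_module R quot_map Y)"
    "left_module R (corner_module R quot_map Y)" "carrier (corner_module R quot_map Y) = carrier Y"
    "z \<in> carrier Z \<Longrightarrow> q z = \<zero>\<^bsub>Y\<^esub> \<longleftrightarrow> z \<in> carrier (trace_module R e Z)"
  using assms corner_map.left_module_corner[OF corner_map_quot]
    left_module_corner_carrier[OF ring_axioms _ quot_map_hom]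
  by (auto simp: trace_quotient_def)

lemma kerm_trace_quotient:
  assumes "trace_quotient Z Y q"
  shows "kerm Z (corner_module R quot_map Y) q = trace_module R e Z"
proof -
  note D = trace_quotientD[OF assms]
  have "carrier (trace_module R e Z) = {z \<in> carrier Z. q z = \<zero>\<^bsub>Y\<^esub>}"
    using D(6) trace_subset[OF D(1), of _ e] by blast
  from trace_module_eq[OF this] show ?thesis by (simp add: kerm_def)
qed

text \<open>The elements are cosets of the trace; the operations use representatives chosen by
  \<open>xr\<close> and \<open>ar\<close>.\<close>

lemma trace_quotient_ex:
  fixes Z :: "('a, 'm) module"
  assumes "left_module R Z"
  obtains Y :: "('a set, 'm set) module" and q where "trace_quotient Z Y q"
proof -
  interpret Z: left_module R Z by fact
  let ?T = "carrier (trace_module R e Z)"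
  note T = left_submoduleD[OF trace_submodule[OF assms, of e]]
  define q where "q = (\<lambda>x. {y \<in> carrier Z. mdiff R Z y x \<in> ?T})"
  have mdiff_T: "mdiff R Z x y \<in> ?T" if "x \<in> ?T" "y \<in> ?T" for x y
    by (rule left_submodule_mdiff[OF trace_submodule[OF assms] ring_axioms that])
  have add_diff: "mdiff R Z (x \<oplus>\<^bsub>Z\<^esub> y) (x' \<oplus>\<^bsub>Z\<^esub> y') = mdiff R Z x x' \<oplus>\<^bsub>Z\<^esub> mdiff R Z y y'"
    if "x \<in> carrier Z" "y \<in> carrier Z" "x' \<in> carrier Z" "y' \<in> carrier Z" for x y x' y'
    using that by (simp add: mdiff_def Z.smult_r_distr Z.M.a_ac)
  have trans_diff: "mdiff R Z x z = mdiff R Z x y \<oplus>\<^bsub>Z\<^esub> mdiff R Z y z"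
    if "x \<in> carrier Z" "y \<in> carrier Z" "z \<in> carrier Z" for x y z
  proof -
    have "mdiff R Z x y \<oplus>\<^bsub>Z\<^esub> mdiff R Z y z = (mdiff R Z x y \<oplus>\<^bsub>Z\<^esub> y) \<oplus>\<^bsub>Z\<^esub> ((\<ominus> \<one>) \<odot>\<^bsub>Z\<^esub> z)"
      using that by (simp add: mdiff_def Z.M.a_assoc)
    then show ?thesis using that by (simp add: mdiff_def[of R Z x z])
  qed
  have qeq: "q x = q y \<longleftrightarrow> mdiff R Z x y \<in> ?T" if "x \<in> carrier Z" "y \<in> carrier Z" for x y
  proof
    assume "q x = q y"
    moreover have "x \<in> q x" using that T(3) by (simp add: q_def)
    ultimately show "mdiff R Z x y \<in> ?T" by (simp add: q_def)
  next
    assume xy: "mdiff R Z x y \<in> ?T"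
    have yx: "mdiff R Z y x \<in> ?T"
    proof -
      have "(\<ominus> \<one>) \<odot>\<^bsub>Z\<^esub> mdiff R Z x y = mdiff R Z y x"
        using that Z.smult_assoc[symmetric, of "\<ominus> \<one>" "\<ominus> \<one>" y]
        by (simp add: mdiff_def Z.smult_r_distr l_minus Z.M.a_comm)
      then show ?thesis using T(5)[OF _ xy, of "\<ominus> \<one>"] by simp
    qed
    show "q x = q y"
    proof (rule Set.set_eqI)
      fix z
      show "z \<in> q x \<longleftrightarrow> z \<in> q y"
        using trans_diff[of z x y] trans_diff[of z y x] T(4)[OF _ xy, of "mdiff R Z z x"]
          T(4)[OF _ yx, of "mdiff R Z z y"] that unfolding q_def by auto
    qed
  qed
  define xr where "xr = (\<lambda>X. SOME x. x \<in> carrier Z \<and> q x = X)"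
  define ar where "ar = (\<lambda>\<beta>. SOME a. a \<in> carrier R \<and> I +> a = \<beta>)"
  have xr: "xr (q x) \<in> carrier Z" "q (xr (q x)) = q x" if "x \<in> carrier Z" for x
    unfolding xr_def using someI[of "\<lambda>y. y \<in> carrier Z \<and> q y = q x" x] that by auto
  have ar: "ar (I +> a) \<in> carrier R" "I +> ar (I +> a) = I +> a" if "a \<in> carrier R" for a
    unfolding ar_def using someI[of "\<lambda>b. b \<in> carrier R \<and> I +> b = I +> a" a] that by auto
  define Y :: "('a set, 'm set) module" where
    "Y = \<lparr>carrier = q ` carrier Z, mult = undefined, one = undefined, zero = q \<zero>\<^bsub>Z\<^esub>,
      add = (\<lambda>X X'. q (xr X \<oplus>\<^bsub>Z\<^esub> xr X')), smult = (\<lambda>\<beta> X. q (ar \<beta> \<odot>\<^bsub>Z\<^esub> xr X))\<rparr>"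
  have add: "q x \<oplus>\<^bsub>Y\<^esub> q y = q (x \<oplus>\<^bsub>Z\<^esub> y)" if "x \<in> carrier Z" "y \<in> carrier Z" for x y
  proof -
    have "mdiff R Z (xr (q x)) x \<oplus>\<^bsub>Z\<^esub> mdiff R Z (xr (q y)) y \<in> ?T"
      using xr[OF that(1)] xr[OF that(2)] qeq that by (intro T(4)) auto
    then show ?thesis
      using xr[OF that(1)] xr[OF that(2)] that by (simp add: Y_def qeq add_diff)
  qed
  have smult: "(I +> a) \<odot>\<^bsub>Y\<^esub> q x = q (a \<odot>\<^bsub>Z\<^esub> x)" if "a \<in> carrier R" "x \<in> carrier Z" for a x
  proof -
    let ?b = "ar (I +> a)" and ?y = "xr (q x)"
    note b = ar[OF that(1)] and y = xr[OF that(2)]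
    \<comment> \<open>Another representative of the scalar differs by an element of
      \<open>I\<close>, which maps \<open>Z\<close> into the trace; this makes the action of
      \<open>R/I\<close> well defined.\<close>
    have "?b \<ominus> a \<in> I" using b that quot_map_eq_iff by blast
    then have 1: "(?b \<ominus> a) \<odot>\<^bsub>Z\<^esub> ?y \<in> ?T" by (rule ideal_smult_trace[OF assms _ y(1)])
    have 2: "a \<odot>\<^bsub>Z\<^esub> mdiff R Z ?y x \<in> ?T" using y that qeq by (intro T(5)) auto
    have "mdiff R Z (?b \<odot>\<^bsub>Z\<^esub> ?y) (a \<odot>\<^bsub>Z\<^esub> x) =
        mdiff R Z (?b \<odot>\<^bsub>Z\<^esub> ?y) (a \<odot>\<^bsub>Z\<^esub> ?y) \<oplus>\<^bsub>Z\<^esub> mdiff R Z (a \<odot>\<^bsub>Z\<^esub> ?y) (a \<odot>\<^bsub>Z\<^esub> x)"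
      using b y that by (intro trans_diff) auto
    moreover have "mdiff R Z (?b \<odot>\<^bsub>Z\<^esub> ?y) (a \<odot>\<^bsub>Z\<^esub> ?y) = (?b \<ominus> a) \<odot>\<^bsub>Z\<^esub> ?y"
      using b y that Z.smult_assoc[symmetric, of "\<ominus> \<one>" a ?y]
      by (simp add: mdiff_def minus_eq Z.smult_l_distr l_minus)
    moreover have "mdiff R Z (a \<odot>\<^bsub>Z\<^esub> ?y) (a \<odot>\<^bsub>Z\<^esub> x) = a \<odot>\<^bsub>Z\<^esub> mdiff R Z ?y x"
      using b y that Z.smult_assoc[symmetric, of "\<ominus> \<one>" a x] Z.smult_assoc[symmetric, of a "\<ominus> \<one>" x]
      by (simp add: mdiff_def Z.smult_r_distr l_minus r_minus)
    ultimately have "mdiff R Z (?b \<odot>\<^bsub>Z\<^esub> ?y) (a \<odot>\<^bsub>Z\<^esub> x) \<in> ?T" using T(4)[OF 1 2] by simp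
    then show ?thesis using b y that by (simp add: Y_def qeq)
  qed
  have Y: "left_module quot_ring Y"
    by (rule left_module_hom_image[OF assms quot_ring quot_map_surj _ _ quot_map_hom add smult])
      (simp_all add: Y_def)
  have "q \<in> mod_hom R Z (corner_module R quot_map Y)"
  proof (rule mod_homI)
    show "q x \<in> carrier (corner_module R quot_map Y)" if "x \<in> carrier Z" for x
      using that left_module_corner_carrier[OF ring_axioms Y quot_map_hom] by (simp add: Y_def)
  qed (simp_all add: add smult)
  moreover have "q ` carrier Z = carrier (corner_module R quot_map Y)"
    using left_module_corner_carrier[OF ring_axioms Y quot_map_hom] by (simp add: Y_def)
  moreover have "q z = \<zero>\<^bsub>Y\<^esub> \<longleftrightarrow> z \<in> ?T" if "z \<in> carrier Z" for z
    using qeq[OF that, of "\<zero>\<^bsub>Z\<^esub>"] that by (simp add: Y_def)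
  ultimately have "trace_quotient Z Y q"
    using assms Y by (simp add: trace_quotient_def mod_epi_def)
  then show thesis by (rule that)
qed

lemma trace_quotient_map:
  assumes "trace_quotient Z Y q" "trace_quotient Z' Y' q'" "f \<in> mod_hom R Z Z'"
  obtains t where "t \<in> mod_hom quot_ring Y Y'" "\<And>x. x \<in> carrier Z \<Longrightarrow> t (q x) = q' (f x)"
proof -
  note D = trace_quotientD[OF assms(1)] and D' = trace_quotientD[OF assms(2)]
  have q': "q' \<in> mod_hom R Z' (corner_module R quot_map Y')" by (rule mod_epiD(1)[OF D'(3)])
  have "q' (f x) = \<zero>\<^bsub>corner_module R quot_map Y'\<^esub>"
    if "x \<in> carrier Z" "q x = \<zero>\<^bsub>corner_module R quot_map Y\<^esub>" for x
  proof -
    have "x \<in> carrier (trace_module R e Z)" using that D(6) by simp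
    then have "f x \<in> carrier (trace_module R e Z')"
      by (rule mod_homD(1)[OF mod_hom_trace[OF D(1) D'(1) assms(3) e_closed]])
    then show ?thesis using D'(6)[OF mod_homD(1)[OF assms(3) that(1)]] by simp
  qed
  then obtain t where t: "t \<in> mod_hom R (corner_module R quot_map Y) (corner_module R quot_map Y')"
      "\<And>x. x \<in> carrier Z \<Longrightarrow> t (q x) = q' (f x)"
    using mod_hom_factor[OF D(1) D'(4) D(3) mod_hom_comp[OF assms(3) q'] D(4)] by blast
  show thesis
    by (rule that[OF mod_hom_corner_surj[OF ring_axioms quot_map_hom quot_map_surj D(2) D'(2) t(1)] t(2)])
qed

lemma trace_quotient_epi:
  assumes "trace_quotient Z Y q" "trace_quotient Z' Y' q'" "f \<in> mod_epi R Z Z'"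
    and "t \<in> mod_hom quot_ring Y Y'" "\<And>x. x \<in> carrier Z \<Longrightarrow> t (q x) = q' (f x)"
  shows "t \<in> mod_epi quot_ring Y Y'"
proof (rule mod_epiI[OF assms(4)])
  note D = trace_quotientD[OF assms(1)] and D' = trace_quotientD[OF assms(2)]
  fix y assume "y \<in> carrier Y'"
  then have "y \<in> carrier (corner_module R quot_map Y')" using D'(5) by simp
  then obtain z where z: "z \<in> carrier Z'" "q' z = y" by (rule mod_epiE[OF D'(3)])
  obtain x where x: "x \<in> carrier Z" "f x = z" by (rule mod_epiE[OF assms(3) z(1)])
  then show "\<exists>x\<in>carrier Y. t x = y"
    using assms(5) z D(5) mod_homD(1)[OF mod_epiD(1)[OF D(3)] x(1)] by auto
qed

lemma trace_quotient_relfree: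
  "trace_quotient (relfree R \<one> k) (relfree quot_ring \<one>\<^bsub>quot_ring\<^esub> k) (\<lambda>x i. I +> x i)"
proof -
  interpret B: idempotent quot_ring "\<one>\<^bsub>quot_ring\<^esub>" by (rule idempotent_quot_one)
  let ?Y = "relfree quot_ring \<one>\<^bsub>quot_ring\<^esub> k"
  let ?C = "corner_module R quot_map ?Y"
  have Ymem: "y \<in> carrier ?Y \<longleftrightarrow> (\<forall>i. y i \<in> carrier quot_ring) \<and> (\<forall>i\<ge>k. y i = \<zero>\<^bsub>quot_ring\<^esub>)" for y
    unfolding B.relfree_mem by auto
  have C: "carrier ?C = carrier ?Y"
    by (rule left_module_corner_carrier[OF ring_axioms _ quot_map_hom]) simp
  note h = ring_hom_memE[OF quot_map_hom]
  have z: "I +> \<zero> = \<zero>\<^bsub>quot_ring\<^esub>"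
    using quot_map_zero_iff[of \<zero>] left_idealD(2)[OF left_ideal_I] by (simp add: quot_zero)
  have hom: "(\<lambda>x i. I +> x i) \<in> mod_hom R (relfree R \<one> k) ?C"
  proof (rule mod_homI)
    fix x assume "x \<in> carrier (relfree R \<one> k)"
    then show "(\<lambda>i. I +> x i) \<in> carrier ?C"
      unfolding C Ymem relfree_one_mem using h(1) z by auto
  next
    fix x y assume "x \<in> carrier (relfree R \<one> k)" "y \<in> carrier (relfree R \<one> k)"
    then show "(\<lambda>i. I +> (x \<oplus>\<^bsub>relfree R \<one> k\<^esub> y) i) = (\<lambda>i. I +> x i) \<oplus>\<^bsub>?C\<^esub> (\<lambda>i. I +> y i)"
      unfolding relfree_one_mem using h(3) by (simp add: fun_eq_iff)
  next
    fix a x assume "a \<in> carrier R" "x \<in> carrier (relfree R \<one> k)"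
    then show "(\<lambda>i. I +> (a \<odot>\<^bsub>relfree R \<one> k\<^esub> x) i) = a \<odot>\<^bsub>?C\<^esub> (\<lambda>i. I +> x i)"
      unfolding relfree_one_mem using h(2) by (simp add: fun_eq_iff)
  qed
  have "(\<lambda>x i. I +> x i) \<in> mod_epi R (relfree R \<one> k) ?C"
  proof (rule mod_epiI[OF hom])
    fix y assume "y \<in> carrier ?C"
    then have y: "\<And>i. y i \<in> carrier quot_ring" "\<And>i. i \<ge> k \<Longrightarrow> y i = \<zero>\<^bsub>quot_ring\<^esub>"
      unfolding C Ymem by auto
    have "\<exists>a\<in>carrier R. I +> a = y i" for i using y(1)[of i] quot_map_surj by (metis imageE)
    then obtain x where x: "\<And>i. x i \<in> carrier R" "\<And>i. I +> x i = y i" by metis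
    let ?x = "\<lambda>i. if i < k then x i else \<zero>"
    have "?x \<in> carrier (relfree R \<one> k)" unfolding relfree_one_mem using x(1) by auto
    moreover have "(\<lambda>i. I +> ?x i) = y" using x(2) y(2) z by (auto simp: fun_eq_iff)
    ultimately show "\<exists>x\<in>carrier (relfree R \<one> k). (\<lambda>i. I +> x i) = y"
      by (intro bexI[where x = ?x])
  qed
  moreover have "(\<lambda>i. I +> x i) = \<zero>\<^bsub>?Y\<^esub> \<longleftrightarrow> x \<in> carrier (trace_module R e (relfree R \<one> k))"
    if "x \<in> carrier (relfree R \<one> k)" for x
    using that quot_map_zero_iff unfolding trace_relfree_one tuples_mem[OF left_ideal_I] relfree_one_mem
    by (auto simp: quot_zero fun_eq_iff)
  ultimately show ?thesis
    using left_module_relfree_one by (simp add: trace_quotient_def)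
qed

lemma pd_le_trace_quotient_0:
  assumes "relproj R \<one> Z" "trace_quotient Z Y q"
  shows "relproj quot_ring \<one>\<^bsub>quot_ring\<^esub> Y"
proof -
  note D = trace_quotientD[OF assms(2)]
  obtain k j p where jp: "j \<in> mod_hom R Z (relfree R \<one> k)" "p \<in> mod_hom R (relfree R \<one> k) Z"
      "\<And>x. x \<in> carrier Z \<Longrightarrow> p (j x) = x"
    using assms(1) by (elim relprojE) blast
  obtain j' where j': "j' \<in> mod_hom quot_ring Y (relfree quot_ring \<one>\<^bsub>quot_ring\<^esub> k)"
      "\<And>x. x \<in> carrier Z \<Longrightarrow> j' (q x) = (\<lambda>i. I +> j x i)"
    using trace_quotient_map[OF assms(2) trace_quotient_relfree jp(1)] by blast
  obtain p' where p': "p' \<in> mod_hom quot_ring (relfree quot_ring \<one>\<^bsub>quot_ring\<^esub> k) Y"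
      "\<And>x. x \<in> carrier (relfree R \<one> k) \<Longrightarrow> p' (\<lambda>i. I +> x i) = q (p x)"
    using trace_quotient_map[OF trace_quotient_relfree assms(2) jp(2)] by blast
  show ?thesis
  proof (rule relprojI[OF D(2) j'(1) p'(1)])
    fix y assume "y \<in> carrier Y"
    then have "y \<in> carrier (corner_module R quot_map Y)" using D(5) by simp
    then obtain x where "x \<in> carrier Z" "q x = y" by (rule mod_epiE[OF D(3)])
    then show "p' (j' y) = y"
      using j'(2) p'(2) jp(3) mod_homD(1)[OF jp(1)] by auto
  qed
qed

text \<open>The syzygy of \<open>Z/ReZ\<close> over \<open>R/I\<close> is \<open>Z1/ReZ1\<close>,
  with \<open>Z1\<close> the syzygy of \<open>Z\<close>. Surjectivity of \<open>Z1 -> ?L\<close> is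
  the snake lemma argument for the onto map of traces; its kernel consists of the vectors of
  \<open>Z1\<close> in the trace of the free module, which by \<open>trace_fin_pd_syzygy\<close> is
  the trace of \<open>Z1\<close>.\<close>

lemma pd_le_trace_quotient_step:
  assumes IH: "\<And>(Z :: ('a, nat \<Rightarrow> 'a) module) (Y :: ('a set, nat \<Rightarrow> 'a set) module) q.
      \<lbrakk>trace_fin_pd Z; pd_le R \<one> n Z; trace_quotient Z Y q\<rbrakk> \<Longrightarrow> pd_le quot_ring \<one>\<^bsub>quot_ring\<^esub> n Y"
    and I1: "fin_pd R e (tuples R I 1)"
    and Z: "trace_fin_pd Z" "pd_le R \<one> (Suc n) Z" and Y: "trace_quotient Z Y q"
  shows "pd_le quot_ring \<one>\<^bsub>quot_ring\<^esub> (Suc n) Y"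
proof -
  note D = trace_quotientD[OF Y]
  obtain k f where f: "f \<in> mod_epi R (relfree R \<one> k) Z" "pd_le R \<one> n (kerm (relfree R \<one> k) Z f)"
    using Z(2) by (elim pd_le_SucE) blast
  note fh = mod_epiD(1)[OF f(1)]
  let ?P = "relfree R \<one> k" and ?PB = "relfree quot_ring \<one>\<^bsub>quot_ring\<^esub> k"
  let ?Z1 = "kerm ?P Z f" and ?q = "\<lambda>x i. I +> x i"
  note P = left_module_relfree_one[of k]
  interpret P: left_module R ?P by (rule P)
  note DP = trace_quotientD[OF trace_quotient_relfree[of k]]
  have Z1: "left_module R ?Z1" by (rule left_module_kerm[OF P D(1) fh])
  obtain t where t: "t \<in> mod_hom quot_ring ?PB Y" "\<And>x. x \<in> carrier ?P \<Longrightarrow> t (?q x) = q (f x)"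
    using trace_quotient_map[OF trace_quotient_relfree Y fh] by blast
  have tepi: "t \<in> mod_epi quot_ring ?PB Y"
    by (rule trace_quotient_epi[OF trace_quotient_relfree Y f(1) t(1)]) (rule t(2))
  let ?L = "kerm ?PB Y t"
  have L: "left_module quot_ring ?L" by (rule left_module_kerm[OF DP(2) D(2) t(1)])
  have LC: "carrier (corner_module R quot_map ?L) = carrier ?L"
    by (rule left_module_corner_carrier[OF ring_axioms L quot_map_hom])
  have qL: "?q x \<in> carrier ?L" if "x \<in> carrier ?Z1" for x
  proof -
    have x: "x \<in> carrier ?P" "f x = \<zero>\<^bsub>Z\<^esub>" using that by auto
    have "q \<zero>\<^bsub>Z\<^esub> = \<zero>\<^bsub>Y\<^esub>" using mod_hom_zero[OF D(1,4) mod_epiD(1)[OF D(3)]] by simp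
    then show ?thesis
      using x t(2)[OF x(1)] DP(5) mod_homD(1)[OF mod_epiD(1)[OF DP(3)] x(1)] by auto
  qed
  note qP = mod_epiD(1)[OF DP(3)]
  have hom: "?q \<in> mod_hom R ?Z1 (corner_module R quot_map ?L)"
  proof (rule mod_homI)
    show "?q x \<in> carrier (corner_module R quot_map ?L)" if "x \<in> carrier ?Z1" for x
      using qL[OF that] LC by simp
  qed (use mod_homD(2,3)[OF qP] in simp_all)
  have epi: "?q \<in> mod_epi R ?Z1 (corner_module R quot_map ?L)"
  proof (rule mod_epiI[OF hom])
    fix y assume "y \<in> carrier (corner_module R quot_map ?L)"
    then have y: "y \<in> carrier (corner_module R quot_map ?PB)" "t y = \<zero>\<^bsub>Y\<^esub>"
      using LC DP(5) by auto
    obtain x where x: "x \<in> carrier ?P" "?q x = y" by (rule mod_epiE[OF DP(3) y(1)])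
    \<comment> \<open>\<open>f x\<close> lies in the trace of \<open>Z\<close>, so some
      \<open>w\<close> in the trace of the free module has the same image. Then \<open>x - w\<close>
      lies in the syzygy and has the same residue as \<open>x\<close>.\<close>
    have "f x \<in> carrier (trace_module R e Z)"
      using D(6)[OF mod_homD(1)[OF fh x(1)]] t(2)[OF x(1)] x y by simp
    then obtain w where w: "w \<in> carrier (trace_module R e ?P)" "f w = f x"
      by (rule mod_epiE[OF mod_epi_trace[OF P D(1) f(1)]])
    have wP: "w \<in> carrier ?P" by (rule trace_subset[OF P w(1)])
    have "?q w = \<zero>\<^bsub>corner_module R quot_map ?PB\<^esub>" using DP(6)[OF wP] w(1) by simp
    then have "?q (mdiff R ?P x w) = y"
      using mod_hom_mdiff[OF P qP x(1) wP] x(2) left_module.mdiff_zero_r[OF DP(4) y(1)] by metis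
    moreover have "mdiff R ?P x w \<in> carrier ?Z1"
      using mod_hom_mdiff[OF P fh x(1) wP] w(2) left_module.mdiff_self[OF D(1) mod_homD(1)[OF fh x(1)]]
        P.mdiff_closed[OF x(1) wP] by simp
    ultimately show "\<exists>x\<in>carrier ?Z1. ?q x = y" by blast
  qed
  note syz = trace_fin_pd_syzygy[OF I1 Z(1) f(1)]
  have "trace_quotient ?Z1 ?L ?q"
    unfolding trace_quotient_def
  proof (intro conjI Z1 L epi ballI)
    fix x assume x: "x \<in> carrier ?Z1"
    then have xP: "x \<in> carrier ?P" "f x = \<zero>\<^bsub>Z\<^esub>" by auto
    show "?q x = \<zero>\<^bsub>?L\<^esub> \<longleftrightarrow> x \<in> carrier (trace_module R e ?Z1)"
      using DP(6)[OF xP(1)] xP(2) unfolding syz(2) by simp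
  qed
  then have "pd_le quot_ring \<one>\<^bsub>quot_ring\<^esub> n ?L" by (rule IH[OF syz(1) f(2)])
  then show ?thesis by (rule pd_le_SucI[OF D(2) tepi])
qed

lemma pd_le_trace_quotient:
  assumes "fin_pd R e (tuples R I 1)" "trace_fin_pd Z" "pd_le R \<one> n Z" "trace_quotient Z Y q"
  shows "pd_le quot_ring \<one>\<^bsub>quot_ring\<^esub> n Y"
proof -
  have tup: "pd_le quot_ring \<one>\<^bsub>quot_ring\<^esub> n Y"
    if "trace_fin_pd Z" "pd_le R \<one> n Z" "trace_quotient Z Y q"
    for Z :: "('a, nat \<Rightarrow> 'a) module" and Y :: "('a set, nat \<Rightarrow> 'a set) module" and q n
    using that
  proof (induction n arbitrary: Z Y q)
    case 0
    then show ?case using pd_le_trace_quotient_0 by auto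
  next
    case (Suc n)
    show ?case by (rule pd_le_trace_quotient_step[OF _ assms(1) Suc.prems]) (rule Suc.IH)
  qed
  show ?thesis
  proof (cases n)
    case 0
    then show ?thesis using assms pd_le_trace_quotient_0 by auto
  next
    case (Suc m)
    show ?thesis
      unfolding Suc
      by (rule pd_le_trace_quotient_step[OF _ assms(1,2) assms(3)[unfolded Suc] assms(4)]) (rule tup)
  qed
qed

text \<open>From \<open>0 -> I -> R -> R/I -> 0\<close> the module \<open>R/I\<close> has dimension
  at most \<open>m + 1\<close> over \<open>R\<close>; change of rings adds this to
  \<open>t\<close>.\<close>

lemma pd_le_restrict_quot:
  assumes "pd_le R \<one> m (tuples R I 1)" "pd_le quot_ring \<one>\<^bsub>quot_ring\<^esub> t Y"
  shows "pd_le R \<one> (t + Suc m) (corner_module R quot_map Y)"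
proof -
  interpret One: idempotent R \<one> by (rule idempotent_one)
  note D = trace_quotientD[OF trace_quotient_relfree[of 1]]
  have "pd_le R \<one> (Suc m) (corner_module R quot_map (relfree quot_ring \<one>\<^bsub>quot_ring\<^esub> 1))"
  proof (rule One.pd_le_cokernel[OF left_module_relfree_one D(4,3)])
    show "pd_le R \<one> m (kerm (relfree R \<one> 1)
        (corner_module R quot_map (relfree quot_ring \<one>\<^bsub>quot_ring\<^esub> 1)) (\<lambda>x i. I +> x i))"
      using assms(1) by (simp only: kerm_trace_quotient[OF trace_quotient_relfree] trace_relfree_one)
    show "pd_le R \<one> (Suc m) (relfree R \<one> 1)" by (rule One.pd_le_mono[of 0]) simp_all
  qed
  from corner_map.pd_le_corner[OF corner_map_quot idempotent_one idempotent_quot_one this assms(2)]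
  show ?thesis .
qed

text \<open>The sequence \<open>0 -> ReX -> X -> X/ReX -> 0\<close>. As \<open>e(ReX) = eX\<close>,
  the length of the finite resolution of \<open>ReX\<close> is read off over the corner
  ring.\<close>

lemma pd_le_trace_fin_pd:
  assumes "trace_fin_pd X" "pd_le (corner_ring R e) e s (idem_corner R e X)" "trace_quotient X Y q"
    and "pd_le quot_ring \<one>\<^bsub>quot_ring\<^esub> t Y" "pd_le R \<one> m (tuples R I 1)"
  shows "pd_le R \<one> (max s (t + Suc m)) X"
proof -
  interpret One: idempotent R \<one> by (rule idempotent_one)
  note D = trace_quotientD[OF assms(3)]
  obtain n where "pd_le R e n (trace_module R e X)"
    using assms(1) by (auto simp: trace_fin_pd_def fin_pd_def)
  then have "pd_le R e s (trace_module R e X)"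
    by (rule pd_le_idem_corner_reflect) (use assms(2) idem_corner_trace[OF D(1)] in simp)
  then have T: "pd_le R \<one> s (trace_module R e X)" by (rule pd_le_one)
  have "pd_le R \<one> (max s (t + Suc m)) (kerm X (corner_module R quot_map Y) q)"
    using One.pd_le_mono[OF T] by (simp add: kerm_trace_quotient[OF assms(3)])
  moreover have "pd_le R \<one> (max s (t + Suc m)) (corner_module R quot_map Y)"
    by (rule One.pd_le_mono[OF pd_le_restrict_quot[OF assms(5,4)]]) simp
  ultimately show ?thesis by (rule One.pd_le_ext[OF D(1,4,3)])
qed

end

subsection \<open>Finitely generated modules\<close>

lemma submodule_iff:
  assumes "left_module R M"
  shows "submodule N R M \<longleftrightarrow> left_submodule N R M"
proof -
  interpret M: left_module R M by fact
  show ?thesis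
  proof
    assume N: "submodule N R M"
    interpret N: subgroup N "add_monoid M" by (rule submodule.axioms(1)[OF N])
    show "left_submodule N R M"
      using N.subset N.m_closed N.one_closed submodule.smult_closed[OF N]
      by (intro left_submoduleI) auto
  next
    assume N: "left_submodule N R M"
    note D = left_submoduleD[OF N]
    have "subgroup N (add_monoid M)"
    proof (rule M.add.subgroupI)
      show "\<ominus>\<^bsub>M\<^esub> x \<in> N" if "x \<in> N" for x
        using D(5)[OF _ that, of "\<ominus>\<^bsub>R\<^esub> \<one>\<^bsub>R\<^esub>"] M.smult_minus_one[OF D(1)[OF that]] by simp
    qed (use D in auto)
    then show "submodule N R M"
      using D(5) by (intro submodule.intro submodule_axioms.intro)
  qed
qed

lemma fg_left_module_iff:
  "fg_left_module R M \<longleftrightarrow> left_module R M \<and> (\<exists>k f. f \<in> mod_epi R (relfree R \<one>\<^bsub>R\<^esub> k) M)"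
proof
  assume fg: "fg_left_module R M"
  then have M: "left_module R M" by (simp add: fg_left_module_def)
  interpret M: left_module R M by fact
  interpret One: idempotent R "\<one>\<^bsub>R\<^esub>" by (rule M.R.idempotent_one)
  obtain S where S: "finite S" "S \<subseteq> carrier M"
      "\<And>N. \<lbrakk>left_submodule N R M; S \<subseteq> N\<rbrakk> \<Longrightarrow> N = carrier M"
    using fg submodule_iff[OF M] by (auto simp: fg_left_module_def)
  obtain k :: nat and v where v: "S = v ` {i. i < k}"
    using S(1) unfolding finite_conv_nat_seg_image by blast
  have vc: "v i \<in> carrier M" if "i < k" for i using S(2) v that by auto
  obtain f where f: "f \<in> mod_hom R (relfree R \<one>\<^bsub>R\<^esub> k) M"
      "\<And>i. i < k \<Longrightarrow> f (unit_tuple R \<one>\<^bsub>R\<^esub> i) = v i"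
    using One.relfree_hom_ex[OF M, of k v] vc by auto
  have "f ` carrier (relfree R \<one>\<^bsub>R\<^esub> k) = carrier M"
  proof (rule S(3))
    show "left_submodule (f ` carrier (relfree R \<one>\<^bsub>R\<^esub> k)) R M"
      by (rule left_submodule_image[OF One.left_module_relfree M f(1)
            left_submodule_carrier[OF One.left_module_relfree]])
    show "S \<subseteq> f ` carrier (relfree R \<one>\<^bsub>R\<^esub> k)"
      unfolding v using f(2)[symmetric] One.unit_tuple_mem by blast
  qed
  then show "left_module R M \<and> (\<exists>k f. f \<in> mod_epi R (relfree R \<one>\<^bsub>R\<^esub> k) M)"
    using M f(1) by (auto simp: mod_epi_def)
next
  assume "left_module R M \<and> (\<exists>k f. f \<in> mod_epi R (relfree R \<one>\<^bsub>R\<^esub> k) M)"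
  then obtain k f where M: "left_module R M" and f: "f \<in> mod_epi R (relfree R \<one>\<^bsub>R\<^esub> k) M"
    by blast
  interpret M: left_module R M by fact
  interpret One: idempotent R "\<one>\<^bsub>R\<^esub>" by (rule M.R.idempotent_one)
  note fh = mod_epiD(1)[OF f]
  let ?S = "(\<lambda>i. f (unit_tuple R \<one>\<^bsub>R\<^esub> i)) ` {..<k}"
  have "N = carrier M" if N: "left_submodule N R M" "?S \<subseteq> N" for N
  proof -
    have "{x \<in> carrier (relfree R \<one>\<^bsub>R\<^esub> k). f x \<in> N} = carrier (relfree R \<one>\<^bsub>R\<^esub> k)"
      by (rule One.relfree_generated[OF left_submodule_vimage[OF One.left_module_relfree M fh N(1)]])
        (use N(2) One.unit_tuple_mem in auto)
    then have "carrier M \<subseteq> N" unfolding mod_epiD(2)[OF f, symmetric] by blast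
    then show ?thesis using left_submoduleD(2)[OF N(1)] by blast
  qed
  moreover have "?S \<subseteq> carrier M" using mod_homD(1)[OF fh] One.unit_tuple_mem by auto
  ultimately show "fg_left_module R M"
    unfolding fg_left_module_def using M submodule_iff[OF M] by (intro conjI exI[of _ ?S]) auto
qed

lemma fg_left_moduleD: "fg_left_module R M \<Longrightarrow> left_module R M"
  by (simp add: fg_left_module_def)

lemma fg_left_module_epi:
  assumes "fg_left_module R M" "left_module R N" "f \<in> mod_epi R M N"
  shows "fg_left_module R N"
  using assms mod_epi_comp[OF _ assms(3)] unfolding fg_left_module_iff by blast

lemma bij_mod_epi:
  "\<lbrakk>f \<in> mod_hom R M N; bij_betw f (carrier M) (carrier N)\<rbrakk> \<Longrightarrow> f \<in> mod_epi R M N"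
  by (simp add: mod_epi_def bij_betw_def)

text \<open>The copy sends an element to its fibre under a free cover.\<close>

lemma fg_copy:
  fixes R :: "('r, 'x) ring_scheme" and M :: "('r, 'm) module"
  assumes "fg_left_module R M"
  obtains M' :: "('r, 'r mod_univ) module" and h where "fg_left_module R M'" "h \<in> mod_hom R M M'"
    "bij_betw h (carrier M) (carrier M')"
proof -
  obtain k f where f: "left_module R M" "f \<in> mod_epi R (relfree R \<one>\<^bsub>R\<^esub> k) M"
    using assms unfolding fg_left_module_iff by blast
  let ?h = "\<lambda>x. {z \<in> carrier (relfree R \<one>\<^bsub>R\<^esub> k). f z = x}"
  have "inj_on ?h (carrier M)"
  proof (rule inj_onI)
    fix x y assume "x \<in> carrier M" "?h x = ?h y"
    moreover obtain z where "z \<in> carrier (relfree R \<one>\<^bsub>R\<^esub> k)" "f z = x"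
      by (rule mod_epiE[OF f(2) \<open>x \<in> carrier M\<close>])
    ultimately show "x = y" by blast
  qed
  note t = transport[OF f(1) this]
  show thesis
    by (rule that[OF fg_left_module_epi[OF assms t(1) bij_mod_epi[OF t(2,3)]] t(2,3)])
qed

lemma pd_le_fg:
  assumes "pd_le R \<one>\<^bsub>R\<^esub> n X"
  shows "fg_left_module R X"
proof -
  interpret X: left_module R X by (rule pd_le_left_module) fact
  interpret One: idempotent R "\<one>\<^bsub>R\<^esub>" by (rule X.R.idempotent_one)
  show ?thesis
    using One.pd_le_idem_generated[OF assms] X.left_module_axioms
    unfolding fg_left_module_iff idem_generated_def by blast
qed

text \<open>For the direction from lifting to summand, the lifting property speaks only of modules
  on \<open>mod_univ\<close>. Both \<open>P\<close> and its free cover are therefore copied there,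
  and lifting the copy map of \<open>P\<close> yields a section of the cover.\<close>

lemma fg_projective_iff: "fg_projective R P \<longleftrightarrow> relproj R \<one>\<^bsub>R\<^esub> P"
proof
  assume P: "relproj R \<one>\<^bsub>R\<^esub> P"
  then interpret P: left_module R P by (auto simp: relproj_def)
  interpret One: idempotent R "\<one>\<^bsub>R\<^esub>" by (rule P.R.idempotent_one)
  have lift: "\<exists>g\<in>mod_hom R P M. \<forall>x\<in>carrier P. p (g x) = f x"
    if a: "fg_left_module R M" "fg_left_module R N" "p \<in> mod_hom R M N" "p ` carrier M = carrier N"
      "f \<in> mod_hom R P N" for M N :: "('a, 'a mod_univ) module" and p f
  proof -
    have p: "p \<in> mod_epi R M N" using a by (simp add: mod_epi_def)
    obtain g where "g \<in> mod_hom R P M" "\<And>x. x \<in> carrier P \<Longrightarrow> p (g x) = f x"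
      using One.relproj_lift[OF P fg_left_moduleD[OF a(1)] fg_left_moduleD[OF a(2)] p a(5)]
      by blast
    then show ?thesis by (intro bexI[of _ g] ballI) auto
  qed
  show "fg_projective R P"
    unfolding fg_projective_def
  proof (intro conjI allI impI)
    show "fg_left_module R P" using pd_le_fg[of R 0 P] P by simp
  qed (elim conjE, rule lift)
next
  assume fgP: "fg_projective R P"
  then have P: "fg_left_module R P" by (simp add: fg_projective_def)
  then interpret P: left_module R P by (rule fg_left_moduleD)
  interpret One: idempotent R "\<one>\<^bsub>R\<^esub>" by (rule P.R.idempotent_one)
  obtain k f where f: "f \<in> mod_epi R (relfree R \<one>\<^bsub>R\<^esub> k) P"
    using P unfolding fg_left_module_iff by blast
  let ?F = "relfree R \<one>\<^bsub>R\<^esub> k"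
  have F: "fg_left_module R ?F" using pd_le_fg[of R 0 ?F] by simp
  obtain P' :: "('a, 'a mod_univ) module" and h where h: "fg_left_module R P'" "h \<in> mod_hom R P P'"
      "bij_betw h (carrier P) (carrier P')"
    by (rule fg_copy[OF P])
  obtain F' :: "('a, 'a mod_univ) module" and h' where h': "fg_left_module R F'" "h' \<in> mod_hom R ?F F'"
      "bij_betw h' (carrier ?F) (carrier F')"
    by (rule fg_copy[OF F])
  let ?i = "inv_into (carrier ?F) h'"
  have i: "?i \<in> mod_hom R F' ?F" by (rule inv_into_mod_hom[OF One.left_module_relfree h'(2,3)])
  have ibij: "bij_betw ?i (carrier F') (carrier ?F)" by (rule bij_betw_inv_into[OF h'(3)])
  have "(\<lambda>z. h (f (?i z))) \<in> mod_epi R F' P'"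
    by (rule mod_epi_comp[OF mod_epi_comp[OF bij_mod_epi[OF i ibij] f] bij_mod_epi[OF h(2,3)]])
  then have *: "(\<lambda>z. h (f (?i z))) \<in> mod_hom R F' P' \<and> (\<lambda>z. h (f (?i z))) ` carrier F' = carrier P'"
    by (simp only: mod_epi_def mem_Collect_eq)
  have lift: "fg_left_module R M \<and> fg_left_module R N \<and> p \<in> mod_hom R M N \<and>
      p ` carrier M = carrier N \<and> f \<in> mod_hom R P N \<longrightarrow>
      (\<exists>g\<in>mod_hom R P M. \<forall>x\<in>carrier P. p (g x) = f x)"
    for M N :: "('a, 'a mod_univ) module" and p f
    using fgP unfolding fg_projective_def by (elim conjE allE) assumption
  have "\<exists>g\<in>mod_hom R P F'. \<forall>x\<in>carrier P. h (f (?i (g x))) = h x"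
    by (rule lift[of F' P' "\<lambda>z. h (f (?i z))" h, THEN mp]) (use * h'(1) h(1,2) in simp)
  then obtain g where g: "g \<in> mod_hom R P F'" "\<And>x. x \<in> carrier P \<Longrightarrow> h (f (?i (g x))) = h x"
    by blast
  show "relproj R \<one>\<^bsub>R\<^esub> P"
  proof (rule relprojI[OF P.left_module_axioms mod_hom_comp[OF g(1) i] mod_epiD(1)[OF f]])
    fix x assume x: "x \<in> carrier P"
    have "f (?i (g x)) \<in> carrier P"
      by (rule mod_homD(1)[OF mod_epiD(1)[OF f] mod_homD(1)[OF i mod_homD(1)[OF g(1) x]]])
    then show "f (?i (g x)) = x"
      using g(2)[OF x] x h(3) unfolding bij_betw_def inj_on_def by blast
  qed
qed

subsection \<open>Projective resolutions\<close>

text \<open>A zero module that exists on every type; it pads resolutions beyond their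
  length.\<close>

definition trivial_module :: "('r, 'm) module" where
  "trivial_module = \<lparr>carrier = {undefined}, mult = undefined, one = undefined, zero = undefined,
     add = (\<lambda>_ _. undefined), smult = (\<lambda>_ _. undefined)\<rparr>"

lemma relproj_trivial:
  assumes "ring R"
  shows "relproj R \<one>\<^bsub>R\<^esub> (trivial_module :: ('r, 'm) module)"
proof -
  interpret ring R by fact
  interpret One: idempotent R "\<one>\<^bsub>R\<^esub>" by (rule idempotent_one)
  show ?thesis
  proof (rule relprojI)
    show "left_module R (trivial_module :: ('r, 'm) module)"
      by (rule left_moduleI[OF assms]) (auto simp: trivial_module_def)
    show "(\<lambda>_ _. \<zero>\<^bsub>R\<^esub>) \<in> mod_hom R (trivial_module :: ('r, 'm) module) (relfree R \<one>\<^bsub>R\<^esub> 0)"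
      by (rule mod_homI) (auto simp: One.relfree_mem)
    show "(\<lambda>_. undefined) \<in> mod_hom R (relfree R \<one>\<^bsub>R\<^esub> 0) (trivial_module :: ('r, 'm) module)"
      by (rule mod_homI) (auto simp: trivial_module_def)
  qed (auto simp: trivial_module_def)
qed

lemma a_kernel_eq: "a_kernel M N f = {x \<in> carrier M. f x = \<zero>\<^bsub>N\<^esub>}"
  by (simp add: a_kernel_def')

lemma projective_resolution_iff:
  "projective_resolution R X P d \<epsilon> \<longleftrightarrow>
     (\<forall>n. relproj R \<one>\<^bsub>R\<^esub> (P n)) \<and> (\<forall>n. d n \<in> mod_hom R (P (Suc n)) (P n)) \<and>
     \<epsilon> \<in> mod_epi R (P 0) X \<and>
     {x \<in> carrier (P 0). \<epsilon> x = \<zero>\<^bsub>X\<^esub>} = d 0 ` carrier (P (Suc 0)) \<and>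
     (\<forall>n. {x \<in> carrier (P (Suc n)). d n x = \<zero>\<^bsub>P n\<^esub>} = d (Suc n) ` carrier (P (Suc (Suc n))))"
  unfolding projective_resolution_def a_kernel_eq fg_projective_iff mod_epi_def
  by (simp only: mem_Collect_eq conj_assoc)

lemma projective_resolutionD:
  assumes "projective_resolution R X P d \<epsilon>"
  shows "relproj R \<one>\<^bsub>R\<^esub> (P n)" "d n \<in> mod_hom R (P (Suc n)) (P n)" "\<epsilon> \<in> mod_epi R (P 0) X"
    and "{x \<in> carrier (P 0). \<epsilon> x = \<zero>\<^bsub>X\<^esub>} = d 0 ` carrier (P (Suc 0))"
    and "{x \<in> carrier (P (Suc n)). d n x = \<zero>\<^bsub>P n\<^esub>} = d (Suc n) ` carrier (P (Suc (Suc n)))"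
proof -
  note res = assms[unfolded projective_resolution_iff]
  show "relproj R \<one>\<^bsub>R\<^esub> (P n)" using res by (elim conjE) (erule spec)
  show "d n \<in> mod_hom R (P (Suc n)) (P n)" using res by (elim conjE) (erule_tac x = n in allE)+
  show "\<epsilon> \<in> mod_epi R (P 0) X" using res by (elim conjE)
  show "{x \<in> carrier (P 0). \<epsilon> x = \<zero>\<^bsub>X\<^esub>} = d 0 ` carrier (P (Suc 0))" using res by (elim conjE)
  show "{x \<in> carrier (P (Suc n)). d n x = \<zero>\<^bsub>P n\<^esub>} = d (Suc n) ` carrier (P (Suc (Suc n)))"
    using res by (elim conjE) (erule_tac x = n in allE)+
qed

lemma projective_resolution_trivial:
  assumes "left_module R X" "carrier X = {\<zero>\<^bsub>X\<^esub>}"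
  shows "projective_resolution R X (\<lambda>_. trivial_module) (\<lambda>_ _. undefined) (\<lambda>_. \<zero>\<^bsub>X\<^esub>)"
proof -
  interpret X: left_module R X by fact
  show ?thesis
    unfolding projective_resolution_iff
  proof (intro conjI allI)
    show "relproj R \<one>\<^bsub>R\<^esub> (trivial_module :: ('a, 'a mod_univ) module)"
      by (rule relproj_trivial[OF X.R.ring_axioms])
  qed (auto simp: trivial_module_def mod_epi_def assms(2) intro!: mod_homI)
qed

text \<open>The terms of a resolution must live on \<open>mod_univ\<close>, so \<open>M\<close>
  enters through a copy \<open>h\<close>. The identities for \<open>P'\<close> and \<open>d'\<close>
  are part of the conclusion because dimension shifting moves cocycles between the two
  resolutions.\<close>

lemma projective_resolution_splice:
  fixes R :: "('r, 'x) ring_scheme"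
  assumes "left_module R X" "relproj R \<one>\<^bsub>R\<^esub> M" "p \<in> mod_epi R M X"
    and "projective_resolution R (kerm M X p) P d \<epsilon>"
  obtains P' d' \<epsilon>' h where "projective_resolution R X P' d' \<epsilon>'"
    "\<And>i. P' (Suc i) = P i" "\<And>i. d' (Suc i) = d i" "h \<in> mod_hom R M (P' 0)"
    "bij_betw h (carrier M) (carrier (P' 0))" "\<And>x. x \<in> carrier M \<Longrightarrow> \<epsilon>' (h x) = p x"
    "\<And>x. d' 0 x = h (\<epsilon> x)"
proof -
  have M: "left_module R M" using assms(2) by (auto simp: relproj_def)
  have "fg_left_module R M" using pd_le_fg[of R 0 M] assms(2) by simp
  then obtain M' :: "('r, 'r mod_univ) module" and h where h: "fg_left_module R M'" "h \<in> mod_hom R M M'"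
      "bij_betw h (carrier M) (carrier M')"
    by (rule fg_copy)
  note M' = fg_left_moduleD[OF h(1)]
  let ?i = "inv_into (carrier M) h"
  have i: "?i \<in> mod_hom R M' M" by (rule inv_into_mod_hom[OF M h(2,3)])
  have ih: "?i (h x) = x" if "x \<in> carrier M" for x
    using h(3) that by (simp add: bij_betw_def)
  have hi: "h (?i y) = y" "?i y \<in> carrier M" if "y \<in> carrier M'" for y
    using h(3) that by (auto simp: bij_betw_def f_inv_into_f inv_into_into)
  define P' where "P' = (\<lambda>n. case n of 0 \<Rightarrow> M' | Suc i \<Rightarrow> P i)"
  define d' where "d' = (\<lambda>n. case n of 0 \<Rightarrow> (\<lambda>x. h (\<epsilon> x)) | Suc i \<Rightarrow> d i)"
  let ?e = "\<lambda>y. p (?i y)"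
  note res = assms(4)[unfolded projective_resolution_iff]
  have \<epsilon>: "\<epsilon> \<in> mod_epi R (P 0) (kerm M X p)" using res by blast
  have "relproj R \<one>\<^bsub>R\<^esub> M'" by (rule relproj_retract[OF M' assms(2) i h(2)]) (rule hi)
  then have 1: "relproj R \<one>\<^bsub>R\<^esub> (P' n)" for n using res by (cases n) (auto simp: P'_def)
  have 2: "d' n \<in> mod_hom R (P' (Suc n)) (P' n)" for n
    using res mod_hom_comp[OF mod_hom_comp[OF mod_epiD(1)[OF \<epsilon>] kerm_incl] h(2)]
    by (cases n) (auto simp: P'_def d'_def)
  have 3: "?e \<in> mod_epi R (P' 0) X"
    unfolding P'_def nat.case
    by (rule mod_epi_comp[OF bij_mod_epi[OF i bij_betw_inv_into[OF h(3)]] assms(3)])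
  have 4: "{x \<in> carrier (P' 0). ?e x = \<zero>\<^bsub>X\<^esub>} = d' 0 ` carrier (P' (Suc 0))"
  proof -
    have "d' 0 ` carrier (P' (Suc 0)) = h ` (\<epsilon> ` carrier (P 0))"
      by (simp add: d'_def P'_def image_image)
    also have "\<dots> = h ` {x \<in> carrier M. p x = \<zero>\<^bsub>X\<^esub>}"
      unfolding mod_epiD(2)[OF \<epsilon>] carrier_kerm ..
    also have "\<dots> = {x \<in> carrier M'. ?e x = \<zero>\<^bsub>X\<^esub>}"
    proof (intro Set.set_eqI iffI)
      fix y assume "y \<in> {x \<in> carrier M'. ?e x = \<zero>\<^bsub>X\<^esub>}"
      then show "y \<in> h ` {x \<in> carrier M. p x = \<zero>\<^bsub>X\<^esub>}"
        using hi[of y] by (intro image_eqI[of y h "?i y"]) auto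
    qed (use mod_homD(1)[OF h(2)] ih in auto)
    finally show ?thesis by (simp add: P'_def)
  qed
  have 5: "{x \<in> carrier (P' (Suc n)). d' n x = \<zero>\<^bsub>P' n\<^esub>} = d' (Suc n) ` carrier (P' (Suc (Suc n)))" for n
  proof (cases n)
    case 0
    have "h y = \<zero>\<^bsub>M'\<^esub> \<longleftrightarrow> y = \<zero>\<^bsub>M\<^esub>" if "y \<in> carrier M" for y
      using mod_hom_zero[OF M M' h(2)] mod_hom_zero[OF M' M i] ih[OF that] by metis
    moreover have "\<epsilon> x \<in> carrier M" if "x \<in> carrier (P 0)" for x
      using mod_homD(1)[OF mod_epiD(1)[OF \<epsilon>] that] by simp
    ultimately have "{x \<in> carrier (P 0). h (\<epsilon> x) = \<zero>\<^bsub>M'\<^esub>} = {x \<in> carrier (P 0). \<epsilon> x = \<zero>\<^bsub>kerm M X p\<^esub>}"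
      by auto
    also have "\<dots> = d 0 ` carrier (P (Suc 0))" using res by blast
    finally show ?thesis by (simp add: 0 P'_def d'_def)
  next
    case (Suc m)
    then show ?thesis using res by (simp add: P'_def d'_def)
  qed
  show thesis
  proof (rule that[of P' d' ?e h])
    show "projective_resolution R X P' d' ?e"
      unfolding projective_resolution_iff using 1 2 3 4 5 by blast
  qed (use h ih in \<open>auto simp: P'_def d'_def\<close>)
qed

lemma kerm_id_trivial:
  assumes "left_module R X"
  shows "carrier (kerm X X (\<lambda>x. x)) = {\<zero>\<^bsub>kerm X X (\<lambda>x. x)\<^esub>}"
proof -
  interpret X: left_module R X by fact
  show ?thesis by auto
qed

lemma pd_le_resolution_step:
  assumes "left_module R X" "relproj R \<one>\<^bsub>R\<^esub> M" "p \<in> mod_epi R M X"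
    and "projective_resolution R (kerm M X p) P d \<epsilon>" "\<forall>i\<ge>n. carrier (P i) = {\<zero>\<^bsub>P i\<^esub>}"
  shows "\<exists>P d \<epsilon>. projective_resolution R X P d \<epsilon> \<and> (\<forall>i>n. carrier (P i) = {\<zero>\<^bsub>P i\<^esub>})"
proof -
  obtain P' d' \<epsilon>' h where *: "projective_resolution R X P' d' \<epsilon>'" "\<And>i. P' (Suc i) = P i"
    "\<And>i. d' (Suc i) = d i" "h \<in> mod_hom R M (P' 0)"
    "bij_betw h (carrier M) (carrier (P' 0))" "\<And>x. x \<in> carrier M \<Longrightarrow> \<epsilon>' (h x) = p x"
    "\<And>x. d' 0 x = h (\<epsilon> x)"
    by (rule projective_resolution_splice[OF assms(1-4)]) (rule that)
  have "carrier (P' i) = {\<zero>\<^bsub>P' i\<^esub>}" if "i > n" for i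
    using that assms(5) *(2) by (cases i) auto
  then show ?thesis using *(1) by blast
qed

lemma pd_le_resolution:
  assumes "pd_le R \<one>\<^bsub>R\<^esub> n X"
  shows "\<exists>P d \<epsilon>. projective_resolution R X P d \<epsilon> \<and> (\<forall>i>n. carrier (P i) = {\<zero>\<^bsub>P i\<^esub>})"
proof -
  have 0: "\<exists>P d \<epsilon>. projective_resolution R X P d \<epsilon> \<and> (\<forall>i>0. carrier (P i) = {\<zero>\<^bsub>P i\<^esub>})"
    if X: "relproj R \<one>\<^bsub>R\<^esub> X" for X :: "('a, 'm) module"
  proof -
    have Xm: "left_module R X" using X by (auto simp: relproj_def)
    \<comment> \<open>A projective module resolves itself: the identity is the cover and its kernel
      is zero.\<close>
    have epi: "(\<lambda>x. x) \<in> mod_epi R X X" by (rule mod_epiI[OF mod_hom_id]) auto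
    show ?thesis
      by (rule pd_le_resolution_step[OF Xm X epi projective_resolution_trivial[OF
              left_module_kerm[OF Xm Xm mod_hom_id] kerm_id_trivial[OF Xm]]])
        (simp add: trivial_module_def)
  qed
  have step: "\<exists>P d \<epsilon>. projective_resolution R X P d \<epsilon> \<and> (\<forall>i>Suc n. carrier (P i) = {\<zero>\<^bsub>P i\<^esub>})"
    if X: "left_module R X" "f \<in> mod_epi R (relfree R \<one>\<^bsub>R\<^esub> k) X"
      and ex: "\<exists>P d \<epsilon>. projective_resolution R (kerm (relfree R \<one>\<^bsub>R\<^esub> k) X f) P d \<epsilon> \<and>
        (\<forall>i>n. carrier (P i) = {\<zero>\<^bsub>P i\<^esub>})"
    for X :: "('a, 'm) module" and f k n
  proof -
    interpret X: left_module R X by fact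
    interpret One: idempotent R "\<one>\<^bsub>R\<^esub>" by (rule X.R.idempotent_one)
    obtain P d \<epsilon> where P: "projective_resolution R (kerm (relfree R \<one>\<^bsub>R\<^esub> k) X f) P d \<epsilon>"
      "\<forall>i\<ge>Suc n. carrier (P i) = {\<zero>\<^bsub>P i\<^esub>}"
      using ex by (auto simp: Suc_le_eq)
    show ?thesis by (rule pd_le_resolution_step[OF X(1) One.relproj_relfree X(2) P])
  qed
  have tup: "\<exists>P d \<epsilon>. projective_resolution R X P d \<epsilon> \<and> (\<forall>i>n. carrier (P i) = {\<zero>\<^bsub>P i\<^esub>})"
    if "pd_le R \<one>\<^bsub>R\<^esub> n X" for X :: "('a, nat \<Rightarrow> 'a) module" and n
    using that
  proof (induction n arbitrary: X)
    case base: 0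
    then show ?case using 0[of X] by simp
  next
    case (Suc n)
    then obtain k f where f: "left_module R X" "f \<in> mod_epi R (relfree R \<one>\<^bsub>R\<^esub> k) X"
      "pd_le R \<one>\<^bsub>R\<^esub> n (kerm (relfree R \<one>\<^bsub>R\<^esub> k) X f)" by (elim pd_le_SucE) blast
    show ?case by (rule step[OF f(1,2) Suc.IH[OF f(3)]])
  qed
  show ?thesis
  proof (cases n)
    case base: 0
    then show ?thesis using 0[of X] assms by simp
  next
    case (Suc m)
    then obtain k f where f: "left_module R X" "f \<in> mod_epi R (relfree R \<one>\<^bsub>R\<^esub> k) X"
      "pd_le R \<one>\<^bsub>R\<^esub> m (kerm (relfree R \<one>\<^bsub>R\<^esub> k) X f)" using assms unfolding Suc by (elim pd_le_SucE) blast
    show ?thesis unfolding Suc by (rule step[OF f(1,2) tup[OF f(3)]])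
  qed
qed

text \<open>Removing the first term leaves a resolution of the kernel of \<open>\<epsilon>\<close>.
  When only \<open>P 0\<close> is nonzero, the image of \<open>d 0\<close> is zero and
  \<open>\<epsilon>\<close> is an isomorphism.\<close>

lemma resolution_pd_le:
  assumes "left_module R X" "projective_resolution R X P d \<epsilon>" "\<forall>i>n. carrier (P i) = {\<zero>\<^bsub>P i\<^esub>}"
  shows "pd_le R \<one>\<^bsub>R\<^esub> n X"
proof -
  interpret X: left_module R X by fact
  interpret One: idempotent R "\<one>\<^bsub>R\<^esub>" by (rule X.R.idempotent_one)
  have 0: "pd_le R \<one>\<^bsub>R\<^esub> 0 X"
    if X: "left_module R X" "projective_resolution R X P d \<epsilon>" "carrier (P 1) = {\<zero>\<^bsub>P 1\<^esub>}"
    for X :: "('a, 'm) module" and P d \<epsilon>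
  proof -
    note res = projective_resolutionD[OF X(2)]
    have rp: "relproj R \<one>\<^bsub>R\<^esub> (P n)" for n by (rule res(1))
    have P: "left_module R (P n)" for n using rp[of n] by (simp add: relproj_def)
    note \<epsilon> = res(3)
    have "d 0 \<zero>\<^bsub>P 1\<^esub> = \<zero>\<^bsub>P 0\<^esub>" using mod_hom_zero[OF P P res(2)[of 0]] by simp
    then have "{x \<in> carrier (P 0). \<epsilon> x = \<zero>\<^bsub>X\<^esub>} = {\<zero>\<^bsub>P 0\<^esub>}" using res(4) X(3) by simp
    then have "inj_on \<epsilon> (carrier (P 0))"
      by (intro mod_hom_inj_on[OF P X(1) mod_epiD(1)[OF \<epsilon>]]) blast
    then have "bij_betw \<epsilon> (carrier (P 0)) (carrier X)"
      using mod_epiD(2)[OF \<epsilon>] by (simp add: bij_betw_def)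
    then show ?thesis
      using pd_le_iso[OF X(1) mod_epiD(1)[OF \<epsilon>], of "\<one>\<^bsub>R\<^esub>" 0] rp[of 0] by simp
  qed
  have shift: "projective_resolution R (kerm (P 0) X \<epsilon>) (\<lambda>i. P (Suc i)) (\<lambda>i. d (Suc i)) (d 0)"
    and cok: "pd_le R \<one>\<^bsub>R\<^esub> n (kerm (P 0) X \<epsilon>) \<Longrightarrow> pd_le R \<one>\<^bsub>R\<^esub> (Suc n) X"
    and ker: "left_module R (kerm (P 0) X \<epsilon>)"
    if X: "left_module R X" "projective_resolution R X P d \<epsilon>"
    for X :: "('a, 'm) module" and P d \<epsilon> n
  proof -
    note res = projective_resolutionD[OF X(2)]
    have rp: "relproj R \<one>\<^bsub>R\<^esub> (P n)" for n by (rule res(1))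
    have P: "left_module R (P n)" for n using rp[of n] by (simp add: relproj_def)
    note \<epsilon> = res(3)
    note d0 = res(2)[of 0]
    have im: "d 0 ` carrier (P (Suc 0)) = carrier (kerm (P 0) X \<epsilon>)"
      using res(4) by (simp add: carrier_kerm)
    show K: "left_module R (kerm (P 0) X \<epsilon>)"
      by (rule left_module_kerm[OF P X(1) mod_epiD(1)[OF \<epsilon>]])
    have "d 0 \<in> mod_hom R (P (Suc 0)) (kerm (P 0) X \<epsilon>)"
      by (rule mod_homI) (use mod_homD(2,3)[OF d0] im in auto)
    then show "projective_resolution R (kerm (P 0) X \<epsilon>) (\<lambda>i. P (Suc i)) (\<lambda>i. d (Suc i)) (d 0)"
      unfolding projective_resolution_iff mod_epi_def using res(1,2,5) im by simp
    show "pd_le R \<one>\<^bsub>R\<^esub> n (kerm (P 0) X \<epsilon>) \<Longrightarrow> pd_le R \<one>\<^bsub>R\<^esub> (Suc n) X"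
      by (rule One.pd_le_cokernel[OF P X(1) \<epsilon>]) (use One.pd_le_mono[of 0] rp in auto)
  qed
  have tup: "pd_le R \<one>\<^bsub>R\<^esub> n X"
    if "left_module R X" "projective_resolution R X P d \<epsilon>" "\<forall>i>n. carrier (P i) = {\<zero>\<^bsub>P i\<^esub>}"
    for X :: "('a, 'a mod_univ) module" and P d \<epsilon> n
    using that
  proof (induction n arbitrary: X P d \<epsilon>)
    case base: 0
    show ?case by (rule 0[OF base(1,2)]) (use base(3) in simp)
  next
    case (Suc n)
    show ?case
      by (rule cok[OF Suc.prems(1,2)], rule Suc.IH[OF ker[OF Suc.prems(1,2)] shift[OF Suc.prems(1,2)]])
        (use Suc.prems(3) in simp)
  qed
  show ?thesis
  proof (cases n)
    case base: 0
    show ?thesis unfolding base by (rule 0[OF assms(1,2)]) (use assms(3) base in simp)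
  next
    case (Suc m)
    show ?thesis
      unfolding Suc
      by (rule cok[OF assms(1,2)], rule tup[OF ker[OF assms(1,2)] shift[OF assms(1,2)]])
        (use assms(3) Suc in simp)
  qed
qed

lemma proj_dim_le_iff:
  assumes "left_module R X"
  shows "proj_dim R X \<le> enat n \<longleftrightarrow> pd_le R \<one>\<^bsub>R\<^esub> n X"
proof -
  interpret X: left_module R X by fact
  interpret One: idempotent R "\<one>\<^bsub>R\<^esub>" by (rule X.R.idempotent_one)
  let ?A = "{enat n | n. \<exists>P d \<epsilon>. projective_resolution R X P d \<epsilon> \<and>
                       (\<forall>i>n. carrier (P i) = {\<zero>\<^bsub>P i\<^esub>})}"
  have A: "?A = {enat n | n. pd_le R \<one>\<^bsub>R\<^esub> n X}"
  proof -
    have "(\<exists>P d \<epsilon>. projective_resolution R X P d \<epsilon> \<and> (\<forall>i>n. carrier (P i) = {\<zero>\<^bsub>P i\<^esub>})) \<longleftrightarrow>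
        pd_le R \<one>\<^bsub>R\<^esub> n X" for n
      by (rule iffI, elim exE conjE, erule (1) resolution_pd_le[OF assms], erule pd_le_resolution)
    then show ?thesis by (simp only:)
  qed
  have eq: "proj_dim R X = Inf {enat n | n. pd_le R \<one>\<^bsub>R\<^esub> n X}"
    unfolding proj_dim_def A ..
  show ?thesis
  proof
    assume le: "proj_dim R X \<le> enat n"
    \<comment> \<open>The infimum of the empty set is infinite, so the set is nonempty and its
      infimum is attained.\<close>
    have "{enat n | n. pd_le R \<one>\<^bsub>R\<^esub> n X} \<noteq> {}"
    proof
      assume "{enat n | n. pd_le R \<one>\<^bsub>R\<^esub> n X} = {}"
      then have "proj_dim R X = \<infinity>" unfolding eq by (simp only: Inf_enat_def) simp
      then show False using le by simp
    qed
    then obtain a where "a \<in> {enat n | n. pd_le R \<one>\<^bsub>R\<^esub> n X}" by blast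
    then have "proj_dim R X \<in> {enat n | n. pd_le R \<one>\<^bsub>R\<^esub> n X}"
      unfolding eq by (rule wellorder_InfI)
    then obtain m where "proj_dim R X = enat m" "pd_le R \<one>\<^bsub>R\<^esub> m X" by blast
    then show "pd_le R \<one>\<^bsub>R\<^esub> n X" using le One.pd_le_mono by simp
  next
    assume "pd_le R \<one>\<^bsub>R\<^esub> n X"
    then show "proj_dim R X \<le> enat n" unfolding eq by (intro Inf_lower) blast
  qed
qed

text \<open>The supremum in \<open>fin_dim\<close> ranges over modules on one type; copying extends
  its use to modules of any type, finite generation being implied by the finite resolution.\<close>

lemma fin_dim_pd_le:
  assumes "pd_le R \<one>\<^bsub>R\<^esub> n X" "fin_dim R = enat s"
  shows "pd_le R \<one>\<^bsub>R\<^esub> s X"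
proof -
  note X = pd_le_left_module[OF assms(1)]
  obtain X' :: "('a, 'a mod_univ) module" and h where h: "fg_left_module R X'" "h \<in> mod_hom R X X'"
      "bij_betw h (carrier X) (carrier X')"
    by (rule fg_copy[OF pd_le_fg[OF assms(1)]])
  note X' = fg_left_moduleD[OF h(1)]
  have "pd_le R \<one>\<^bsub>R\<^esub> n X'" by (rule pd_le_iso[OF X' h(2,3) assms(1)])
  then have "proj_dim R X' \<le> enat n" using proj_dim_le_iff[OF X'] by blast
  then have "proj_dim R X' < \<infinity>" by (rule order.strict_trans1) simp
  then have "proj_dim R X' \<le> fin_dim R"
    unfolding fin_dim_def using h(1) by (intro Sup_upper) blast
  then have "pd_le R \<one>\<^bsub>R\<^esub> s X'" using proj_dim_le_iff[OF X'] assms(2) by simp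
  then show ?thesis
    by (rule pd_le_iso[OF X inv_into_mod_hom[OF X h(2,3)] bij_betw_inv_into[OF h(3)]])
qed

subsection \<open>Vanishing of Ext over a strongly idempotent ideal\<close>

context idempotent
begin

text \<open>\<open>e\<close> acts as zero on a module over \<open>R/I\<close>, so \<open>eM\<close>
  lies in the kernel of \<open>f\<close>, and with it the submodule generated by
  \<open>eM\<close>.\<close>

lemma hom_trace_quot_zero:
  assumes "left_module R M" "left_module quot_ring Y" "f \<in> mod_hom R M (corner_module R quot_map Y)"
    and "x \<in> carrier (trace_module R e M)"
  shows "f x = \<zero>\<^bsub>Y\<^esub>"
proof -
  let ?C = "corner_module R quot_map Y"
  interpret Y: left_module quot_ring Y by fact
  have C: "left_module R ?C" by (rule corner_map.left_module_corner[OF corner_map_quot assms(2)])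
  have c: "carrier ?C = carrier Y" by (rule left_module_corner_carrier[OF ring_axioms assms(2) quot_map_hom])
  have "carrier (trace_module R e M) \<subseteq> {x \<in> carrier M. f x = \<zero>\<^bsub>?C\<^esub>}"
  proof (rule trace_least[OF assms(1) left_submodule_ker[OF assms(1) C assms(3)]])
    fix x assume x: "x \<in> carrier M" "e \<odot>\<^bsub>M\<^esub> x = x"
    have fx: "f x \<in> carrier Y" using mod_homD(1)[OF assms(3) x(1)] c by simp
    have "I +> e = \<zero>\<^bsub>quot_ring\<^esub>" using quot_map_zero_iff[of e] e_in_I by (simp add: quot_zero)
    then have "f (e \<odot>\<^bsub>M\<^esub> x) = \<zero>\<^bsub>Y\<^esub>"
      using mod_homD(3)[OF assms(3) e_closed x(1)] fx by simp
    then show "x \<in> {x \<in> carrier M. f x = \<zero>\<^bsub>?C\<^esub>}" using x by simp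
  qed
  then show ?thesis using assms(4) by auto
qed

text \<open>
  Vanishing of \<open>Ext\<^sup>i(W, Y)\<close> for all modules \<open>Y\<close> over the quotient ring, stated on cocycles.
\<close>

definition ext_vanishes :: "nat \<Rightarrow> ('a, 'm) module \<Rightarrow> bool" where
  "ext_vanishes i W \<longleftrightarrow> (\<forall>P d \<epsilon> (Y :: ('a set, 'a set mod_univ) module) g.
     projective_resolution R W P d \<epsilon> \<and> fg_left_module quot_ring Y \<and>
     g \<in> mod_hom R (P i) (corner_module R quot_map Y) \<and>
     (\<forall>x\<in>carrier (P (Suc i)). g (d i x) = \<zero>\<^bsub>Y\<^esub>) \<longrightarrow>
     (case i of 0 \<Rightarrow> \<forall>x\<in>carrier (P 0). g x = \<zero>\<^bsub>Y\<^esub>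
      | Suc j \<Rightarrow> \<exists>h\<in>mod_hom R (P j) (corner_module R quot_map Y).
          \<forall>x\<in>carrier (P (Suc j)). g x = h (d j x)))"

lemma ext_vanishes_0D:
  fixes Y :: "('a set, 'a set mod_univ) module"
  assumes "ext_vanishes 0 W" "projective_resolution R W P d \<epsilon>" "fg_left_module quot_ring Y"
    "g \<in> mod_hom R (P 0) (corner_module R quot_map Y)"
    "\<And>x. x \<in> carrier (P (Suc 0)) \<Longrightarrow> g (d 0 x) = \<zero>\<^bsub>Y\<^esub>" "x \<in> carrier (P 0)"
  shows "g x = \<zero>\<^bsub>Y\<^esub>"
proof -
  have "\<forall>x\<in>carrier (P 0). g x = \<zero>\<^bsub>Y\<^esub>"
    using assms(1)[unfolded ext_vanishes_def, rule_format, of P d \<epsilon> Y g] assms(2-5) by simp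
  then show ?thesis using assms(6) by blast
qed

lemma ext_vanishes_SucD:
  fixes Y :: "('a set, 'a set mod_univ) module"
  assumes "ext_vanishes (Suc j) W" "projective_resolution R W P d \<epsilon>" "fg_left_module quot_ring Y"
    "g \<in> mod_hom R (P (Suc j)) (corner_module R quot_map Y)"
    "\<And>x. x \<in> carrier (P (Suc (Suc j))) \<Longrightarrow> g (d (Suc j) x) = \<zero>\<^bsub>Y\<^esub>"
  shows "\<exists>h\<in>mod_hom R (P j) (corner_module R quot_map Y). \<forall>x\<in>carrier (P (Suc j)). g x = h (d j x)"
  using assms(1)[unfolded ext_vanishes_def, rule_format, of P d \<epsilon> Y g] assms(2-5) by simp

text \<open>Dimension shift. Splicing with \<open>C\<close> makes a cocycle in degree
  \<open>i\<close> on the kernel one in degree \<open>i + 1\<close> on \<open>W\<close>, hence a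
  coboundary. For \<open>i = 0\<close> the coboundary comes from a map on \<open>C\<close>, which is
  zero because \<open>C\<close> is generated by \<open>eC\<close>.\<close>

lemma ext_vanishes_syzygy:
  assumes "\<And>i. ext_vanishes i W" "left_module R W" "relproj R \<one> C" "idem_generated R e C"
    and "p \<in> mod_epi R C W"
  shows "ext_vanishes i (kerm C W p)"
  unfolding ext_vanishes_def
proof (intro allI impI, elim conjE)
  fix P d \<epsilon> and Y :: "('a set, 'a set mod_univ) module" and g
  assume P: "projective_resolution R (kerm C W p) P d \<epsilon>" and Y: "fg_left_module quot_ring Y"
    and g: "g \<in> mod_hom R (P i) (corner_module R quot_map Y)"
    and gd: "\<forall>x\<in>carrier (P (Suc i)). g (d i x) = \<zero>\<^bsub>Y\<^esub>"
  have C: "left_module R C" using assms(3) by (auto simp: relproj_def)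
  obtain P' d' \<epsilon>' h where P': "projective_resolution R W P' d' \<epsilon>'" "\<And>i. P' (Suc i) = P i"
    "\<And>i. d' (Suc i) = d i" "h \<in> mod_hom R C (P' 0)"
    "bij_betw h (carrier C) (carrier (P' 0))" "\<And>x. x \<in> carrier C \<Longrightarrow> \<epsilon>' (h x) = p x"
    "\<And>x. d' 0 x = h (\<epsilon> x)"
    by (rule projective_resolution_splice[OF assms(2,3,5) P]) (rule that)
  obtain t where t: "t \<in> mod_hom R (P' i) (corner_module R quot_map Y)"
      "\<forall>x\<in>carrier (P' (Suc i)). g x = t (d' i x)"
    using ext_vanishes_SucD[OF assms(1) P'(1) Y, of g i] g gd P'(2,3) by auto
  show "case i of 0 \<Rightarrow> \<forall>x\<in>carrier (P 0). g x = \<zero>\<^bsub>Y\<^esub>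
      | Suc j \<Rightarrow> \<exists>h\<in>mod_hom R (P j) (corner_module R quot_map Y).
          \<forall>x\<in>carrier (P (Suc j)). g x = h (d j x)"
  proof (cases i)
    case 0
    have th: "(\<lambda>x. t (h x)) \<in> mod_hom R C (corner_module R quot_map Y)"
      using mod_hom_comp[OF P'(4)] t(1) 0 by simp
    have "g x = \<zero>\<^bsub>Y\<^esub>" if x: "x \<in> carrier (P 0)" for x
    proof -
      have "\<epsilon> x \<in> carrier (kerm C W p)"
        by (rule mod_homD(1)[OF mod_epiD(1)[OF projective_resolutionD(3)[OF P]] x])
      then have "\<epsilon> x \<in> carrier (trace_module R e C)" using idem_generated_trace[OF assms(4)] by simp
      then have "t (h (\<epsilon> x)) = \<zero>\<^bsub>Y\<^esub>" by (rule hom_trace_quot_zero[OF C fg_left_moduleD[OF Y] th])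
      then show ?thesis using t(2) x 0 P'(2,7) by simp
    qed
    then show ?thesis by (simp add: 0)
  next
    case (Suc j)
    then show ?thesis using t P'(2,3) by auto
  qed
qed

lemma image_submodule_join:
  assumes "left_module R W" "f \<in> mod_hom R (relfree R e k) W" "f' \<in> mod_hom R (relfree R e l) W"
  obtains F where "F \<in> mod_hom R (relfree R e (k + l)) W"
    "\<And>x y. \<lbrakk>x \<in> carrier (relfree R e k); y \<in> carrier (relfree R e l)\<rbrakk> \<Longrightarrow>
      f x \<oplus>\<^bsub>W\<^esub> f' y \<in> F ` carrier (relfree R e (k + l))"
proof (rule that)
  let ?F = "\<lambda>z. f (lower R k z) \<oplus>\<^bsub>W\<^esub> f' (upper k z)"
  show "?F \<in> mod_hom R (relfree R e (k + l)) W"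
    by (rule mod_hom_sum[OF assms(1) mod_hom_comp[OF relfree_lower assms(2)]
          mod_hom_comp[OF relfree_upper assms(3)]])
  fix x y assume xy: "x \<in> carrier (relfree R e k)" "y \<in> carrier (relfree R e l)"
  have 1: "lower R k (join k x y) = x" and 2: "join k x y \<in> carrier (relfree R e (k + l))"
    using xy lower_join[OF left_ideal_idem] join_mem[OF left_ideal_idem] by (simp_all add: relfree_def)
  have "?F (join k x y) = f x \<oplus>\<^bsub>W\<^esub> f' y" unfolding 1 upper_join ..
  from image_eqI[where f = ?F, OF this[symmetric] 2]
  show "f x \<oplus>\<^bsub>W\<^esub> f' y \<in> ?F ` carrier (relfree R e (k + l))" .
qed

text \<open>The images of powers of \<open>Re\<close> in \<open>W\<close> have a union that is a
  submodule containing \<open>eW\<close>, hence equals \<open>W\<close>. Any two images lie in a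
  third, so one image contains all of the finitely many generators.\<close>

lemma idem_generatedI:
  assumes "fg_left_module R W" "carrier (trace_module R e W) = carrier W"
  shows "idem_generated R e W"
proof -
  note W = fg_left_moduleD[OF assms(1)]
  interpret W: left_module R W by (rule W)
  interpret One: idempotent R \<one> by (rule idempotent_one)
  let ?U = "{x. \<exists>k f. f \<in> mod_hom R (relfree R e k) W \<and> x \<in> f ` carrier (relfree R e k)}"
  have "carrier (trace_module R e W) \<subseteq> ?U"
  proof (rule trace_least[OF W left_submoduleI])
    show "?U \<subseteq> carrier W" by clarify (erule (1) mod_homD(1))
    have "\<zero>\<^bsub>W\<^esub> \<in> (\<lambda>_. \<zero>\<^bsub>W\<^esub>) ` carrier (relfree R e 0)"
      by (rule image_eqI[of _ _ "\<lambda>_. \<zero>"]) (auto simp: relfree_mem)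
    then show "\<zero>\<^bsub>W\<^esub> \<in> ?U" using mod_hom_const_zero[OF W, of "relfree R e 0"] by blast
    show "x \<oplus>\<^bsub>W\<^esub> y \<in> ?U" if xy: "x \<in> ?U" "y \<in> ?U" for x y
    proof -
      obtain k f u where f: "f \<in> mod_hom R (relfree R e k) W" "u \<in> carrier (relfree R e k)" "x = f u"
        using xy(1) by blast
      obtain l f' v where f': "f' \<in> mod_hom R (relfree R e l) W" "v \<in> carrier (relfree R e l)" "y = f' v"
        using xy(2) by blast
      obtain F where "F \<in> mod_hom R (relfree R e (k + l)) W"
        "x \<oplus>\<^bsub>W\<^esub> y \<in> F ` carrier (relfree R e (k + l))"
        using image_submodule_join[OF W f(1) f'(1)] f(2,3) f'(2,3) by metis
      then show ?thesis by blast
    qed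
    show "a \<odot>\<^bsub>W\<^esub> x \<in> ?U" if ax: "a \<in> carrier R" "x \<in> ?U" for a x
    proof -
      obtain k f u where f: "f \<in> mod_hom R (relfree R e k) W" "u \<in> carrier (relfree R e k)" "x = f u"
        using ax(2) by blast
      have "a \<odot>\<^bsub>relfree R e k\<^esub> u \<in> carrier (relfree R e k)"
        by (rule left_module.smult_closed[OF left_module_relfree ax(1) f(2)])
      then have "a \<odot>\<^bsub>W\<^esub> x \<in> f ` carrier (relfree R e k)"
        using mod_homD(3)[OF f(1) ax(1) f(2)] f(3) by (metis imageI)
      then show ?thesis using f(1) by blast
    qed
    show "x \<in> ?U" if x: "x \<in> carrier W" "e \<odot>\<^bsub>W\<^esub> x = x" for x
    proof -
      obtain f where f: "f \<in> mod_hom R (relfree R e 1) W" "f (unit_tuple R e 0) = x"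
        using relfree_hom_ex[OF W, of 1 "\<lambda>_. x"] x by auto
      have "x \<in> f ` carrier (relfree R e 1)"
        using f(2) unit_tuple_mem[of 0 1] by (metis imageI zero_less_one)
      then show ?thesis using f(1) by blast
    qed
  qed
  then have U: "\<exists>k f. f \<in> mod_hom R (relfree R e k) W \<and> x \<in> f ` carrier (relfree R e k)"
    if "x \<in> carrier W" for x
    using that assms(2) by blast
  obtain n g where g: "g \<in> mod_epi R (relfree R \<one> n) W"
    using assms(1) unfolding fg_left_module_iff by blast
  note gh = mod_epiD(1)[OF g]
  have "\<exists>k f. f \<in> mod_hom R (relfree R e k) W \<and>
      (\<forall>i<j. g (unit_tuple R \<one> i) \<in> f ` carrier (relfree R e k))" if "j \<le> n" for j
    using that
  proof (induction j)
    case 0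
    then show ?case using mod_hom_const_zero[OF W, of "relfree R e 0"] by blast
  next
    case (Suc j)
    then obtain k f where f: "f \<in> mod_hom R (relfree R e k) W"
      "\<And>i. i < j \<Longrightarrow> g (unit_tuple R \<one> i) \<in> f ` carrier (relfree R e k)"
      by auto
    have gj: "g (unit_tuple R \<one> i) \<in> carrier W" if "i < n" for i
      by (rule mod_homD(1)[OF gh One.unit_tuple_mem[OF that]])
    then obtain l f' where f': "f' \<in> mod_hom R (relfree R e l) W"
      "g (unit_tuple R \<one> j) \<in> f' ` carrier (relfree R e l)"
      using U[OF gj[of j]] Suc.prems by auto
    obtain F where F: "F \<in> mod_hom R (relfree R e (k + l)) W"
        "\<And>x y. \<lbrakk>x \<in> carrier (relfree R e k); y \<in> carrier (relfree R e l)\<rbrakk> \<Longrightarrow>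
          f x \<oplus>\<^bsub>W\<^esub> f' y \<in> F ` carrier (relfree R e (k + l))"
      using image_submodule_join[OF W f(1) f'(1)] by metis
    have z: "(\<lambda>_. \<zero>) \<in> carrier (relfree R e m)" for m by (auto simp: relfree_mem)
    have fz: "f (\<lambda>_. \<zero>) = \<zero>\<^bsub>W\<^esub>" "f' (\<lambda>_. \<zero>) = \<zero>\<^bsub>W\<^esub>"
      using mod_hom_zero[OF left_module_relfree W f(1)] mod_hom_zero[OF left_module_relfree W f'(1)]
      by simp_all
    have "g (unit_tuple R \<one> i) \<in> F ` carrier (relfree R e (k + l))" if "i < Suc j" for i
    proof (cases "i < j")
      case True
      then obtain x where x: "x \<in> carrier (relfree R e k)" "g (unit_tuple R \<one> i) = f x"
        using f(2) by blast
      then show ?thesis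
        using F(2)[OF x(1) z] mod_homD(1)[OF f(1) x(1)] by (simp add: fz)
    next
      case False
      then have "i = j" using that by simp
      then obtain y where y: "y \<in> carrier (relfree R e l)" "g (unit_tuple R \<one> i) = f' y"
        using f'(2) by blast
      then show ?thesis
        using F(2)[OF z y(1)] mod_homD(1)[OF f'(1) y(1)] by (simp add: fz)
    qed
    then show ?case using F(1) by blast
  qed
  from this[OF order.refl] obtain k f where f: "f \<in> mod_hom R (relfree R e k) W"
      "\<And>i. i < n \<Longrightarrow> g (unit_tuple R \<one> i) \<in> f ` carrier (relfree R e k)" by blast
  have "{x \<in> carrier (relfree R \<one> n). g x \<in> f ` carrier (relfree R e k)} = carrier (relfree R \<one> n)"
  proof (rule One.relfree_generated[OF left_submodule_vimage[OF left_module_relfree_one W gh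
          left_submodule_image[OF left_module_relfree W f(1) left_submodule_carrier[OF left_module_relfree]]]])
    show "unit_tuple R \<one> i \<in> {x \<in> carrier (relfree R \<one> n). g x \<in> f ` carrier (relfree R e k)}"
      if "i < n" for i
      using f(2)[OF that] One.unit_tuple_mem[OF that] by simp
  qed
  then have "carrier W \<subseteq> f ` carrier (relfree R e k)"
    unfolding mod_epiD(2)[OF g, symmetric] by blast
  then have "f \<in> mod_epi R (relfree R e k) W"
    by (intro mod_epiI[OF f(1)]) auto
  then show ?thesis using W unfolding idem_generated_def by blast
qed

text \<open>The test module is \<open>W/ReW\<close>, which is finitely generated over
  \<open>R/I\<close> and is copied to \<open>mod_univ\<close>. The projection composed with
  \<open>\<epsilon>\<close> is a cocycle of degree 0, hence zero, so \<open>W = ReW\<close>.\<close>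

lemma ext_vanishes_generated:
  fixes W :: "('a, 'm) module"
  assumes "ext_vanishes 0 W" "pd_le R \<one> n W"
  shows "idem_generated R e W"
proof -
  note W = pd_le_left_module[OF assms(2)] and fg = pd_le_fg[OF assms(2)]
  obtain P d \<epsilon> where P: "projective_resolution R W P d \<epsilon>" using pd_le_resolution[OF assms(2)] by blast
  obtain Y :: "('a set, 'm set) module" and q where Y: "trace_quotient W Y q"
    by (rule trace_quotient_ex[OF W])
  note D = trace_quotientD[OF Y]
  obtain k f where f: "f \<in> mod_epi R (relfree R \<one> k) W" using fg unfolding fg_left_module_iff by blast
  obtain t where t: "t \<in> mod_hom quot_ring (relfree quot_ring \<one>\<^bsub>quot_ring\<^esub> k) Y"
      "\<And>x. x \<in> carrier (relfree R \<one> k) \<Longrightarrow> t (\<lambda>i. I +> x i) = q (f x)"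
    using trace_quotient_map[OF trace_quotient_relfree Y mod_epiD(1)[OF f]] by blast
  have "t \<in> mod_epi quot_ring (relfree quot_ring \<one>\<^bsub>quot_ring\<^esub> k) Y"
    by (rule trace_quotient_epi[OF trace_quotient_relfree Y f t(1)]) (rule t(2))
  then have "fg_left_module quot_ring Y" using D(2) unfolding fg_left_module_iff by blast
  then obtain Y' :: "('a set, 'a set mod_univ) module" and h where h: "fg_left_module quot_ring Y'"
      "h \<in> mod_hom quot_ring Y Y'" "bij_betw h (carrier Y) (carrier Y')"
    by (rule fg_copy)
  note Y' = fg_left_moduleD[OF h(1)]
  have hC: "h \<in> mod_hom R (corner_module R quot_map Y) (corner_module R quot_map Y')"
    by (rule corner_map.mod_hom_corner[OF corner_map_quot h(2)])
  have h0: "h \<zero>\<^bsub>Y\<^esub> = \<zero>\<^bsub>Y'\<^esub>" by (rule mod_hom_zero[OF D(2) Y' h(2)])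
  have q0: "q \<zero>\<^bsub>W\<^esub> = \<zero>\<^bsub>Y\<^esub>" using mod_hom_zero[OF D(1,4) mod_epiD(1)[OF D(3)]] by simp
  note res = projective_resolutionD[OF P]
  have "carrier W \<subseteq> carrier (trace_module R e W)"
  proof
    fix w assume w: "w \<in> carrier W"
    obtain x where x: "x \<in> carrier (P 0)" "\<epsilon> x = w" by (rule mod_epiE[OF res(3) w])
    have "h (q (\<epsilon> x)) = \<zero>\<^bsub>Y'\<^esub>"
    proof (rule ext_vanishes_0D[OF assms(1) P h(1) _ _ x(1)])
      show "(\<lambda>x. h (q (\<epsilon> x))) \<in> mod_hom R (P 0) (corner_module R quot_map Y')"
        by (rule mod_hom_comp[OF mod_hom_comp[OF mod_epiD(1)[OF res(3)] mod_epiD(1)[OF D(3)]] hC])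
      show "h (q (\<epsilon> (d 0 y))) = \<zero>\<^bsub>Y'\<^esub>" if "y \<in> carrier (P (Suc 0))" for y
      proof -
        have "d 0 y \<in> {x \<in> carrier (P 0). \<epsilon> x = \<zero>\<^bsub>W\<^esub>}" unfolding res(4) using that by blast
        then show ?thesis by (simp add: q0 h0)
      qed
    qed
    then have "h (q w) = h \<zero>\<^bsub>Y\<^esub>" using x h0 by simp
    moreover have "q w \<in> carrier Y" using mod_homD(1)[OF mod_epiD(1)[OF D(3)] w] D(5) by simp
    moreover have "\<zero>\<^bsub>Y\<^esub> \<in> carrier Y"
      using left_submoduleD(3)[OF left_submodule_carrier[OF D(2)]] .
    ultimately have "q w = \<zero>\<^bsub>Y\<^esub>" using h(3) by (auto simp: bij_betw_def inj_on_def)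
    then show "w \<in> carrier (trace_module R e W)" using D(6)[OF w] by blast
  qed
  then have "carrier (trace_module R e W) = carrier W" using trace_subset[OF W] by auto
  then show ?thesis by (rule idem_generatedI[OF fg])
qed

lemma relproj_one_relfree: "relproj R \<one> (relfree R e k)"
  using pd_le_one[of 0 "relfree R e k"] by simp

text \<open>Each syzygy along a power of \<open>Re\<close> inherits the vanishing, and since
  \<open>Re\<close> is projective its dimension drops by one. A projective module covered by a power
  of \<open>Re\<close> is a summand of it.\<close>

lemma ext_vanishes_pd_le:
  assumes "\<And>i. ext_vanishes i W" "pd_le R \<one> n W"
  shows "pd_le R e n W"
proof -
  interpret One: idempotent R \<one> by (rule idempotent_one)
  have 0: "relproj R e W" if W: "\<And>i. ext_vanishes i W" "relproj R \<one> W" for W :: "('a, 'm) module"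
  proof -
    have Wm: "left_module R W" using W(2) by (auto simp: relproj_def)
    obtain k f where f: "f \<in> mod_epi R (relfree R e k) W"
      using ext_vanishes_generated[OF W(1), of 0] W(2) by (auto simp: idem_generated_def)
    obtain s where "s \<in> mod_hom R W (relfree R e k)" "\<And>x. x \<in> carrier W \<Longrightarrow> f (s x) = x"
      using One.relproj_lift[OF W(2) left_module_relfree Wm f mod_hom_id] by blast
    then show ?thesis by (rule relprojI[OF Wm _ mod_epiD(1)[OF f]])
  qed
  have step: "\<exists>k. \<exists>f\<in>mod_epi R (relfree R e k) W. left_module R W \<and>
      (\<forall>i. ext_vanishes i (kerm (relfree R e k) W f)) \<and> pd_le R \<one> n (kerm (relfree R e k) W f)"
    if W: "\<And>i. ext_vanishes i W" "pd_le R \<one> (Suc n) W" for W :: "('a, 'm) module" and n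
  proof -
    note Wm = pd_le_left_module[OF W(2)]
    obtain k f where f: "f \<in> mod_epi R (relfree R e k) W"
      using ext_vanishes_generated[OF W] by (auto simp: idem_generated_def)
    have "ext_vanishes i (kerm (relfree R e k) W f)" for i
      by (rule ext_vanishes_syzygy[OF W(1) Wm relproj_one_relfree idem_generated_relfree f])
    moreover have "pd_le R \<one> n (kerm (relfree R e k) W f)"
      by (rule One.pd_le_kernel[OF One.pd_le_mono[of 0] W(2) f]) (simp_all add: relproj_one_relfree)
    ultimately show ?thesis using f Wm by blast
  qed
  have tup: "pd_le R e n W" if "\<And>i. ext_vanishes i W" "pd_le R \<one> n W"
    for W :: "('a, nat \<Rightarrow> 'a) module" and n
    using that
  proof (induction n arbitrary: W)
    case base: 0
    then show ?case using 0[of W] by simp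
  next
    case (Suc n)
    obtain k f where f: "f \<in> mod_epi R (relfree R e k) W" "left_module R W"
      "\<And>i. ext_vanishes i (kerm (relfree R e k) W f)" "pd_le R \<one> n (kerm (relfree R e k) W f)"
      using step[OF Suc.prems] by blast
    show ?case by (rule pd_le_SucI[OF f(2,1) Suc.IH[OF f(3,4)]])
  qed
  show ?thesis
  proof (cases n)
    case base: 0
    then show ?thesis using 0[of W] assms by simp
  next
    case (Suc m)
    obtain k f where f: "f \<in> mod_epi R (relfree R e k) W" "left_module R W"
      "\<And>i. ext_vanishes i (kerm (relfree R e k) W f)" "pd_le R \<one> m (kerm (relfree R e k) W f)"
      using step[OF assms(1) assms(2)[unfolded Suc]] by blast
    show ?thesis unfolding Suc by (rule pd_le_SucI[OF f(2,1) tup[OF f(3,4)]])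
  qed
qed

end

text \<open>
  A group isomorphic to an \<open>Ext\<close> group computed from a resolution that is trivial in the given
  degree is trivial, so every cocycle is a coboundary.
\<close>

lemma cocycle_coboundary:
  assumes Q: "Q (Suc i) = trivial_module" and Y: "left_module S Y" and Y': "left_module R Y'"
    and P: "left_module R (P i)" "left_module R (P (Suc i))" "left_module R (P (Suc (Suc i)))"
    and d: "d i \<in> mod_hom R (P (Suc i)) (P i)"
      "d (Suc i) \<in> mod_hom R (P (Suc (Suc i))) (P (Suc i))"
    and iso: "\<Phi> \<in> iso (ext_group S Q d' Y (Suc i)) (ext_group R P d Y' (Suc i))"
    and g: "g \<in> mod_hom R (P (Suc i)) Y'" "\<And>x. x \<in> carrier (P (Suc (Suc i))) \<Longrightarrow> g (d (Suc i) x) = \<zero>\<^bsub>Y'\<^esub>"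
  shows "\<exists>h\<in>mod_hom R (P i) Y'. \<forall>x\<in>carrier (P (Suc i)). g x = h (d i x)"
proof -
  interpret Y: left_module S Y by fact
  interpret Y': left_module R Y' by fact
  interpret P1: left_module R "P (Suc i)" by fact
  interpret Pi: left_module R "P i" by fact
  let ?Z = "ext_cocycles R P d Y' (Suc i)" and ?H = "ext_coboundaries R P d Y' (Suc i)"
  let ?C = "carrier (P (Suc i))"
  let ?z = "\<lambda>x\<in>?C. \<zero>\<^bsub>Y'\<^esub>" and ?g = "restrict g ?C"
  have gZ: "?g \<in> carrier ?Z"
  proof -
    have "?g \<in> mod_hom R (P (Suc i)) Y'" by (rule mod_hom_cong[OF g(1) P(2)]) simp
    then show ?thesis
      using g(2) mod_homD(1)[OF d(2)] by (simp add: ext_cocycles_def Hom_set_def)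
  qed
  have zZ: "?z \<in> carrier ?Z"
  proof -
    have "?z \<in> mod_hom R (P (Suc i)) Y'"
      by (rule mod_hom_cong[OF mod_hom_const_zero[OF Y'] P(2)]) simp
    then show ?thesis
      using mod_homD(1)[OF d(2)] by (simp add: ext_cocycles_def Hom_set_def)
  qed
  have zH: "?z \<in> ?H"
  proof -
    have "(\<lambda>x\<in>carrier (P i). \<zero>\<^bsub>Y'\<^esub>) \<in> Hom_set R (P i) Y'"
      using mod_hom_cong[OF mod_hom_const_zero[OF Y'] P(1)] by (simp add: Hom_set_def)
    moreover have "?z = compose ?C (\<lambda>x\<in>carrier (P i). \<zero>\<^bsub>Y'\<^esub>) (d i)"
      using mod_homD(1)[OF d(1)] by (auto simp: compose_def fun_eq_iff)
    ultimately show ?thesis by (auto simp: ext_coboundaries_def)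
  qed
  \<comment> \<open>Over \<open>S\<close> the term of the resolution is the zero module, so the zero
    map is the only cocycle and the group has one element.\<close>
  have triv: "c = c'" if "c \<in> carrier (ext_group S Q d' Y (Suc i))" "c' \<in> carrier (ext_group S Q d' Y (Suc i))" for c c'
  proof -
    have "u = u'" if uv: "u \<in> carrier (ext_cocycles S Q d' Y (Suc i))"
      "u' \<in> carrier (ext_cocycles S Q d' Y (Suc i))" for u u'
    proof -
      have T: "left_module S (Q (Suc i))"
        unfolding Q using relproj_trivial[OF Y.R.ring_axioms] by (auto simp: relproj_def)
      have *: "v undefined = \<zero>\<^bsub>Y\<^esub> \<and> v \<in> extensional {undefined}"
        if "v \<in> carrier (ext_cocycles S Q d' Y (Suc i))" for v
      proof -
        have v: "v \<in> mod_hom S (Q (Suc i)) Y" "v \<in> extensional (carrier (Q (Suc i)))"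
          using that by (auto simp: ext_cocycles_def Hom_set_def)
        then show ?thesis using mod_hom_zero[OF T Y v(1)] by (auto simp: Q trivial_module_def)
      qed
      from *[OF uv(1)] *[OF uv(2)] show ?thesis
        by (intro extensionalityI[of u "{undefined}"]) auto
    qed
    then show ?thesis using that by (auto simp: ext_group_def FactGroup_def RCOSETS_def)
  qed
  have eq: "?H #>\<^bsub>?Z\<^esub> ?g = ?H #>\<^bsub>?Z\<^esub> ?z"
  proof -
    let ?E = "ext_group R P d Y' (Suc i)" and ?D = "ext_group S Q d' Y (Suc i)"
    have surj: "\<Phi> ` carrier ?D = carrier ?E" using iso by (simp add: iso_def bij_betw_def)
    have mem: "?H #>\<^bsub>?Z\<^esub> ?g \<in> \<Phi> ` carrier ?D" "?H #>\<^bsub>?Z\<^esub> ?z \<in> \<Phi> ` carrier ?D"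
      unfolding surj using gZ zZ by (auto simp: ext_group_def FactGroup_def RCOSETS_def)
    then obtain c c' where "c \<in> carrier ?D" "c' \<in> carrier ?D" "?H #>\<^bsub>?Z\<^esub> ?g = \<Phi> c" "?H #>\<^bsub>?Z\<^esub> ?z = \<Phi> c'"
      by (elim imageE)
    then show ?thesis using triv[of c c'] by simp
  qed
  \<comment> \<open>The cosets of \<open>g\<close> and of zero agree, so \<open>g\<close> is a
    coboundary plus zero.\<close>
  have "?g \<in> ?H #>\<^bsub>?Z\<^esub> ?g"
  proof -
    have "?z \<otimes>\<^bsub>?Z\<^esub> ?g = ?g"
      using mod_homD(1)[OF g(1)] by (auto simp: ext_cocycles_def fun_eq_iff)
    then show ?thesis using zH unfolding r_coset_def by force
  qed
  then have "?g \<in> ?H #>\<^bsub>?Z\<^esub> ?z" unfolding eq .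
  then obtain u where u: "u \<in> ?H" "?g = u \<otimes>\<^bsub>?Z\<^esub> ?z" unfolding r_coset_def by blast
  obtain h where h: "h \<in> Hom_set R (P i) Y'" "u = compose ?C h (d i)"
    using u(1) by (auto simp: ext_coboundaries_def)
  have hm: "h \<in> mod_hom R (P i) Y'" using h(1) by (simp add: Hom_set_def)
  have "g x = h (d i x)" if x: "x \<in> ?C" for x
  proof -
    have "?g x = h (d i x) \<oplus>\<^bsub>Y'\<^esub> \<zero>\<^bsub>Y'\<^esub>"
      unfolding u(2) h(2) using x by (simp add: ext_cocycles_def compose_def)
    then show ?thesis
      using x mod_homD(1)[OF hm mod_homD(1)[OF d(1) x]] by simp
  qed
  then show ?thesis using hm by blast
qed

context idempotent
begin

text \<open>The isomorphisms are used for a copy \<open>X\<close> of \<open>R/I\<close> in degree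
  \<open>i + 1\<close>. Its resolution \<open>Q\<close> over \<open>R/I\<close> is concentrated in
  degree 0, and splicing the resolution of \<open>I\<close> with \<open>R\<close> gives one of
  \<open>R/I\<close> over \<open>R\<close>, so cocycles on the resolution of \<open>I\<close> become
  coboundaries. For \<open>i = 0\<close> the bounding map is defined on \<open>R\<close> and
  vanishes on \<open>I\<close>.\<close>

lemma strongly_idempotent_ext_vanishes:
  assumes "strongly_idempotent_ideal R I"
  shows "ext_vanishes i (tuples R I 1)"
  unfolding ext_vanishes_def
proof (intro allI impI, elim conjE)
  fix P d \<epsilon> and Y :: "('a set, 'a set mod_univ) module" and g
  assume P: "projective_resolution R (tuples R I 1) P d \<epsilon>" and Y: "fg_left_module quot_ring Y"
    and g: "g \<in> mod_hom R (P i) (corner_module R quot_map Y)"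
    and gd: "\<forall>x\<in>carrier (P (Suc i)). g (d i x) = \<zero>\<^bsub>Y\<^esub>"
  interpret B: idempotent quot_ring "\<one>\<^bsub>quot_ring\<^esub>" by (rule idempotent_quot_one)
  let ?X0 = "relfree quot_ring \<one>\<^bsub>quot_ring\<^esub> 1" and ?F = "relfree R \<one> 1" and ?q = "\<lambda>x i. I +> x i"
  note D = trace_quotientD[OF trace_quotient_relfree[of 1]]
  have F: "relproj R \<one> ?F" by (rule idempotent.relproj_relfree[OF idempotent_one])
  note Fm = left_module_relfree_one[of 1]
  have X0: "relproj quot_ring \<one>\<^bsub>quot_ring\<^esub> ?X0" by simp
  have "fg_left_module quot_ring ?X0" using pd_le_fg[of quot_ring 0 ?X0] X0 by simp
  then obtain X :: "('a set, 'a set mod_univ) module" and h where h: "fg_left_module quot_ring X"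
      "h \<in> mod_hom quot_ring ?X0 X" "bij_betw h (carrier ?X0) (carrier X)"
    by (rule fg_copy)
  note X = fg_left_moduleD[OF h(1)] and Ym = fg_left_moduleD[OF Y]
  let ?CX = "corner_module R quot_map X" and ?CY = "corner_module R quot_map Y"
  have CX: "left_module R ?CX" by (rule corner_map.left_module_corner[OF corner_map_quot X])
  have CY: "left_module R ?CY" by (rule corner_map.left_module_corner[OF corner_map_quot Ym])
  have CXc: "carrier ?CX = carrier X" by (rule left_module_corner_carrier[OF ring_axioms X quot_map_hom])
  have rX: "restrict_scalars quot_map X = ?CX"
    by (rule restrict_scalars_eq_corner[OF ring_axioms X quot_map_hom])
  have rY: "restrict_scalars quot_map Y = ?CY"
    by (rule restrict_scalars_eq_corner[OF ring_axioms Ym quot_map_hom])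
  have hepi: "h \<in> mod_epi R (corner_module R quot_map ?X0) ?CX"
    by (rule corner_map.mod_epi_corner[OF corner_map_quot bij_mod_epi[OF h(2,3)] D(2)])
  have pepi: "(\<lambda>x. h (?q x)) \<in> mod_epi R ?F ?CX" by (rule mod_epi_comp[OF D(3) hepi])
  have "kerm ?F ?CX (\<lambda>x. h (?q x)) = kerm ?F (corner_module R quot_map ?X0) ?q"
  proof (rule kerm_cong)
    fix x assume "x \<in> carrier ?F"
    then have x: "?q x \<in> carrier ?X0" using mod_homD(1)[OF mod_epiD(1)[OF D(3)]] D(5) by blast
    have z: "\<zero>\<^bsub>?X0\<^esub> \<in> carrier ?X0" by (rule left_submoduleD(3)[OF left_submodule_carrier[OF D(2)]])
    have "h \<zero>\<^bsub>?X0\<^esub> = \<zero>\<^bsub>X\<^esub>" by (rule mod_hom_zero[OF D(2) X h(2)])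
    then have "h (?q x) = \<zero>\<^bsub>X\<^esub> \<longleftrightarrow> ?q x = \<zero>\<^bsub>?X0\<^esub>"
      using inj_on_eq_iff[OF bij_betw_imp_inj_on[OF h(3)] x z] by simp
    then show "h (?q x) = \<zero>\<^bsub>?CX\<^esub> \<longleftrightarrow> ?q x = \<zero>\<^bsub>corner_module R quot_map ?X0\<^esub>" by simp
  qed
  then have ker: "kerm ?F ?CX (\<lambda>x. h (?q x)) = tuples R I 1" by (simp only: kerm_trace_quotient[OF trace_quotient_relfree] trace_relfree_one)
  obtain P' d' \<epsilon>' j where P': "projective_resolution R ?CX P' d' \<epsilon>'" "\<And>i. P' (Suc i) = P i"
    "\<And>i. d' (Suc i) = d i" "j \<in> mod_hom R ?F (P' 0)"
    "bij_betw j (carrier ?F) (carrier (P' 0))" "\<And>x. x \<in> carrier ?F \<Longrightarrow> \<epsilon>' (j x) = h (?q x)"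
    "\<And>x. d' 0 x = j (\<epsilon> x)"
    by (rule projective_resolution_splice[OF CX F pepi P[folded ker]]) (rule that)
  note res' = projective_resolutionD[OF P'(1)]
  have Pm: "left_module R (P' n)" for n using res'(1)[of n] by (simp add: relproj_def)
  have Xp: "relproj quot_ring \<one>\<^bsub>quot_ring\<^esub> X"
    using pd_le_iso[OF X h(2,3), of "\<one>\<^bsub>quot_ring\<^esub>" 0] X0 by simp
  have Xid: "(\<lambda>x. x) \<in> mod_epi quot_ring X X" by (rule mod_epiI[OF mod_hom_id]) auto
  have Xk: "projective_resolution quot_ring (kerm X X (\<lambda>x. x)) (\<lambda>_. trivial_module) (\<lambda>_ _. undefined)
      (\<lambda>_. \<zero>\<^bsub>kerm X X (\<lambda>x. x)\<^esub>)"
    by (rule projective_resolution_trivial[OF left_module_kerm[OF X X mod_hom_id] kerm_id_trivial[OF X]])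
  obtain Q b \<eta> l where Q: "projective_resolution quot_ring X Q b \<eta>" "\<And>i. Q (Suc i) = trivial_module"
    "l \<in> mod_hom quot_ring X (Q 0)" "\<And>x. x \<in> carrier X \<Longrightarrow> \<eta> (l x) = x"
    by (rule projective_resolution_splice[OF X Xp Xid Xk]) (rule that)
  note resQ = projective_resolutionD[OF Q(1)]
  have Qm: "left_module quot_ring (Q n)" for n using resQ(1)[of n] by (simp add: relproj_def)
  have rQ: "restrict_scalars quot_map (Q n) = corner_module R quot_map (Q n)" for n
    by (rule restrict_scalars_eq_corner[OF ring_axioms Qm quot_map_hom])
  have CQ: "left_module R (corner_module R quot_map (Q n))" for n
    by (rule corner_map.left_module_corner[OF corner_map_quot Qm])
  \<comment> \<open>A comparison map can only be zero in positive degrees, where \<open>Q\<close> is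
    trivial; in degree 0 it is the augmentation followed by the inverse \<open>l\<close> of the
    augmentation of \<open>Q\<close>.\<close>
  define f where "f = (\<lambda>n x. case n of 0 \<Rightarrow> l (\<epsilon>' x) | Suc m \<Rightarrow> \<zero>\<^bsub>Q n\<^esub>)"
  have lC: "l \<in> mod_hom R ?CX (corner_module R quot_map (Q 0))"
    by (rule corner_map.mod_hom_corner[OF corner_map_quot Q(3)])
  have cm: "comparison_map R quot_map X P' d' \<epsilon>' Q b \<eta> f"
    unfolding comparison_map_def rQ
  proof (intro conjI allI ballI)
    show "f n \<in> mod_hom R (P' n) (corner_module R quot_map (Q n))" for n
    proof (cases n)
      case 0
      then show ?thesis using mod_hom_comp[OF mod_epiD(1)[OF res'(3)] lC] by (simp add: f_def)
    next
      case (Suc m)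
      then show ?thesis using mod_hom_const_zero[OF CQ[of n], of "P' n"] by (simp add: f_def)
    qed
    show "\<eta> (f 0 x) = \<epsilon>' x" if "x \<in> carrier (P' 0)" for x
      using Q(4) mod_homD(1)[OF mod_epiD(1)[OF res'(3)] that] CXc by (simp add: f_def)
    show "b n (f (Suc n) x) = f n (d' n x)" if "x \<in> carrier (P' (Suc n))" for n x
    proof -
      have "b n (f (Suc n) x) = \<zero>\<^bsub>Q n\<^esub>"
        using mod_hom_zero[OF Qm Qm resQ(2)[of n]] by (simp add: f_def)
      moreover have "f n (d' n x) = \<zero>\<^bsub>Q n\<^esub>"
      proof (cases n)
        case 0
        have "d' 0 x \<in> {x \<in> carrier (P' 0). \<epsilon>' x = \<zero>\<^bsub>?CX\<^esub>}"
          unfolding res'(4) using that 0 by blast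
        then show ?thesis using mod_hom_zero[OF X Qm Q(3)] by (simp add: 0 f_def)
      qed (simp add: f_def)
      ultimately show ?thesis by simp
    qed
  qed
  have iso: "ext_natural_map R quot_map P' d' f Y (Suc i) \<in>
      iso (ext_group quot_ring Q b Y (Suc i)) (ext_group R P' d' ?CY (Suc i))"
    using assms h(1) Y P'(1) Q(1) cm unfolding strongly_idempotent_ideal_def rX[symmetric] rY[symmetric]
    by blast
  have "\<exists>t\<in>mod_hom R (P' i) ?CY. \<forall>x\<in>carrier (P' (Suc i)). g x = t (d' i x)"
    by (rule cocycle_coboundary[OF Q(2) Ym CY Pm Pm Pm res'(2) res'(2) iso])
      (use g gd P'(2,3) in simp_all)
  then obtain t where t: "t \<in> mod_hom R (P' i) ?CY" "\<And>x. x \<in> carrier (P i) \<Longrightarrow> g x = t (d' i x)"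
    using P'(2) by auto
  show "case i of 0 \<Rightarrow> \<forall>x\<in>carrier (P 0). g x = \<zero>\<^bsub>Y\<^esub>
      | Suc j \<Rightarrow> \<exists>h\<in>mod_hom R (P j) ?CY. \<forall>x\<in>carrier (P (Suc j)). g x = h (d j x)"
  proof (cases i)
    case 0
    have tj: "(\<lambda>x. t (j x)) \<in> mod_hom R ?F ?CY" using mod_hom_comp[OF P'(4)] t(1) 0 by simp
    have "g x = \<zero>\<^bsub>Y\<^esub>" if x: "x \<in> carrier (P 0)" for x
    proof -
      have "\<epsilon> x \<in> carrier (tuples R I 1)"
        by (rule mod_homD(1)[OF mod_epiD(1)[OF projective_resolutionD(3)[OF P]] x])
      then have "\<epsilon> x \<in> carrier (trace_module R e ?F)" by (simp only: trace_relfree_one)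
      then have "t (j (\<epsilon> x)) = \<zero>\<^bsub>Y\<^esub>" by (rule hom_trace_quot_zero[OF Fm Ym tj])
      then show ?thesis using t(2)[of x] x 0 P'(7) by simp
    qed
    then show ?thesis by (simp add: 0)
  next
    case (Suc m)
    then show ?thesis using t P'(2,3) by auto
  qed
qed

section \<open>Assembly of the bounds\<close>

lemma left_ideal_module_tuples:
  assumes "left_ideal T R"
  shows "left_module R (left_ideal_module R T)"
    and "(\<lambda>x i. if i = 0 then x else \<zero>) \<in> mod_hom R (left_ideal_module R T) (tuples R T 1)"
    and "bij_betw (\<lambda>x i. if i = 0 then x else \<zero>) (carrier (left_ideal_module R T)) (carrier (tuples R T 1))"
proof -
  note D = left_idealD[OF assms]
  show "left_module R (left_ideal_module R T)"
  proof (rule left_moduleI[OF ring_axioms], goal_cases)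
    case (6 x)
    then show ?case using D by (simp add: left_ideal_module_def l_minus l_neg)
  qed (auto simp: left_ideal_module_def D a_assoc l_distr r_distr m_assoc l_minus l_neg intro!: a_comm)
  show "(\<lambda>x i. if i = 0 then x else \<zero>) \<in> mod_hom R (left_ideal_module R T) (tuples R T 1)"
    by (rule mod_homI) (auto simp: left_ideal_module_def tuples_mem[OF assms] D fun_eq_iff)
  show "bij_betw (\<lambda>x i. if i = 0 then x else \<zero>) (carrier (left_ideal_module R T)) (carrier (tuples R T 1))"
    by (rule bij_betw_byWitness[where f' = "\<lambda>x. x 0"])
      (auto simp: left_ideal_module_def tuples_mem[OF assms] D fun_eq_iff)
qed

text \<open>The summand \<open>s + 1\<close> counts the syzygies needed to reach a module with
  finitely resolved trace, and the maximum bounds the dimension of such a module.\<close>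

lemma fin_dim_bound:
  assumes I1: "pd_le R \<one> m (tuples R I 1)" and fin: "fin_pd R e (tuples R I 1)"
    and s: "fin_dim (corner_ring R e) = enat s" and t: "fin_dim quot_ring = enat t"
  shows "pd_le R \<one> s (tuples R I 1)"
    and "pd_le R \<one> n X \<Longrightarrow> pd_le R \<one> (s + 1 + max s (t + Suc m)) X"
proof -
  obtain m' where m': "pd_le R e m' (tuples R I 1)" using fin by (auto simp: fin_pd_def)
  have corner: "pd_le (corner_ring R e) e s (idem_corner R e X)" if "pd_le R \<one> n X" for X :: "('a, 'm) module" and n
  proof -
    \<comment> \<open>Since \<open>eI = eR\<close>, the resolution of \<open>I\<close> by powers of
      \<open>Re\<close> bounds \<open>eR\<close> over the corner ring. Thus \<open>eX\<close> has
      finite dimension there, and the finitistic dimension improves any finite bound to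
      \<open>s\<close>.\<close>
    have "pd_le (corner_ring R e) e m' (idem_corner R e (relfree R \<one> 1))"
      using pd_le_idem_corner[OF m'] idem_corner_trace[OF left_module_relfree_one[of 1]]
      by (simp only: trace_relfree_one)
    then have "pd_le (corner_ring R e) e (n + m') (idem_corner R e X)"
      unfolding idem_corner_def
      by (rule corner_map.pd_le_corner[OF corner_map_incl idempotent_corner idempotent_one _ that])
    then have "pd_le (corner_ring R e) \<one>\<^bsub>corner_ring R e\<^esub> (n + m') (idem_corner R e X)" by simp
    from fin_dim_pd_le[OF this s] show ?thesis by simp
  qed
  \<comment> \<open>The source of \<open>pd(I) \<le> s\<close>: the dimension of \<open>eI\<close>
    is at most \<open>s\<close>, and \<open>I\<close> has a finite resolution by powers of
    \<open>Re\<close>, so the bound is reflected.\<close>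
  show "pd_le R \<one> s (tuples R I 1)"
    by (rule pd_le_one[OF pd_le_idem_corner_reflect[OF m' corner[OF I1]]])
  assume X: "pd_le R \<one> n X"
  show "pd_le R \<one> (s + 1 + max s (t + Suc m)) X"
  proof (rule pd_le_syzygies[OF fin _ corner[OF X] X])
    fix Z :: "('a, nat \<Rightarrow> 'a) module" and n
    assume Z: "trace_fin_pd Z" "pd_le R \<one> n Z"
    obtain Y :: "('a set, (nat \<Rightarrow> 'a) set) module" and q where Y: "trace_quotient Z Y q"
      by (rule trace_quotient_ex[OF pd_le_left_module[OF Z(2)]])
    have "pd_le quot_ring \<one>\<^bsub>quot_ring\<^esub> t Y"
      by (rule fin_dim_pd_le[OF pd_le_trace_quotient[OF fin Z Y] t])
    then show "pd_le R \<one> (max s (t + Suc m)) Z"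
      by (rule pd_le_trace_fin_pd[OF Z(1) corner[OF Z(2)] Y _ I1])
  qed
qed

end

theorem theorem3p5:
  fixes k :: "('k, 'x) ring_scheme" and \<phi> :: "'k \<Rightarrow> 'a"
    and A :: "('a, 'y) ring_scheme" and e :: 'a and AeA :: "'a set"
  assumes "artin_algebra k \<phi> A"
    and "e \<in> carrier A" and "e \<otimes>\<^bsub>A\<^esub> e = e"
    and "AeA = Idl\<^bsub>A\<^esub> {e}"
    and "strongly_idempotent_ideal A AeA"
    and "proj_dim A (left_ideal_module A AeA) < \<infinity>"
  shows "fin_dim A \<le> max (2 * fin_dim (corner_ring A e) + 1)
             (proj_dim A (left_ideal_module A AeA) + fin_dim (corner_ring A e)
                + fin_dim (A Quot AeA) + 2)
         \<and> fin_dim A \<le> 2 * fin_dim (corner_ring A e) + fin_dim (A Quot AeA) + 2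
         \<and> (fin_dim (A Quot AeA) < \<infinity> \<and> fin_dim (corner_ring A e) < \<infinity> \<longrightarrow> fin_dim A < \<infinity>)"
proof -
  interpret ring A using assms(1) by (simp add: artin_algebra_def)
  interpret idempotent A e
    using assms(2,3) by (intro idempotent.intro ring_axioms idempotent_axioms.intro)
  note iso = left_ideal_module_tuples[OF left_ideal_I]
  obtain m where m: "proj_dim A (left_ideal_module A AeA) = enat m"
    using assms(6) by (auto simp: less_infinityE)
  have "pd_le A \<one>\<^bsub>A\<^esub> m (left_ideal_module A AeA)"
    using proj_dim_le_iff[OF iso(1), of m] m assms(4) by simp
  then have I1: "pd_le A \<one>\<^bsub>A\<^esub> m (tuples A AeA 1)"
    using pd_le_iso[OF left_module_tuples[OF ring_axioms left_ideal_I] iso(2,3)] assms(4) by simp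
  have fin: "fin_pd A e (tuples A AeA 1)"
    using ext_vanishes_pd_le[OF strongly_idempotent_ext_vanishes] assms(4,5) I1 unfolding fin_pd_def by blast
  show ?thesis
  proof (cases "fin_dim (corner_ring A e) = \<infinity> \<or> fin_dim (A Quot AeA) = \<infinity>")
    \<comment> \<open>Both right-hand sides are infinite, and the last claim has a false
      premise.\<close>
    case True
    then show ?thesis by (auto simp: m max_def numeral_eq_enat)
  next
    case False
    then obtain s t where st: "fin_dim (corner_ring A e) = enat s" "fin_dim (A Quot AeA) = enat t"
      by auto
    note bound = fin_dim_bound[of m s t, folded assms(4), OF I1 fin st]
    have "pd_le A \<one>\<^bsub>A\<^esub> s (left_ideal_module A AeA)"
      using pd_le_iso[OF iso(1) inv_into_mod_hom[OF iso(1-3)] bij_betw_inv_into[OF iso(3)]] bound(1)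
        assms(4) by simp
    then have ms: "m \<le> s" using proj_dim_le_iff[OF iso(1), of s] m assms(4) by simp
    have le: "fin_dim A \<le> enat (s + 1 + max s (t + Suc m))"
      unfolding fin_dim_def
    proof (rule Sup_least, elim CollectE exE conjE)
      fix p and X :: "('a, 'a mod_univ) module"
      assume X: "p = proj_dim A X" "fg_left_module A X" "proj_dim A X < \<infinity>"
      then obtain n where "proj_dim A X = enat n" by (auto simp: less_infinityE)
      then have "pd_le A \<one>\<^bsub>A\<^esub> n X" using proj_dim_le_iff[OF fg_left_moduleD[OF X(2)], of n] by simp
      from bound(2)[OF this]
      show "p \<le> enat (s + 1 + max s (t + Suc m))"
        using proj_dim_le_iff[OF fg_left_moduleD[OF X(2)]] X(1) by blast
    qed
    \<comment> \<open>Distributing \<open>s + 1\<close> over the maximum gives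
      \<open>2 s + 1\<close> and \<open>m + s + t + 2\<close>; the bound \<open>m \<le> s\<close>
      then turns the latter into \<open>2 s + t + 2\<close>, which also exceeds the former.\<close>
    have "enat (s + 1 + max s (t + Suc m)) \<le> max (2 * enat s + 1) (enat m + enat s + enat t + 2)"
      by (simp add: numeral_eq_enat one_enat_def max_def)
    moreover have "enat (s + 1 + max s (t + Suc m)) \<le> 2 * enat s + enat t + 2"
      using ms by (simp add: numeral_eq_enat one_enat_def max_def)
    moreover have "fin_dim A < \<infinity>" using le by (rule order.strict_trans1) simp
    ultimately show ?thesis unfolding st m using le by (auto intro: order.trans)
  qed
qed

end
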